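(* Let $\mathbb{F}_q$ be a finite field, let $d$ and $k$ be positive integers with $k>d$, let $f=T^{k+d}+f_{d-1}T^{k+d-1}+\cdots+f_0T^k\in\mathbb{F}_q[T]$, and let $V_f\subset\mathbb{A}^{k+1}$ be the hypersurface defined by the polynomial $H_f\in\mathbb{F}_q[X_1,\ldots,X_{k+1}]$ associated to $f$. Then the singular locus $\Sigma_f\subset\mathbb{A}^{k+1}$ of $V_f$ has dimension at most $d-1$.
   Context: $\mathbb{A}^{n}$ denotes affine $n$-space over the algebraic closure $\overline{\mathbb{F}}_q$. Given $f=T^{k+d}+f_{d-1}T^{k+d-1}+\cdots+f_0T^k\in\mathbb{F}_q[T]$, put $Q=(T-X_1)\cdots(T-X_{k+1})\in\mathbb{F}_q[X_1,\ldots,X_{k+1}][T]$ and let $R_f\in\mathbb{F}_q[X_1,\ldots,X_{k+1}][T]$ be the unique polynomial of degree at most $k$ in $T$ with $f\equiv R_f \bmod Q$. The polynomial $H_f\in\mathbb{F}_q[X_1,\ldots,X_{k+1}]$ associated to $f$ is the coefficient of $T^k$ in $R_f$. $V_f\subset\mathbb{A}^{k+1}$ is the set of zeros of $H_f$ in $\mathbb{A}^{k+1}$. For an affine variety $V\subset\mathbb{A}^n$ with defining ideal $I(V)=(F_1,\ldots,F_m)\subset\overline{\mathbb{F}}_q[X_1,\ldots,X_n]$ and $\mathbf{x}\in V$, the tangent space $\mathcal{T}_{\mathbf{x}}V$ is the kernel of the Jacobian matrix $(\partial F_i/\partial X_j)(\mathbf{x})$, and $\dim_{\mathbf{x}}V$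 is the maximum of the dimensions of the irreducible components of $V$ containing $\mathbf{x}$. The point $\mathbf{x}$ is singular if $\dim\mathcal{T}_{\mathbf{x}}V\neq\dim_{\mathbf{x}}V$; the singular locus of $V$ is the set of its singular points. *)

theory Defs
  imports
    "HOL-Library.Poly_Mapping"
    "HOL-Library.Extended_Real"
    "HOL-Algebra.Algebraic_Closure_Type"
    "Jordan_Normal_Form.Matrix_Kernel"
begin

section \<open>Multivariate polynomials\<close>

text \<open>
  A monomial is a finitely supported exponent function and a polynomial is a finitely supported
  family of coefficients.  The type has the countably many variables \<open>X\<^sub>0, X\<^sub>1, \<dots>\<close>; the ring in
  \<open>n\<close> variables is the subring \<open>mpolys n\<close> of polynomials in \<open>X\<^sub>0, \<dots>, X\<^bsub>n-1\<^esub>\<close>.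
\<close>

type_synonym 'a mpoly = "(nat \<Rightarrow>\<^sub>0 nat) \<Rightarrow>\<^sub>0 'a"

definition mpolys :: "nat \<Rightarrow> 'a::zero mpoly set" where
  "mpolys n = {F. \<forall>m \<in> Poly_Mapping.keys F. Poly_Mapping.keys m \<subseteq> {..<n}}"

definition mvar :: "nat \<Rightarrow> 'a::comm_ring_1 mpoly" where
  "mvar i = Poly_Mapping.single (Poly_Mapping.single i 1) 1"

definition mconst :: "'a::comm_ring_1 \<Rightarrow> 'a mpoly" where
  "mconst c = Poly_Mapping.single 0 c"

definition meval :: "'a::comm_ring_1 vec \<Rightarrow> 'a mpoly \<Rightarrow> 'a" where
  "meval x F = (\<Sum>m \<in> Poly_Mapping.keys F.
     Poly_Mapping.lookup F m *
     (\<Prod>i \<in> Poly_Mapping.keys m. (x $ i) ^ Poly_Mapping.lookup m i))"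

text \<open>
  The exponent subtraction is truncated, but only where the coefficient \<open>of_nat 0\<close> vanishes.
\<close>

definition mpderiv :: "nat \<Rightarrow> 'a::comm_ring_1 mpoly \<Rightarrow> 'a mpoly" where
  "mpderiv j F = (\<Sum>m \<in> Poly_Mapping.keys F.
     Poly_Mapping.single (m - Poly_Mapping.single j 1)
       (of_nat (Poly_Mapping.lookup m j) * Poly_Mapping.lookup F m))"

section \<open>Affine varieties\<close>

text \<open>Affine \<open>n\<close>-space over a field is \<open>carrier_vec n\<close>.\<close>

definition zeros :: "nat \<Rightarrow> 'a::field mpoly set \<Rightarrow> 'a vec set" where
  "zeros n S = {x \<in> carrier_vec n. \<forall>F \<in> S. meval x F = 0}"

definition vanishing_ideal :: "nat \<Rightarrow> 'a::field vec set \<Rightarrow> 'a mpoly set" where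
  "vanishing_ideal n V = {F \<in> mpolys n. \<forall>x \<in> V. meval x F = 0}"

definition affine_variety :: "nat \<Rightarrow> 'a::field vec set \<Rightarrow> bool" where
  "affine_variety n V \<longleftrightarrow> (\<exists>S \<subseteq> mpolys n. V = zeros n S)"

definition irreducible_variety :: "nat \<Rightarrow> 'a::field vec set \<Rightarrow> bool" where
  "irreducible_variety n V \<longleftrightarrow> affine_variety n V \<and> V \<noteq> {} \<and>
     (\<forall>V\<^sub>1 V\<^sub>2. affine_variety n V\<^sub>1 \<and> affine_variety n V\<^sub>2 \<and> V = V\<^sub>1 \<union> V\<^sub>2 \<longrightarrow> V = V\<^sub>1 \<or> V = V\<^sub>2)"

definition irreducible_component :: "nat \<Rightarrow> 'a::field vec set \<Rightarrow> 'a vec set \<Rightarrow> bool" where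
  "irreducible_component n V Z \<longleftrightarrow> irreducible_variety n Z \<and> Z \<subseteq> V \<and>
     (\<forall>Z'. irreducible_variety n Z' \<and> Z \<subseteq> Z' \<and> Z' \<subseteq> V \<longrightarrow> Z' = Z)"

definition zariski_closure :: "nat \<Rightarrow> 'a::field vec set \<Rightarrow> 'a vec set" where
  "zariski_closure n S = zeros n (vanishing_ideal n S)"

text \<open>
  The dimension is the largest length \<open>r\<close> of a chain \<open>Z\<^sub>0 \<subset> \<dots> \<subset> Z\<^sub>r\<close> of irreducible varieties.
  The closure makes this meaningful for every subset of affine space; it changes nothing for
  varieties.  The dimension of the empty set is \<open>-\<infinity>\<close>.
\<close>

definition variety_dim :: "nat \<Rightarrow> 'a::field vec set \<Rightarrow> ereal" where
  "variety_dim n S = Sup {ereal (real r) | r. \<exists>Z :: nat \<Rightarrow> 'a vec set.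
     (\<forall>i \<le> r. irreducible_variety n (Z i) \<and> Z i \<subseteq> zariski_closure n S) \<and>
     (\<forall>i < r. Z i \<subset> Z (Suc i))}"

definition local_dim :: "nat \<Rightarrow> 'a::field vec set \<Rightarrow> 'a vec \<Rightarrow> ereal" where
  "local_dim n V x = Sup {variety_dim n Z | Z. irreducible_component n V Z \<and> x \<in> Z}"

section \<open>Tangent spaces and singular points\<close>

definition generates_ideal :: "nat \<Rightarrow> 'a::field mpoly list \<Rightarrow> 'a mpoly set \<Rightarrow> bool" where
  "generates_ideal n Fs I \<longleftrightarrow> set Fs \<subseteq> mpolys n \<and>
     I = {\<Sum>i<length Fs. G i * Fs ! i | G. \<forall>i<length Fs. G i \<in> mpolys n}"

definition jacobian_matrix :: "nat \<Rightarrow> 'a::field mpoly list \<Rightarrow> 'a vec \<Rightarrow> 'a mat" where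
  "jacobian_matrix n Fs x = mat (length Fs) n (\<lambda>(i, j). meval x (mpderiv j (Fs ! i)))"

text \<open>
  For \<open>x \<in> V\<close>, the tangent space of \<open>V\<close> at \<open>x\<close> is \<open>mat_kernel (jacobian_matrix n Fs x)\<close>, where
  \<open>Fs\<close> generates the vanishing ideal of \<open>V\<close>.  Such an \<open>Fs\<close> exists by Hilbert's basis theorem,
  and by the product rule the kernel does not depend on its choice, so that the existential
  quantifier below could equivalently be a universal one.
\<close>

definition singular_point :: "nat \<Rightarrow> 'a::field vec set \<Rightarrow> 'a vec \<Rightarrow> bool" where
  "singular_point n V x \<longleftrightarrow> x \<in> V \<and>
     (\<exists>Fs. generates_ideal n Fs (vanishing_ideal n V) \<and>
        ereal (real (kernel_dim (jacobian_matrix n Fs x))) \<noteq> local_dim n V x)"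

definition singular_locus :: "nat \<Rightarrow> 'a::field vec set \<Rightarrow> 'a vec set" where
  "singular_locus n V = {x. singular_point n V x}"

section \<open>The hypersurface associated to a polynomial\<close>

text \<open>The variables \<open>X\<^sub>1, \<dots>, X\<^bsub>k+1\<^esub>\<close> are \<open>mvar 0, \<dots>, mvar k\<close>.\<close>

definition Q_poly :: "nat \<Rightarrow> 'a::field mpoly poly" where
  "Q_poly k = (\<Prod>i<k + 1. [:- mvar i, 1:])"

text \<open>
  As \<open>Q_poly k\<close> is monic of degree \<open>k + 1\<close> in \<open>T\<close>, the remainder exists, is unique even among
  polynomials over the ring in all variables, and has its coefficients in \<open>mpolys (k + 1)\<close>.
\<close>

definition R_poly :: "nat \<Rightarrow> 'a::field poly \<Rightarrow> 'a mpoly poly" where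
  "R_poly k f = (THE R. Polynomial.degree R \<le> k \<and> Q_poly k dvd map_poly mconst f - R)"

definition H_poly :: "nat \<Rightarrow> 'a::field poly \<Rightarrow> 'a mpoly" where
  "H_poly k f = Polynomial.coeff (R_poly k f) k"

definition V_hyp :: "nat \<Rightarrow> 'a::field poly \<Rightarrow> 'a alg_closure vec set" where
  "V_hyp k f = zeros (k + 1) {Poly_Mapping.map to_ac (H_poly k f)}"

end

theory Submission
  imports Defs "Subresultants.More_Homomorphisms"
begin

text \<open>
  \<^bold>\<open>Where the gradient vanishes.\<close>  The value of \<open>H\<^sub>f\<close> at \<open>x\<close> is the divided difference \<open>f[x\<^sub>0, \<dots>, x\<^sub>k]\<close>, and
  the recursion of divided differences gives \<open>\<partial>H\<^sub>f/\<partial>X\<^sub>i (x) = f[x\<^sub>0, \<dots>, x\<^sub>k, x\<^sub>i] = S\<^sub>x(x\<^sub>i)\<close>, where \<open>S\<^sub>x\<close> is the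
  quotient of \<open>f\<close> by \<open>(T - x\<^sub>0) \<cdots> (T - x\<^sub>k)\<close> (\<open>H_poly_shift\<close>, \<open>gradient_H_poly_ac\<close>).  This quotient is monic of
  degree \<open>d - 1\<close>.  So a point at which the gradient of \<open>H\<^sub>f\<close> vanishes has at most \<open>d - 1\<close> distinct
  coordinates, all being roots of \<open>S\<^sub>x\<close>, and it lies in one of finitely many linear subspaces of
  dimension \<open>d - 1\<close>.

  \<^bold>\<open>Why the remaining points are nonsingular.\<close>  Singularity is defined through generators of the
  vanishing ideal and the local dimension, so two facts have to be shown at a point with nonzero
  gradient.  Both use that \<open>H\<^sub>f\<close> is monic in its last variable, and hold for any such hypersurface.

  The tangent space is a hyperplane.  If \<open>F\<close> vanishes on the hypersurface then \<open>H\<^sub>f\<close> divides a power of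
  \<open>F\<close> (\<open>monic_nullstellensatz\<close>).  Every direction orthogonal to the gradient is the velocity of a curve
  on which \<open>H\<^sub>f\<close> vanishes to high order (\<open>smooth_curve\<close>); there \<open>F\<close> vanishes to second order, so its
  derivative in this direction is zero (\<open>tangent_direction_kills\<close>).

  The local dimension is \<open>k\<close>.  An irreducible factor of \<open>H\<^sub>f\<close> over the field of rational functions in the
  other variables defines a prime ideal whose variety is a component through the point.  Setting
  these variables to zero one after the other, and following an irreducible factor through the
  specialisations, yields a strictly decreasing chain of irreducible varieties of length \<open>k\<close>
  (\<open>factor_specialises\<close>, \<open>hypersurface_chain_through_point\<close>).  A factor can be followed because the norm
  of a polynomial modulo \<open>H\<^sub>f\<close> commutes with specialisation, and because an ideal is not a finite union
  of proper subspaces.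

  \<^bold>\<open>Bounding dimensions.\<close>  A strictly increasing chain \<open>Z\<^sub>0 \<subset> \<dots> \<subset> Z\<^sub>r\<close> of irreducible varieties gives \<open>r\<close>
  polynomials that are algebraically independent on \<open>Z\<^sub>r\<close> (\<open>chain_independent\<close>), whereas more than \<open>m\<close>
  polynomials in \<open>m\<close> variables are dependent, as is seen by counting monomials
  (\<open>algebraically_dependent\<close>).  So a set covered by finitely many polynomial images of affine
  \<open>m\<close>-space has dimension at most \<open>m\<close> (\<open>variety_dim_le\<close>).  This bounds the singular locus by \<open>d - 1\<close>, and
  also the dimension of every component of the hypersurface by \<open>k\<close>.
\<close>

(* degree and lead_coeff are those of the polynomial type, not of the list representation *)
hide_const (open) Polynomials.degree Polynomials.lead_coeff

section \<open>Substitution into multivariate polynomials\<close>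

definition mon_inst :: "(nat \<Rightarrow> 'b::comm_ring_1) \<Rightarrow> (nat \<Rightarrow>\<^sub>0 nat) \<Rightarrow> 'b" where
  "mon_inst p m = (\<Prod>i\<in>Poly_Mapping.keys m. p i ^ Poly_Mapping.lookup m i)"

text \<open>
  The ring homomorphism extending \<open>h\<close> that sends \<open>X\<^sub>i\<close> to \<open>p i\<close>.  The target ring is arbitrary, so that
  this one operation is evaluation at a point, restriction to a curve (target \<open>K[t]\<close>), restriction to
  a coordinate subspace, and the passage to polynomials in a distinguished variable.
\<close>

definition minst :: "('a::comm_ring_1 \<Rightarrow> 'b::comm_ring_1) \<Rightarrow> (nat \<Rightarrow> 'b) \<Rightarrow> 'a mpoly \<Rightarrow> 'b" where
  "minst h p F = (\<Sum>m\<in>Poly_Mapping.keys F. h (Poly_Mapping.lookup F m) * mon_inst p m)"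

lemma meval_eq_minst: "meval x F = minst (\<lambda>c. c) (\<lambda>i. x $ i) F"
  by (simp add: meval_def minst_def mon_inst_def)

lemma mon_inst_superset:
  assumes "finite S" "Poly_Mapping.keys m \<subseteq> S"
  shows "mon_inst p m = (\<Prod>i\<in>S. p i ^ Poly_Mapping.lookup m i)"
  unfolding mon_inst_def by (rule prod.mono_neutral_left) (use assms in \<open>auto simp: in_keys_iff\<close>)

lemma mon_inst_0 [simp]: "mon_inst p 0 = 1"
  by (simp add: mon_inst_def)

lemma mon_inst_add: "mon_inst p (m + m') = mon_inst p m * mon_inst p m'"
proof -
  let ?S = "Poly_Mapping.keys m \<union> Poly_Mapping.keys m'"
  have "mon_inst p (m + m') = (\<Prod>i\<in>?S. p i ^ Poly_Mapping.lookup (m + m') i)"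
    by (rule mon_inst_superset) (use keys_add in \<open>force\<close>)+
  also have "\<dots> = mon_inst p m * mon_inst p m'"
    by (simp add: mon_inst_superset[of ?S] lookup_add power_add prod.distrib)
  finally show ?thesis .
qed

lemma mon_inst_single: "mon_inst p (Poly_Mapping.single i n) = p i ^ n"
  by (simp add: mon_inst_def)

lemma mon_inst_cong:
  assumes "\<And>i. i \<in> Poly_Mapping.keys m \<Longrightarrow> p i = q i"
  shows "mon_inst p m = mon_inst q m"
  unfolding mon_inst_def by (rule prod.cong) (auto simp: assms)

lemma mpoly_as_sum: "F = (\<Sum>m\<in>Poly_Mapping.keys F. Poly_Mapping.single m (Poly_Mapping.lookup F m))"
proof (rule poly_mapping_eqI)
  fix k
  have "Poly_Mapping.lookup (\<Sum>m\<in>Poly_Mapping.keys F. Poly_Mapping.single m (Poly_Mapping.lookup F m)) k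
      = (\<Sum>m\<in>Poly_Mapping.keys F. if m = k then Poly_Mapping.lookup F m else 0)"
    by (simp add: lookup_sum lookup_single when_def)
  also have "\<dots> = Poly_Mapping.lookup F k"
    by (simp add: in_keys_iff)
  finally show "Poly_Mapping.lookup F k = Poly_Mapping.lookup
     (\<Sum>m\<in>Poly_Mapping.keys F. Poly_Mapping.single m (Poly_Mapping.lookup F m)) k" by simp
qed

lemma mpolys_induct [consumes 1, case_names single add]:
  fixes F :: "'a::comm_ring_1 mpoly"
  assumes F: "F \<in> mpolys n"
    and single: "\<And>m c. Poly_Mapping.keys m \<subseteq> {..<n} \<Longrightarrow> P (Poly_Mapping.single m c)"
    and add: "\<And>G G'. P G \<Longrightarrow> P G' \<Longrightarrow> P (G + G')"
  shows "P F"
proof -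
  have "P (\<Sum>m\<in>S. Poly_Mapping.single m (Poly_Mapping.lookup F m))"
    if "finite S" "S \<subseteq> Poly_Mapping.keys F" for S
    using that
  proof induction
    case empty
    show ?case using single[of 0 0] by simp
  next
    case (insert m S)
    with F show ?case by (auto simp: mpolys_def intro!: add single)
  qed
  from this[of "Poly_Mapping.keys F"] show ?thesis
    by (simp flip: mpoly_as_sum)
qed

lemma mpolys_mono: "n \<le> n' \<Longrightarrow> F \<in> mpolys n \<Longrightarrow> F \<in> mpolys n'"
  by (force simp: mpolys_def)

lemma ex_mpolys: "\<exists>n. F \<in> mpolys n"
proof -
  have "finite (\<Union>m\<in>Poly_Mapping.keys F. Poly_Mapping.keys m)" by auto
  then obtain n where "(\<Union>m\<in>Poly_Mapping.keys F. Poly_Mapping.keys m) \<subseteq> {..<n}"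
    using finite_nat_iff_bounded by blast
  thus ?thesis by (auto simp: mpolys_def)
qed

lemma mpoly_induct [case_names single add]:
  fixes F :: "'a::comm_ring_1 mpoly"
  assumes "\<And>m c. P (Poly_Mapping.single m c)" "\<And>G G'. P G \<Longrightarrow> P G' \<Longrightarrow> P (G + G')"
  shows "P F"
  using ex_mpolys[of F] assms mpolys_induct[of F _ P] by blast

lemma minst_superset:
  assumes "finite S" "Poly_Mapping.keys F \<subseteq> S" "h 0 = 0"
  shows "minst h p F = (\<Sum>m\<in>S. h (Poly_Mapping.lookup F m) * mon_inst p m)"
  unfolding minst_def by (rule sum.mono_neutral_left) (use assms in \<open>auto simp: in_keys_iff\<close>)

lemma minst_single: "h 0 = 0 \<Longrightarrow> minst h p (Poly_Mapping.single m c) = h c * mon_inst p m"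
  by (simp add: minst_def)

text \<open>
  In \<open>hom_minst\<close>, a homomorphism applied to a substitution is again a substitution; two
  substitutions are therefore equal as soon as they agree on constants and on variables.
\<close>

context comm_ring_hom
begin

lemma minst_add: "minst hom p (F + G) = minst hom p F + minst hom p G"
proof -
  let ?S = "Poly_Mapping.keys F \<union> Poly_Mapping.keys G"
  have "minst hom p (F + G) = (\<Sum>m\<in>?S. hom (Poly_Mapping.lookup (F + G) m) * mon_inst p m)"
    by (rule minst_superset) (use keys_add in \<open>force\<close>)+
  also have "\<dots> = minst hom p F + minst hom p G"
    by (simp add: minst_superset[of ?S] lookup_add hom_add ring_distribs sum.distrib)
  finally show ?thesis .
qed

lemma minst_mult: "minst hom p (F * G) = minst hom p F * minst hom p G"
proof (induction F rule: mpoly_induct)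
  case (single m c)
  show ?case
  proof (induction G rule: mpoly_induct)
    case (single m' c')
    show ?case by (simp add: mult_single minst_single mon_inst_add hom_mult mult_ac)
  next
    case (add G G')
    thus ?case by (simp add: ring_distribs minst_add)
  qed
next
  case (add F F')
  thus ?case by (simp add: ring_distribs minst_add)
qed

lemma minst_comm_ring_hom: "comm_ring_hom (minst hom p)"
proof
  show "minst hom p 1 = 1"
    using minst_single[of hom p 0 1] by simp
  show "minst hom p 0 = 0" by (simp add: minst_def)
qed (simp_all add: minst_add minst_mult)

lemma minst_mvar: "minst hom p (mvar i) = p i"
  by (simp add: mvar_def minst_single mon_inst_single)

lemma minst_mconst: "minst hom p (mconst c) = hom c"
  by (simp add: mconst_def minst_single)

lemma hom_mon_inst: "hom (mon_inst q m) = mon_inst (\<lambda>i. hom (q i)) m"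
  by (simp add: mon_inst_def hom_prod hom_power)

lemma hom_minst: "hom (minst h q F) = minst (\<lambda>c. hom (h c)) (\<lambda>i. hom (q i)) F"
  by (simp add: minst_def hom_sum hom_mult hom_mon_inst)

end

lemma minst_cong:
  assumes "F \<in> mpolys n" "\<And>i. i < n \<Longrightarrow> p i = q i"
  shows "minst h p F = minst h q F"
  unfolding minst_def
proof (rule sum.cong)
  fix m assume "m \<in> Poly_Mapping.keys F"
  with assms(1) have "Poly_Mapping.keys m \<subseteq> {..<n}" by (auto simp: mpolys_def)
  with assms(2) have "mon_inst p m = mon_inst q m" by (intro mon_inst_cong) auto
  thus "h (Poly_Mapping.lookup F m) * mon_inst p m = h (Poly_Mapping.lookup F m) * mon_inst q m" by simp
qed simp

lemma mconst_hom: "inj_comm_ring_hom (mconst :: 'a::comm_ring_1 \<Rightarrow> 'a mpoly)"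
proof
  show "mconst (x + y) = mconst x + mconst y" for x y :: 'a
    by (simp add: mconst_def single_add)
  show "mconst (x * y) = mconst x * mconst y" for x y :: 'a
    by (simp add: mconst_def mult_single)
  show "x = 0" if "mconst x = 0" for x :: 'a
    using that by (metis mconst_def lookup_single_eq lookup_zero)
qed (simp_all add: mconst_def)

interpretation mconst_hom: inj_comm_ring_hom "mconst :: 'a::comm_ring_1 \<Rightarrow> 'a mpoly"
  by (rule mconst_hom)

lemma mvar_power: "mvar i ^ n = Poly_Mapping.single (Poly_Mapping.single i n) 1"
  by (induction n) (simp_all add: mvar_def mult_single flip: single_add)

lemma exponent_as_sum:
  "m = (\<Sum>i\<in>Poly_Mapping.keys m. Poly_Mapping.single i (Poly_Mapping.lookup m i))"
  for m :: "nat \<Rightarrow>\<^sub>0 nat"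
  by (rule poly_mapping_eqI) (auto simp: lookup_sum lookup_single when_def in_keys_iff)

lemma prod_single_one: "finite S \<Longrightarrow>
   (\<Prod>i\<in>S. Poly_Mapping.single (m i) (1::'a::comm_ring_1)) = Poly_Mapping.single (\<Sum>i\<in>S. m i) 1"
  for m :: "'i \<Rightarrow> nat \<Rightarrow>\<^sub>0 nat"
  by (induction S rule: finite_induct) (simp_all add: mult_single)

lemma single_eq_mconst_mult:
  "Poly_Mapping.single m c = mconst c * mon_inst mvar m"
proof -
  have "mon_inst mvar m = Poly_Mapping.single m (1 :: 'a)"
    by (simp add: mon_inst_def mvar_power prod_single_one flip: exponent_as_sum)
  thus ?thesis by (simp add: mconst_def mult_single)
qed

lemma minst_mconst_mvar: "minst mconst mvar F = F"
proof (induction F rule: mpoly_induct)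
  case (single m c)
  show ?case by (simp add: minst_single flip: single_eq_mconst_mult)
qed (simp add: mconst_hom.minst_add)

lemma mpolys_mconst [intro, simp]: "mconst c \<in> mpolys n"
  by (auto simp: mpolys_def mconst_def)

lemma mpolys_0 [intro, simp]: "0 \<in> mpolys n"
  by (auto simp: mpolys_def)

lemma mpolys_1 [intro, simp]: "1 \<in> mpolys n"
  by (auto simp: mpolys_def)

lemma mpolys_mvar [intro, simp]: "i < n \<Longrightarrow> mvar i \<in> mpolys n"
  by (auto simp: mpolys_def mvar_def)

lemma mpolys_add [intro]: "F \<in> mpolys n \<Longrightarrow> G \<in> mpolys n \<Longrightarrow> F + G \<in> mpolys n"
  unfolding mpolys_def using keys_add[of F G] by blast

lemma mpolys_mult [intro]:
  assumes "F \<in> mpolys n" "G \<in> mpolys n"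
  shows "F * G \<in> mpolys n"
  unfolding mpolys_def mem_Collect_eq
proof
  fix m assume "m \<in> Poly_Mapping.keys (F * G)"
  then obtain a b where ab: "m = a + b" "a \<in> Poly_Mapping.keys F" "b \<in> Poly_Mapping.keys G"
    using keys_mult[of F G] by auto
  have "Poly_Mapping.keys m \<subseteq> Poly_Mapping.keys a \<union> Poly_Mapping.keys b"
    unfolding ab(1) by (rule keys_add)
  also have "\<dots> \<subseteq> {..<n}" using assms ab(2,3) by (auto simp: mpolys_def)
  finally show "Poly_Mapping.keys m \<subseteq> {..<n}" .
qed

lemma mpolys_power [intro]: "F \<in> mpolys n \<Longrightarrow> F ^ e \<in> mpolys n" for F :: "'a::comm_ring_1 mpoly"
  by (induction e) auto

lemma mpolys_sum [intro]: "(\<And>i. i \<in> S \<Longrightarrow> F i \<in> mpolys n) \<Longrightarrow> sum F S \<in> mpolys n"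
  for F :: "'i \<Rightarrow> 'a::comm_ring_1 mpoly"
  by (induction S rule: infinite_finite_induct) auto

lemma mpolys_prod [intro]: "(\<And>i. i \<in> S \<Longrightarrow> F i \<in> mpolys n) \<Longrightarrow> prod F S \<in> mpolys n"
  for F :: "'i \<Rightarrow> 'a::comm_ring_1 mpoly"
  by (induction S rule: infinite_finite_induct) auto

lemma mpolys_minst [intro]:
  assumes "F \<in> mpolys r" "\<And>i. i < r \<Longrightarrow> G i \<in> mpolys n"
  shows "minst mconst G F \<in> mpolys n"
  unfolding minst_def mon_inst_def
proof (intro mpolys_sum mpolys_mult mpolys_prod mpolys_power mpolys_mconst)
  fix m i assume "m \<in> Poly_Mapping.keys F" "i \<in> Poly_Mapping.keys m"
  with assms(1) have "i < r" by (auto simp: mpolys_def)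
  thus "G i \<in> mpolys n" by (rule assms(2))
qed

lemma mpolys_zero_vars: "F \<in> mpolys 0 \<Longrightarrow> \<exists>c. F = mconst c"
proof (induction F rule: mpolys_induct)
  case (single m c)
  hence "m = 0" by simp
  thus ?case by (auto simp: mconst_def)
next
  case (add G G')
  thus ?case by (metis mconst_hom.hom_add)
qed

subsection \<open>Singling out a variable\<close>

text \<open>
  A multivariate polynomial as a polynomial in \<open>X\<^sub>k\<close>.  The coefficients stay in the ring of all
  variables, so that the coefficient ring is one type for all \<open>k\<close>.
\<close>

definition vsplit :: "nat \<Rightarrow> 'a::comm_ring_1 mpoly \<Rightarrow> 'a mpoly poly" where
  "vsplit k = minst (\<lambda>c. [:mconst c:]) (\<lambda>i. if i = k then [:0, 1:] else [:mvar i:])"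

lemma const_mconst_hom: "comm_ring_hom (\<lambda>c. [:mconst c:] :: 'a::comm_ring_1 mpoly poly)"
  by unfold_locales (simp_all add: mconst_hom.hom_add mconst_hom.hom_mult)

lemma poly_map_poly_hom: "comm_ring_hom h \<Longrightarrow> comm_ring_hom (\<lambda>P. poly (map_poly h P) y)"
proof -
  assume "comm_ring_hom h"
  then interpret comm_ring_hom h .
  interpret P: map_poly_comm_ring_hom h ..
  show "comm_ring_hom (\<lambda>P. poly (map_poly h P) y)"
    by unfold_locales (simp_all add: P.hom_add P.hom_mult)
qed

lemma id_hom: "comm_ring_hom (\<lambda>c. c)"
  by unfold_locales auto

lemma vsplit_hom: "comm_ring_hom (vsplit k)"
  unfolding vsplit_def by (rule comm_ring_hom.minst_comm_ring_hom[OF const_mconst_hom])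

lemma minst_vsplit:
  assumes "comm_ring_hom h"
  shows "poly (map_poly (minst h p) (vsplit k F)) y = minst h (p(k := y)) F"
proof -
  interpret comm_ring_hom h by fact
  interpret M: comm_ring_hom "minst h p" by (rule minst_comm_ring_hom)
  interpret C: comm_ring_hom "\<lambda>P. poly (map_poly (minst h p) P) y"
    by (rule poly_map_poly_hom) unfold_locales
  show ?thesis
    unfolding vsplit_def C.hom_minst
    by (rule arg_cong[where f = "\<lambda>f. f F"], rule arg_cong2[where f = minst])
       (auto simp: minst_mconst minst_mvar fun_eq_iff M.map_poly_pCons_hom)
qed

lemma poly_vsplit: "poly (vsplit k F) (mvar k) = F"
proof -
  have "minst mconst mvar = (\<lambda>F :: 'a mpoly. F)" by (simp add: fun_eq_iff minst_mconst_mvar)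
  with minst_vsplit[OF mconst_hom.comm_ring_hom_axioms, of mvar k F "mvar k"]
  show ?thesis by (simp add: minst_mconst_mvar map_poly_id')
qed

lemma vsplit_eq_0_iff [simp]: "vsplit k F = 0 \<longleftrightarrow> F = 0"
proof
  assume "vsplit k F = 0"
  thus "F = 0" using poly_vsplit[of k F] by simp
next
  interpret comm_ring_hom "vsplit k :: 'a mpoly \<Rightarrow> _" by (rule vsplit_hom)
  show "F = 0 \<Longrightarrow> vsplit k F = 0" by simp
qed

lemma vsplit_mvar [simp]: "vsplit k (mvar i) = (if i = k then [:0, 1:] else [:mvar i:])"
  unfolding vsplit_def by (rule comm_ring_hom.minst_mvar[OF const_mconst_hom])

lemma vsplit_mconst [simp]: "vsplit k (mconst c) = [:mconst c:]"
  unfolding vsplit_def by (rule comm_ring_hom.minst_mconst[OF const_mconst_hom])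

lemma mpolys_coeff_mult:
  fixes P R :: "'a::comm_ring_1 mpoly poly"
  assumes "\<forall>i. coeff P i \<in> mpolys n" "\<forall>i. coeff R i \<in> mpolys n"
  shows "\<forall>i. coeff (P * R) i \<in> mpolys n"
  using assms by (auto simp: coeff_mult intro!: mpolys_sum mpolys_mult)

lemma mpolys_coeff_power:
  fixes P :: "'a::comm_ring_1 mpoly poly"
  assumes "\<forall>i. coeff P i \<in> mpolys n"
  shows "\<forall>i. coeff (P ^ e) i \<in> mpolys n"
  using assms by (induction e) (auto simp: coeff_mult coeff_1 intro!: mpolys_sum mpolys_mult)

text \<open>
  Splitting off the last variable lowers the number of variables, which permits inductions over it.
\<close>

lemma coeff_vsplit_mpolys: "F \<in> mpolys (Suc n) \<Longrightarrow> coeff (vsplit n F) i \<in> mpolys n"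
proof (induction F arbitrary: i rule: mpolys_induct)
  case (single m c)
  interpret comm_ring_hom "vsplit n :: 'a mpoly \<Rightarrow> _" by (rule vsplit_hom)
  have "\<forall>i. coeff (\<Prod>j\<in>S. (if j = n then [:0, 1:] else [:mvar j:]) ^ e j :: 'a mpoly poly) i \<in> mpolys n"
    if "finite S" "S \<subseteq> {..<Suc n}" for S e
    using that
  proof induction
    case empty
    show ?case by (auto simp: coeff_1)
  next
    case (insert j S)
    have "\<forall>i. coeff ((if j = n then [:0, 1:] else [:mvar j:]) ^ e j :: 'a mpoly poly) i \<in> mpolys n"
      by (rule mpolys_coeff_power)
        (use insert.prems in \<open>auto simp: coeff_pCons less_Suc_eq split: nat.splits\<close>)
    with insert show ?case by (auto simp del: power_0 intro!: mpolys_coeff_mult[rule_format])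
  qed
  from this[of "Poly_Mapping.keys m" "Poly_Mapping.lookup m"] single show ?case
    by (auto simp: single_eq_mconst_mult hom_mult mon_inst_def hom_prod hom_power intro!: mpolys_mult)
next
  case (add G G')
  interpret comm_ring_hom "vsplit n :: 'a mpoly \<Rightarrow> _" by (rule vsplit_hom)
  from add show ?case by (auto simp: hom_add)
qed

text \<open>
  By induction on the number of variables: choose values of the first variables at which the leading
  coefficient in the last one does not vanish, then avoid the finitely many roots.
\<close>

lemma exists_nonzero_value:
  fixes F :: "'a::field mpoly"
  assumes "infinite (UNIV :: 'a set)" "F \<noteq> 0"
  shows "\<exists>u. minst (\<lambda>c. c) u F \<noteq> 0"
proof -
  have "\<exists>u. minst (\<lambda>c. c) u F \<noteq> 0" if "F \<in> mpolys n" "F \<noteq> 0" for n and F :: "'a mpoly"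
    using that
  proof (induction n arbitrary: F)
    case 0
    then obtain c where "F = mconst c" using mpolys_zero_vars by blast
    with 0 show ?case by (auto simp: comm_ring_hom.minst_mconst[OF id_hom])
  next
    case (Suc n)
    let ?P = "vsplit n F"
    from Suc have "coeff ?P (degree ?P) \<in> mpolys n" "coeff ?P (degree ?P) \<noteq> 0"
      by (auto intro: coeff_vsplit_mpolys)
    from Suc.IH[OF this] obtain u where u: "minst (\<lambda>c. c) u (coeff ?P (degree ?P)) \<noteq> 0" by blast
    interpret M: comm_ring_hom "minst (\<lambda>c::'a. c) u" by (rule comm_ring_hom.minst_comm_ring_hom[OF id_hom])
    let ?R = "map_poly (minst (\<lambda>c. c) u) ?P"
    from u have "coeff ?R (degree ?P) \<noteq> 0" by (subst M.coeff_map_poly_hom)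
    hence "?R \<noteq> 0" by (metis coeff_0)
    hence "finite {y. poly ?R y = 0}" by (rule poly_roots_finite)
    with assms(1) have "{y. poly ?R y = 0} \<noteq> UNIV" by metis
    then obtain y where "poly ?R y \<noteq> 0" by blast
    thus ?case unfolding minst_vsplit[OF id_hom] by blast
  qed
  with ex_mpolys[of F] assms(2) show ?thesis by blast
qed

subsection \<open>First-order expansion\<close>

lemma coeff_1_mult: "coeff (p * q) (Suc 0) = coeff p 0 * coeff q (Suc 0) + coeff p (Suc 0) * coeff q 0"
  by (simp add: coeff_mult)

lemma coeff_1_power: "coeff (p ^ n) (Suc 0) = of_nat n * coeff p 0 ^ (n - 1) * coeff p (Suc 0)"
  for p :: "'a::comm_ring_1 poly"
proof (induction n)
  case (Suc n)
  show ?case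
    by (cases n) (use Suc in \<open>auto simp: coeff_1_mult coeff_0_power coeff_mult_0 algebra_simps\<close>)
qed simp

lemma coeff_0_prod: "coeff (\<Prod>i\<in>S. q i) 0 = (\<Prod>i\<in>S. coeff (q i) 0)"
  for q :: "'i \<Rightarrow> 'a::comm_ring_1 poly"
  by (induction S rule: infinite_finite_induct) (auto simp: mult_poly_0 coeff_mult_0)

lemma coeff_1_prod:
  fixes q :: "'i \<Rightarrow> 'a::comm_ring_1 poly"
  assumes "finite S"
  shows "coeff (\<Prod>i\<in>S. q i) (Suc 0) = (\<Sum>i\<in>S. coeff (q i) (Suc 0) * (\<Prod>j\<in>S-{i}. coeff (q j) 0))"
  using assms
proof induction
  case (insert x S)
  have "(\<Sum>i\<in>S. coeff (q i) (Suc 0) * (\<Prod>j\<in>insert x S - {i}. coeff (q j) 0)) =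
        (\<Sum>i\<in>S. coeff (q x) 0 * (coeff (q i) (Suc 0) * (\<Prod>j\<in>S - {i}. coeff (q j) 0)))"
  proof (rule sum.cong)
    fix i assume "i \<in> S"
    with insert have "insert x S - {i} = insert x (S - {i})" by auto
    with insert show "coeff (q i) (Suc 0) * (\<Prod>j\<in>insert x S - {i}. coeff (q j) 0) =
        coeff (q x) 0 * (coeff (q i) (Suc 0) * (\<Prod>j\<in>S - {i}. coeff (q j) 0))" by simp
  qed simp
  with insert show ?case
    by (simp add: coeff_1_mult coeff_0_prod sum_distrib_left algebra_simps)
qed simp

lemma mpderiv_single:
  "mpderiv j (Poly_Mapping.single m c) =
     Poly_Mapping.single (m - Poly_Mapping.single j 1) (of_nat (Poly_Mapping.lookup m j) * c)"
  by (simp add: mpderiv_def)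

lemma mpderiv_superset:
  assumes "finite S" "Poly_Mapping.keys F \<subseteq> S"
  shows "mpderiv j F = (\<Sum>m\<in>S. Poly_Mapping.single (m - Poly_Mapping.single j 1)
       (of_nat (Poly_Mapping.lookup m j) * Poly_Mapping.lookup F m))"
  unfolding mpderiv_def by (rule sum.mono_neutral_left) (use assms in \<open>auto simp: in_keys_iff\<close>)

lemma mpderiv_add: "mpderiv j (F + G) = mpderiv j F + mpderiv j G"
proof -
  let ?S = "Poly_Mapping.keys F \<union> Poly_Mapping.keys G"
  have "mpderiv j (F + G) = (\<Sum>m\<in>?S. Poly_Mapping.single (m - Poly_Mapping.single j 1)
       (of_nat (Poly_Mapping.lookup m j) * Poly_Mapping.lookup (F + G) m))"
    by (rule mpderiv_superset) (use keys_add in \<open>force\<close>)+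
  also have "\<dots> = mpderiv j F + mpderiv j G"
    unfolding mpderiv_superset[of ?S F, OF finite_UnI[OF finite_keys finite_keys] Un_upper1]
      mpderiv_superset[of ?S G, OF finite_UnI[OF finite_keys finite_keys] Un_upper2]
    by (simp only: lookup_add distrib_left single_add sum.distrib)
  finally show ?thesis .
qed

lemma mpolys_mpderiv: "F \<in> mpolys n \<Longrightarrow> mpderiv j F \<in> mpolys n"
proof (induction F rule: mpolys_induct)
  case (single m c)
  have "Poly_Mapping.keys (m - Poly_Mapping.single j 1) \<subseteq> Poly_Mapping.keys m"
    by (auto simp: in_keys_iff lookup_minus)
  with single have "Poly_Mapping.keys (m - Poly_Mapping.single j 1) \<subseteq> {..<n}" by blast
  thus ?case unfolding mpderiv_single by (simp add: mpolys_def)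
next
  case (add G G')
  thus ?case unfolding mpderiv_add by (rule mpolys_add)
qed

lemma pCons_0_hom: "comm_ring_hom h \<Longrightarrow> comm_ring_hom (\<lambda>c. [:h c:])"
proof -
  assume "comm_ring_hom h"
  then interpret comm_ring_hom h .
  show ?thesis
  proof
    show "[:h (x + y):] = [:h x:] + [:h y:]" for x y by (simp only: hom_add add_pCons add_0_left)
    show "[:h (x * y):] = [:h x:] * [:h y:]" for x y by (simp add: hom_mult)
    show "[:h 0:] = 0" by (simp only: hom_zero pCons_0_0)
    show "[:h 1:] = 1" by (simp only: hom_one one_pCons)
  qed
qed

text \<open>
  The chain rule at \<open>t = 0\<close>.  Substituting curves and reading off the coefficient of \<open>t\<close> is how partial
  derivatives are computed below: products and compositions are then handled by the substitution
  homomorphism.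
\<close>

lemma coeff_1_minst:
  fixes h :: "'a::comm_ring_1 \<Rightarrow> 'b::comm_ring_1"
  assumes h: "comm_ring_hom h" and F: "F \<in> mpolys n"
  shows "coeff (minst (\<lambda>c. [:h c:]) p F) (Suc 0) =
    (\<Sum>i<n. minst h (\<lambda>i. coeff (p i) 0) (mpderiv i F) * coeff (p i) (Suc 0))"
proof -
  interpret comm_ring_hom h by fact
  show ?thesis using F
  proof (induction F rule: mpolys_induct)
    case (single m c)
    let ?a = "\<lambda>i. coeff (p i) 0" and ?e = "Poly_Mapping.lookup m"
    have *: "minst h ?a (mpderiv i (Poly_Mapping.single m c)) =
          of_nat (?e i) * (h c * ?a i ^ (?e i - 1) * (\<Prod>j\<in>{..<n}-{i}. ?a j ^ ?e j))"
      if "i < n" for i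
    proof (cases "?e i = 0")
      case True
      hence "mpderiv i (Poly_Mapping.single m c) = 0"
        by (simp only: mpderiv_single of_nat_0 mult_zero_left single_zero)
      thus ?thesis unfolding True by (simp only: hom_zero minst_def keys_zero sum.empty of_nat_0 mult_zero_left)
    next
      case False
      have "Poly_Mapping.keys (m - Poly_Mapping.single i 1) \<subseteq> Poly_Mapping.keys m"
        by (auto simp: in_keys_iff lookup_minus)
      with single have "Poly_Mapping.keys (m - Poly_Mapping.single i 1) \<subseteq> {..<n}" by blast
      hence "mon_inst ?a (m - Poly_Mapping.single i 1) =
          (\<Prod>j<n. ?a j ^ Poly_Mapping.lookup (m - Poly_Mapping.single i 1) j)"
        by (intro mon_inst_superset) auto
      also have "\<dots> = ?a i ^ Poly_Mapping.lookup (m - Poly_Mapping.single i 1) i *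
          (\<Prod>j\<in>{..<n}-{i}. ?a j ^ Poly_Mapping.lookup (m - Poly_Mapping.single i 1) j)"
        using that by (intro prod.remove) auto
      also have "(\<Prod>j\<in>{..<n}-{i}. ?a j ^ Poly_Mapping.lookup (m - Poly_Mapping.single i 1) j) =
          (\<Prod>j\<in>{..<n}-{i}. ?a j ^ ?e j)"
        by (rule prod.cong) (auto simp: lookup_minus lookup_single)
      finally have "mon_inst ?a (m - Poly_Mapping.single i 1) =
          ?a i ^ (?e i - 1) * (\<Prod>j\<in>{..<n}-{i}. ?a j ^ ?e j)"
        by (simp only: lookup_minus lookup_single_eq)
      thus ?thesis
        by (simp only: mpderiv_single minst_single[of h, OF hom_zero] hom_mult hom_of_nat mult.assoc)
    qed
    have "coeff (minst (\<lambda>c. [:h c:]) p (Poly_Mapping.single m c)) (Suc 0) =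
        h c * coeff (\<Prod>i<n. p i ^ ?e i) (Suc 0)"
      using single by (simp add: minst_single mon_inst_superset[of "{..<n}"])
    also have "\<dots> = (\<Sum>i<n. of_nat (?e i) * (h c * ?a i ^ (?e i - 1) * (\<Prod>j\<in>{..<n}-{i}. ?a j ^ ?e j))
         * coeff (p i) (Suc 0))"
      unfolding coeff_1_prod[OF finite_lessThan] coeff_1_power coeff_0_power sum_distrib_left
      by (rule sum.cong) (simp_all only: mult_ac)
    also have "\<dots> = (\<Sum>i<n. minst h ?a (mpderiv i (Poly_Mapping.single m c)) * coeff (p i) (Suc 0))"
      by (rule sum.cong) (simp_all add: *)
    finally show ?case .
  next
    case (add G G')
    thus ?case by (simp add: mpderiv_add minst_add comm_ring_hom.minst_add[OF pCons_0_hom[OF h]] ring_distribs sum.distrib)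
  qed
qed

lemma coeff_0_minst:
  fixes h :: "'a::comm_ring_1 \<Rightarrow> 'b::comm_ring_1"
  assumes h: "comm_ring_hom h"
  shows "coeff (minst (\<lambda>c. [:h c:]) p F) 0 = minst h (\<lambda>i. coeff (p i) 0) F"
proof -
  have "comm_ring_hom (\<lambda>p. poly p (0::'b))" by unfold_locales auto
  from comm_ring_hom.hom_minst[OF this, of "\<lambda>c. [:h c:]" p F] show ?thesis by (simp add: poly_0_coeff_0)
qed

section \<open>Division by monic polynomials and divided differences\<close>

lemma monic_division:
  fixes f Q :: "'a::idom poly"
  assumes "lead_coeff Q = 1"
  obtains S R where "f = Q * S + R" "R = 0 \<or> degree R < degree Q"
proof -
  obtain S R where SR: "pseudo_divmod f Q = (S, R)" by (cases "pseudo_divmod f Q")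
  from assms have "Q \<noteq> 0" by auto
  from pseudo_divmod[OF this SR] assms show ?thesis by (intro that[of S R]) auto
qed

lemma monic_division_unique:
  fixes Q S S' R R' :: "'a::idom poly"
  assumes "lead_coeff Q = 1" "Q * S + R = Q * S' + R'"
    "R = 0 \<or> degree R < degree Q" "R' = 0 \<or> degree R' < degree Q"
  shows "S = S'" "R = R'"
proof -
  have eq: "Q * (S - S') = R' - R" using assms(2) by (simp add: algebra_simps)
  have Q: "Q \<noteq> 0" using assms(1) by auto
  show S: "S = S'"
  proof (rule ccontr)
    assume "S \<noteq> S'"
    hence "degree (Q * (S - S')) = degree Q + degree (S - S')" "Q * (S - S') \<noteq> 0"
      using Q by (auto intro!: degree_mult_eq)
    moreover have "R' - R = 0 \<or> degree (R' - R) < degree Q"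
      using assms(3,4) degree_diff_less[of R' "degree Q" R] by (cases "R = 0"; cases "R' = 0") auto
    ultimately show False using eq by auto
  qed
  with assms(2) show "R = R'" by simp
qed

abbreviation root_poly :: "'b::idom \<Rightarrow> 'b poly" where
  "root_poly c \<equiv> [:- c, 1:]"

lemma degree_prod_root_poly: "finite S \<Longrightarrow> degree (\<Prod>i\<in>S. root_poly (p i)) = card S"
  by (subst degree_prod_eq_sum_degree) auto

lemma lead_coeff_prod_root_poly: "lead_coeff (\<Prod>i\<in>S. root_poly (p i)) = 1"
  by (simp add: lead_coeff_prod)

lemma R_poly_spec:
  fixes f :: "'a::field poly"
  shows "degree (R_poly k f) \<le> k" "Q_poly k dvd map_poly mconst f - R_poly k f"
proof -
  let ?P = "\<lambda>R. degree R \<le> k \<and> Q_poly k dvd map_poly mconst f - R"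
  let ?Q = "Q_poly k :: 'a mpoly poly"
  have deg: "degree ?Q = Suc k" and lc: "lead_coeff ?Q = 1"
    unfolding Q_poly_def by (subst degree_prod_root_poly, simp, simp) (rule lead_coeff_prod_root_poly)
  obtain S R where SR: "map_poly mconst f = ?Q * S + R" "R = 0 \<or> degree R < degree ?Q"
    using monic_division[OF lc] by blast
  have "\<exists>!R. ?P R"
  proof (rule ex1I)
    show "?P R" using SR deg by auto
  next
    fix R' assume R': "?P R'"
    then obtain S' where "map_poly mconst f = ?Q * S' + R'"
      by (metis dvd_def diff_eq_eq)
    with SR R' deg show "R' = R"
      by (intro monic_division_unique(2)[OF lc, of S' R' S R]) auto
  qed
  hence "?P (R_poly k f)" unfolding R_poly_def by (rule theI')
  thus "degree (R_poly k f) \<le> k" "Q_poly k dvd map_poly mconst f - R_poly k f" by auto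
qed

text \<open>
  Division by a monic polynomial commutes with homomorphisms, its remainder being unique.  Hence the
  value of \<open>H\<^sub>f\<close> at elements \<open>p 0, \<dots>, p k\<close> of any domain is the divided difference
  \<open>f[p 0, \<dots>, p k]\<close>, the coefficient of \<open>T\<^sup>k\<close> in the interpolation of \<open>f\<close> at these nodes.
\<close>

lemma minst_H_poly:
  fixes f :: "'a::field poly" and h :: "'a \<Rightarrow> 'b::idom"
  assumes h: "comm_ring_hom h"
    and div: "map_poly h f = (\<Prod>i<k + 1. root_poly (p i)) * S + R" and deg: "degree R \<le> k"
  shows "minst h p (H_poly k f) = coeff R k"
proof -
  interpret comm_ring_hom h by fact
  interpret M: comm_ring_hom "minst h p" by (rule minst_comm_ring_hom)
  interpret MP: map_poly_comm_ring_hom "minst h p" ..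
  let ?Q = "\<Prod>i<k + 1. root_poly (p i)"
  have lc: "lead_coeff ?Q = 1" by (rule lead_coeff_prod_root_poly)
  have dQ: "degree ?Q = k + 1" by (subst degree_prod_root_poly) auto
  obtain S0 where "map_poly mconst f = Q_poly k * S0 + R_poly k f"
    using R_poly_spec(2)[of k f] by (metis dvd_def diff_eq_eq)
  hence "map_poly (minst h p) (map_poly mconst f) =
      map_poly (minst h p) (Q_poly k) * map_poly (minst h p) S0 + map_poly (minst h p) (R_poly k f)"
    by (simp only: MP.hom_add MP.hom_mult)
  also have "map_poly (minst h p) (Q_poly k) = ?Q"
    unfolding Q_poly_def MP.hom_prod M.map_poly_pCons_hom M.hom_uminus minst_mvar M.hom_one map_poly_0 ..
  also have "map_poly (minst h p) (map_poly mconst f) = map_poly h f"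
    unfolding map_poly_map_poly[of "minst h p", OF M.hom_zero] o_def minst_mconst ..
  finally have "?Q * S + R = ?Q * map_poly (minst h p) S0 + map_poly (minst h p) (R_poly k f)"
    using div by simp
  note eq = this
  have dR: "degree (map_poly (minst h p) (R_poly k f)) \<le> k"
    using degree_map_poly_le[of "minst h p" "R_poly k f"] R_poly_spec(1)[of k f]
    by linarith
  have "R = map_poly (minst h p) (R_poly k f)"
  proof (rule monic_division_unique(2)[OF lc eq])
    show "R = 0 \<or> degree R < degree ?Q" using deg dQ by linarith
    show "map_poly (minst h p) (R_poly k f) = 0 \<or>
        degree (map_poly (minst h p) (R_poly k f)) < degree ?Q" using dR dQ by linarith
  qed
  thus ?thesis by (simp add: H_poly_def M.coeff_map_poly_hom)
qed

lemma ex_division_nodes: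
  fixes F :: "'b::idom poly"
  obtains S R where "F = (\<Prod>i<k + 1. root_poly (p i)) * S + R" "degree R \<le> k"
proof -
  let ?Q = "\<Prod>i<k + 1. root_poly (p i)"
  have dQ: "degree ?Q = k + 1" by (subst degree_prod_root_poly) auto
  obtain S R where "F = ?Q * S + R" "R = 0 \<or> degree R < degree ?Q"
    using monic_division[OF lead_coeff_prod_root_poly] by blast
  with dQ show ?thesis by (intro that[of S R]) auto
qed

text \<open>
  The quotient \<open>S\<close> of the division by \<open>\<Prod>(T - p i)\<close> takes the value \<open>f[p 0, \<dots>, p k, u]\<close> at \<open>u\<close>.  So the claim
  is the recursion \<open>f[\<dots>, p i + e, \<dots>] - f[\<dots>, p i, \<dots>] = e f[p 0, \<dots>, p k, p i + e]\<close> of divided differences.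
  Written without division by \<open>e\<close> it is valid for \<open>e = t\<close> in \<open>K[t]\<close>, and its coefficient of \<open>t\<close> is the partial
  derivative of \<open>H\<^sub>f\<close>, in every characteristic.
\<close>

lemma H_poly_shift:
  fixes f :: "'a::field poly" and h :: "'a \<Rightarrow> 'b::idom"
  assumes h: "comm_ring_hom h"
    and div: "map_poly h f = (\<Prod>i<k + 1. root_poly (p i)) * S + R" and deg: "degree R \<le> k"
    and i: "i \<le> k"
  shows "minst h (p(i := p i + e)) (H_poly k f) = minst h p (H_poly k f) + e * poly S (p i + e)"
proof -
  let ?q = "p(i := p i + e)"
  let ?Qi = "\<Prod>j\<in>{..<k + 1} - {i}. root_poly (p j)"
  let ?s = "poly S (p i + e)"
  define S1 where "S1 = synthetic_div S (p i + e)"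
  \<comment> \<open>Split off from the quotient the linear factor of the shifted node.\<close>
  have S: "S = root_poly (p i + e) * S1 + [:?s:]"
    unfolding S1_def by (rule synthetic_div_correct'[symmetric])
  have Q: "(\<Prod>j<k + 1. root_poly (p j)) = root_poly (p i) * ?Qi"
    using i by (intro prod.remove) auto
  have "(\<Prod>j<k + 1. root_poly (?q j)) = root_poly (?q i) * (\<Prod>j\<in>{..<k + 1} - {i}. root_poly (?q j))"
    using i by (intro prod.remove) auto
  also have "(\<Prod>j\<in>{..<k + 1} - {i}. root_poly (?q j)) = ?Qi"
    by (rule prod.cong) auto
  finally have Q': "(\<Prod>j<k + 1. root_poly (?q j)) = root_poly (p i + e) * ?Qi" by simp
  have dQi: "degree ?Qi = k" using i by (subst degree_prod_root_poly) auto
  have cQi: "coeff ?Qi k = 1"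
    using lead_coeff_prod_root_poly[of p "{..<k + 1} - {i}"] unfolding dQi .
  have r: "root_poly (p i) = root_poly (p i + e) + [:e:]" by simp
  have alg: "(a + b) * q * (a * u + t) + r = a * q * ((a * u + t) + b * u) + (r + b * t * q)"
    for a b q u t r :: "'b poly"
    by (simp add: algebra_simps)
  have "map_poly h f = (root_poly (p i + e) + [:e:]) * ?Qi * S + R"
    unfolding div Q r[symmetric] by simp
  also have "\<dots> = root_poly (p i + e) * ?Qi * (S + [:e:] * S1) + (R + [:e:] * [:?s:] * ?Qi)"
    using alg[of "root_poly (p i + e)" "[:e:]" ?Qi S1 "[:?s:]" R] unfolding S[symmetric] .
  finally have "map_poly h f =
      (\<Prod>j<k + 1. root_poly (?q j)) * (S + [:e:] * S1) + (R + smult (e * ?s) ?Qi)"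
    unfolding Q' by (simp add: mult.commute)
  hence "minst h ?q (H_poly k f) = coeff (R + smult (e * ?s) ?Qi) k"
  proof (rule minst_H_poly[OF h])
    have "degree (smult (e * ?s) ?Qi) \<le> k"
      using degree_smult_le[of "e * ?s" ?Qi] unfolding dQi .
    with deg show "degree (R + smult (e * ?s) ?Qi) \<le> k" by (rule degree_add_le)
  qed
  also have "\<dots> = minst h p (H_poly k f) + e * ?s"
    unfolding minst_H_poly[OF h div deg] using cQi by simp
  finally show ?thesis .
qed

lemma quotient_monic:
  fixes F :: "'b::idom poly"
  assumes "F = (\<Prod>i<n. root_poly (p i)) * S + R" "R = 0 \<or> degree R < n"
    and "degree F = n + e" "lead_coeff F = 1"
  shows "degree S = e" "lead_coeff S = 1"
proof -
  let ?Q = "\<Prod>i<n. root_poly (p i)"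
  have dQ: "degree ?Q = n" by (subst degree_prod_root_poly) auto
  have eq: "?Q * S = F - R" using assms(1) by simp
  have 1: "coeff (?Q * S) (n + e) = 1"
  proof -
    have "coeff R (n + e) = 0" using assms(2) by (auto intro: coeff_eq_0)
    thus ?thesis unfolding eq using assms(3,4) by simp
  qed
  have "degree (?Q * S) \<le> n + e"
    unfolding eq using assms(2,3) by (intro degree_diff_le) auto
  with 1 have d: "degree (?Q * S) = n + e"
    by (metis le_antisym le_degree zero_neq_one)
  from 1 have "S \<noteq> 0" by (metis coeff_0 mult_zero_right zero_neq_one)
  have "?Q \<noteq> 0" using lead_coeff_prod_root_poly[of p "{..<n}"] by (metis coeff_0 zero_neq_one)
  with \<open>S \<noteq> 0\<close> d dQ show "degree S = e" by (simp add: degree_mult_eq)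
  have "lead_coeff (?Q * S) = lead_coeff S"
    unfolding lead_coeff_mult lead_coeff_prod_root_poly by simp
  with 1 d show "lead_coeff S = 1" by simp
qed

text \<open>
  The quotient \<open>S\<close> after division by the first \<open>k\<close> linear factors is \<open>f[p 0, \<dots>, p (k - 1), T]\<close>.  Thus it is
  \<open>H\<^sub>f\<close> as a polynomial in its last variable, and \<open>H\<^sub>f\<close> is monic there.
\<close>

lemma minst_H_poly_last:
  fixes f :: "'a::field poly" and h :: "'a \<Rightarrow> 'b::idom"
  assumes h: "comm_ring_hom h"
    and div: "map_poly h f = (\<Prod>i<k. root_poly (p i)) * S + R" and deg: "R = 0 \<or> degree R < k"
  shows "minst h p (H_poly k f) = poly S (p k)"
proof -
  let ?Q = "\<Prod>i<k. root_poly (p i)"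
  define S1 where "S1 = synthetic_div S (p k)"
  have S: "S = root_poly (p k) * S1 + [:poly S (p k):]"
    unfolding S1_def by (rule synthetic_div_correct'[symmetric])
  have dQ: "degree ?Q = k" by (subst degree_prod_root_poly) auto
  have cQ: "coeff ?Q k = 1"
    using lead_coeff_prod_root_poly[of p "{..<k}"] unfolding dQ .
  have "map_poly h f = ?Q * (root_poly (p k) * S1 + [:poly S (p k):]) + R"
    unfolding S[symmetric] by (rule div)
  hence "map_poly h f = (\<Prod>i<k + 1. root_poly (p i)) * S1 + (R + smult (poly S (p k)) ?Q)"
    by (simp add: algebra_simps)
  hence "minst h p (H_poly k f) = coeff (R + smult (poly S (p k)) ?Q) k"
  proof (rule minst_H_poly[OF h])
    have "degree (smult (poly S (p k)) ?Q) \<le> k"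
      using degree_smult_le[of "poly S (p k)" ?Q] unfolding dQ .
    moreover have "degree R \<le> k" using deg by auto
    ultimately show "degree (R + smult (poly S (p k)) ?Q) \<le> k" by (intro degree_add_le)
  qed
  moreover have "coeff R k = 0" using deg by (auto intro: coeff_eq_0)
  ultimately show ?thesis using cQ by simp
qed

text \<open>
  Only the nodes \<open>X\<^sub>0, \<dots>, X\<^sub>k\<close> enter the division, so replacing all further variables by \<open>0\<close> leaves \<open>H\<^sub>f\<close>
  unchanged.
\<close>

lemma H_poly_mpolys:
  fixes f :: "'a::field poly"
  shows "H_poly k f \<in> mpolys (k + 1)"
proof -
  let ?q = "\<lambda>i. if i < k + 1 then mvar i else 0 :: 'a mpoly"
  obtain S R where SR: "map_poly mconst f = (\<Prod>i<k + 1. root_poly (mvar i)) * S + R" "degree R \<le> k"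
    using ex_division_nodes[of "map_poly mconst f" mvar k] by metis
  have "H_poly k f = minst mconst mvar (H_poly k f)" by (simp add: minst_mconst_mvar)
  also have "\<dots> = coeff R k"
    by (rule minst_H_poly[OF mconst_hom.comm_ring_hom_axioms SR])
  also have "\<dots> = minst mconst ?q (H_poly k f)"
    using SR by (intro minst_H_poly[OF mconst_hom.comm_ring_hom_axioms, symmetric]) auto
  finally have eq: "H_poly k f = minst mconst ?q (H_poly k f)" .
  obtain n where "H_poly k f \<in> mpolys n" using ex_mpolys by blast
  hence "minst mconst ?q (H_poly k f) \<in> mpolys (k + 1)" by (rule mpolys_minst) auto
  with eq show ?thesis by simp
qed

subsection \<open>Change of the coefficient field\<close>

lemma map_eq_minst:
  fixes g :: "'a::field \<Rightarrow> 'b::idom"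
  assumes "comm_ring_hom g"
  shows "Poly_Mapping.map g F = minst (\<lambda>c. mconst (g c)) mvar F"
proof -
  interpret comm_ring_hom g by fact
  have hom: "comm_ring_hom (\<lambda>c. mconst (g c) :: 'b mpoly)"
    by unfold_locales (simp_all add: hom_add hom_mult mconst_hom.hom_add mconst_hom.hom_mult)
  show ?thesis
  proof (induction F rule: mpoly_induct)
    case (single m c)
    have "Poly_Mapping.map g (Poly_Mapping.single m c) = Poly_Mapping.single m (g c)"
      by (rule map_single) (rule hom_zero)
    thus ?case by (simp add: minst_single flip: single_eq_mconst_mult)
  next
    case (add G G')
    have "Poly_Mapping.map g (G + G') = Poly_Mapping.map g G + Poly_Mapping.map g G'"
      by (rule poly_mapping_eqI) (simp add: Poly_Mapping.map.rep_eq lookup_add when_def flip: hom_add)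
    with add show ?case by (simp only: comm_ring_hom.minst_add[OF hom])
  qed
qed

lemma minst_map:
  fixes g :: "'a::field \<Rightarrow> 'b::idom" and h :: "'b \<Rightarrow> 'c::idom"
  assumes g: "comm_ring_hom g" and h: "comm_ring_hom h"
  shows "minst h p (Poly_Mapping.map g F) = minst (\<lambda>c. h (g c)) p F"
proof -
  interpret comm_ring_hom h by fact
  have "comm_ring_hom (minst h p)" by (rule minst_comm_ring_hom)
  from comm_ring_hom.hom_minst[OF this, of "\<lambda>c. mconst (g c)" mvar F] show ?thesis
    unfolding map_eq_minst[OF g] by (simp add: minst_mconst minst_mvar)
qed

lemma mpolys_map: 
  fixes g :: "'a::field \<Rightarrow> 'b::idom"
  assumes "comm_ring_hom g" "F \<in> mpolys n"
  shows "Poly_Mapping.map g F \<in> mpolys n"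
proof -
  interpret comm_ring_hom g by fact
  have "Poly_Mapping.keys (Poly_Mapping.map g F) \<subseteq> Poly_Mapping.keys F"
    by (auto simp: in_keys_iff Poly_Mapping.map.rep_eq when_def)
  with assms(2) show ?thesis by (auto simp: mpolys_def)
qed

section \<open>A Nullstellensatz for monic polynomials\<close>

text \<open>
  Over a finite field with elements \<open>a\<close>, the polynomial \<open>1 + \<Prod>(T - a)\<close> would have no root.
\<close>

lemma infinite_UNIV_alg_closed: "infinite (UNIV :: 'a::alg_closed_field set)"
proof
  assume fin: "finite (UNIV :: 'a set)"
  let ?Q = "\<Prod>a\<in>UNIV. root_poly (a :: 'a)"
  have d: "degree ?Q = card (UNIV :: 'a set)"
    using degree_prod_root_poly[OF fin, of "\<lambda>a. a"] .
  have pos: "0 < card (UNIV :: 'a set)" using fin by (simp add: card_gt_0_iff)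
  have "degree (1 + ?Q) = degree ?Q" by (rule degree_add_eq_right) (use d pos in simp)
  hence "degree (1 + ?Q) > 0" using d pos by linarith
  from alg_closed_imp_poly_has_root[OF this] obtain x where "poly (1 + ?Q) x = 0" by blast
  moreover have "poly ?Q x = 0"
    unfolding poly_prod using fin by (intro prod_zero) (auto intro!: bexI[of _ x])
  ultimately show False by simp
qed

text \<open>
  In this section and the next one, a polynomial over \<open>K[X\<^sub>0, X\<^sub>1, \<dots>]\<close> describes a hypersurface with
  coordinates \<open>(b, y)\<close>, where \<open>y\<close> is the value of the distinguished variable.
\<close>

definition pt_eval :: "(nat \<Rightarrow> 'a::field) \<Rightarrow> 'a \<Rightarrow> 'a mpoly poly \<Rightarrow> 'a" where
  "pt_eval b y F = poly (map_poly (minst (\<lambda>c. c) b) F) y"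

lemma minst_id_hom: "comm_ring_hom (minst (\<lambda>c. c) b)"
  by (rule comm_ring_hom.minst_comm_ring_hom[OF id_hom])

lemma pt_eval_hom: "comm_ring_hom (pt_eval b y)"
  unfolding pt_eval_def by (rule poly_map_poly_hom[OF minst_id_hom])

lemma pt_eval_simps:
  "pt_eval b y (F * G) = pt_eval b y F * pt_eval b y G"
  "pt_eval b y (F + G) = pt_eval b y F + pt_eval b y G"
  "pt_eval b y (F ^ n) = pt_eval b y F ^ n"
  "pt_eval b y 0 = 0" "pt_eval b y 1 = 1"
proof -
  interpret comm_ring_hom "pt_eval b y" by (rule pt_eval_hom)
  show "pt_eval b y (F * G) = pt_eval b y F * pt_eval b y G" by (rule hom_mult)
  show "pt_eval b y (F + G) = pt_eval b y F + pt_eval b y G" by (rule hom_add)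
  show "pt_eval b y (F ^ n) = pt_eval b y F ^ n" by (rule hom_power)
  show "pt_eval b y 0 = 0" "pt_eval b y 1 = 1" by (rule hom_zero, rule hom_one)
qed

lemma dvd_power_of_roots:
  fixes h e :: "'a::alg_closed_field poly"
  assumes "h \<noteq> 0" "\<And>y. poly h y = 0 \<Longrightarrow> poly e y = 0"
  shows "h dvd e ^ degree h"
proof -
  from alg_closed_imp_factorization[OF assms(1)] obtain A where
    A: "size A = degree h" "h = smult (lead_coeff h) (\<Prod>x\<in>#A. root_poly x)" by blast
  have "(\<Prod>x\<in>#B. root_poly x) dvd e ^ size B" if "\<And>x. x \<in># B \<Longrightarrow> poly e x = 0" for B
    using that
  proof (induction B)
    case (add x B)
    hence "root_poly x dvd e" by (simp add: poly_eq_0_iff_dvd)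
    moreover have "(\<Prod>x\<in>#B. root_poly x) dvd e ^ size B" using add by simp
    ultimately have "root_poly x * (\<Prod>x\<in>#B. root_poly x) dvd e * e ^ size B" by (rule mult_dvd_mono)
    thus ?case by (simp only: image_mset_add_mset prod_mset.add_mset size_add_mset power_Suc)
  qed simp
  moreover have "poly e x = 0" if "x \<in># A" for x
  proof (rule assms(2))
    have "root_poly x dvd (\<Prod>x\<in>#A. root_poly x)"
      using that by (intro dvd_prod_mset) auto
    hence "root_poly x dvd h" using A(2) by (metis dvd_smult)
    thus "poly h x = 0" by (simp add: poly_eq_0_iff_dvd)
  qed
  ultimately have "(\<Prod>x\<in>#A. root_poly x) dvd e ^ degree h" using A(1) by metis
  moreover have "lead_coeff h \<noteq> 0" using assms(1) by simp
  ultimately show ?thesis using A(2) by (metis smult_dvd)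
qed

text \<open>
  At each value of the parameters, \<open>H\<close> divides \<open>E\<^sup>d\<close> for \<open>d = deg H\<close>, because each of its \<open>d\<close> linear factors
  divides \<open>E\<close>.  So the remainder of \<open>E\<^sup>d\<close> modulo the monic \<open>H\<close> vanishes at all parameter values, and a
  polynomial vanishing everywhere is zero.
\<close>

lemma monic_nullstellensatz:
  fixes H E :: "'a::alg_closed_field mpoly poly"
  assumes H: "lead_coeff H = 1"
    and van: "\<And>b y. pt_eval b y H = 0 \<Longrightarrow> pt_eval b y E = 0"
  shows "H dvd E ^ degree H"
proof -
  obtain S R where SR: "E ^ degree H = H * S + R" "R = 0 \<or> degree R < degree H"
    using monic_division[OF H] by blast
  have "R = 0"
  proof (rule ccontr)
    assume "R \<noteq> 0"
    hence "lead_coeff R \<noteq> 0" by simp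
    from exists_nonzero_value[OF infinite_UNIV_alg_closed this] obtain b
      where b: "minst (\<lambda>c. c) b (lead_coeff R) \<noteq> 0" by blast
    let ?m = "map_poly (minst (\<lambda>c::'a. c) b)"
    interpret M: comm_ring_hom "minst (\<lambda>c::'a. c) b" by (rule minst_id_hom)
    interpret MP: map_poly_comm_ring_hom "minst (\<lambda>c::'a. c) b" ..
    have cH: "coeff (?m H) (degree H) = 1"
      using H by (subst M.coeff_map_poly_hom) (metis M.hom_one)
    hence H0: "?m H \<noteq> 0" by (metis coeff_0 zero_neq_one)
    have dH: "degree (?m H) = degree H"
      by (rule antisym[OF degree_map_poly_le le_degree]) (use cH in \<open>metis zero_neq_one\<close>)
    have "?m H dvd ?m E ^ degree (?m H)"
      by (rule dvd_power_of_roots[OF H0]) (use van in \<open>simp add: pt_eval_def\<close>)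
    moreover have "?m E ^ degree H = ?m H * ?m S + ?m R"
      using arg_cong[OF SR(1), of ?m] by (simp only: MP.hom_power MP.hom_add MP.hom_mult)
    ultimately have "?m H dvd ?m R" unfolding dH by (metis dvd_add_right_iff dvd_triv_left)
    moreover have "?m R \<noteq> 0"
    proof
      assume "?m R = 0"
      hence "coeff (?m R) (degree R) = 0" by (metis coeff_0)
      with b show False by (metis M.coeff_map_poly_hom)
    qed
    ultimately have "degree (?m H) \<le> degree (?m R)" by (rule dvd_imp_degree_le)
    moreover have "degree (?m R) \<le> degree R" by (rule degree_map_poly_le)
    ultimately show False using SR(2) \<open>R \<noteq> 0\<close> dH by linarith
  qed
  with SR(1) show ?thesis by simp
qed

subsection \<open>Passing to the fraction field of the coefficients\<close>

lemma fract_poly_inj: "fract_poly p = fract_poly q \<longleftrightarrow> p = q" for p q :: "'b::idom poly"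
proof -
  interpret map_poly_inj_comm_ring_hom "to_fract :: 'b \<Rightarrow> 'b fract" ..
  show ?thesis by (rule eq_iff)
qed

lemma fract_poly_simps:
  fixes p q :: "'b::idom poly"
  shows "fract_poly (p * q) = fract_poly p * fract_poly q"
    "fract_poly (p + q) = fract_poly p + fract_poly q"
    "fract_poly (p - q) = fract_poly p - fract_poly q"
    "fract_poly (p ^ n) = fract_poly p ^ n"
    "fract_poly (0 :: 'b poly) = 0" "fract_poly (1 :: 'b poly) = 1"
    "fract_poly (smult c p) = smult (to_fract c) (fract_poly p)"
    "fract_poly (pCons c p) = pCons (to_fract c) (fract_poly p)"
    "degree (fract_poly p) = degree p"
    "coeff (fract_poly p) i = to_fract (coeff p i)"
proof -
  interpret map_poly_inj_comm_ring_hom "to_fract :: 'b \<Rightarrow> 'b fract" ..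
  show "fract_poly (p * q) = fract_poly p * fract_poly q" by (rule hom_mult)
  show "fract_poly (p + q) = fract_poly p + fract_poly q" by (rule hom_add)
  show "fract_poly (p - q) = fract_poly p - fract_poly q" by (rule hom_minus)
  show "fract_poly (p ^ n) = fract_poly p ^ n" by (rule hom_power)
  show "fract_poly (0 :: 'b poly) = 0" "fract_poly (1 :: 'b poly) = 1" by (rule hom_zero, rule hom_one)
  show "fract_poly (smult c p) = smult (to_fract c) (fract_poly p)"
    by (rule poly_eqI) (simp add: coeff_map_poly)
  show "fract_poly (pCons c p) = pCons (to_fract c) (fract_poly p)"
    by (rule poly_eqI) (simp add: coeff_map_poly coeff_pCons split: nat.splits)
  show "degree (fract_poly p) = degree p" by (rule degree_map_poly) simp
  show "coeff (fract_poly p) i = to_fract (coeff p i)" by (simp add: coeff_map_poly)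
qed

text \<open>
  A remainder modulo the monic \<open>H\<close> remains one over the fraction field.
\<close>

lemma monic_dvd_of_fract_dvd:
  fixes H F :: "'b::idom poly"
  assumes H: "lead_coeff H = 1" and dvd: "fract_poly H dvd fract_poly F"
  shows "H dvd F"
proof -
  obtain S R where SR: "F = H * S + R" "R = 0 \<or> degree R < degree H"
    using monic_division[OF H] by blast
  from dvd have "fract_poly H dvd fract_poly R"
    unfolding SR(1) fract_poly_simps by (metis dvd_add_right_iff dvd_triv_left)
  hence "R = 0 \<or> degree H \<le> degree R"
    using dvd_imp_degree_le[of "fract_poly H" "fract_poly R"] fract_poly_inj[of R 0]
    by (metis fract_poly_simps(5,9))
  with SR(2) have "R = 0" by linarith
  with SR(1) show ?thesis by simp
qed

lemma clear_denominators:
  fixes g :: "'b::idom fract poly"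
  obtains c P where "c \<noteq> 0" "fract_poly P = smult (to_fract c) g"
proof -
  have "\<exists>c P. c \<noteq> 0 \<and> fract_poly P = smult (to_fract c) g"
  proof (induction g)
    case 0
    show ?case by (rule exI[of _ 1], rule exI[of _ 0]) (simp add: fract_poly_simps)
  next
    case (pCons a g)
    then obtain c P where cP: "c \<noteq> 0" "fract_poly P = smult (to_fract c) g" by blast
    obtain u v where uv: "a = Fract u v" "v \<noteq> 0" by (cases a rule: Fract_cases)
    have "to_fract v * a = to_fract u"
      using uv by (simp add: to_fract_def eq_fract)
    hence "fract_poly (pCons (c * u) (smult v P)) = smult (to_fract (v * c)) (pCons a g)"
      using cP by (simp add: fract_poly_simps mult_ac)
    with cP uv show ?case by (intro exI[of _ "v * c"] exI[of _ "pCons (c * u) (smult v P)"]) simp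
  qed
  with that show ?thesis by blast
qed

lemma irreducible_degree_pos: "irreducible g \<Longrightarrow> 0 < degree g" for g :: "'l::field poly"
  unfolding irreducible_def using is_unit_iff_degree[of g] by auto

lemma ex_irreducible_factor:
  fixes p :: "'l::field poly"
  assumes "0 < degree p"
  obtains g where "irreducible g" "g dvd p"
proof -
  define P where "P = (\<lambda>g. g dvd p \<and> 0 < degree g)"
  have "P p" using assms by (simp add: P_def)
  then obtain g where g: "P g" "\<And>h. P h \<Longrightarrow> degree g \<le> degree h"
    using ex_has_least_nat[of P p degree] by blast
  have "irreducible g"
  proof (rule irreducibleI)
    show "g \<noteq> 0" using g(1) by (auto simp: P_def)
    show "\<not> is_unit g" using g(1) by (auto simp: P_def is_unit_iff_degree)
    fix a b assume ab: "g = a * b"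
    with \<open>g \<noteq> 0\<close> have nz: "a \<noteq> 0" "b \<noteq> 0" by auto
    show "is_unit a \<or> is_unit b"
    proof (rule ccontr)
      assume "\<not> ?thesis"
      hence pos: "0 < degree a" "0 < degree b" using nz by (auto simp: is_unit_iff_degree)
      have "P a" using pos g(1) ab by (auto simp: P_def dvd_mult_left)
      from g(2)[OF this] show False using ab nz pos by (simp add: degree_mult_eq)
    qed
  qed
  with g(1) that show ?thesis by (auto simp: P_def)
qed

lemma irreducible_dvd_mult:
  fixes g :: "'l::field poly"
  shows "irreducible g \<Longrightarrow> g dvd a * b \<Longrightarrow> g dvd a \<or> g dvd b"
  using field_poly_irreducible_imp_prime[of g] by (simp add: prime_elem_dvd_mult_iff)

lemma irreducible_dvd_power:
  fixes g :: "'l::field poly"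
  shows "irreducible g \<Longrightarrow> g dvd a ^ n \<Longrightarrow> g dvd a"
  using field_poly_irreducible_imp_prime[of g] prime_elem_dvd_power by blast

lemma factor_induct [consumes 1, case_names unit factor]:
  fixes p :: "'l::field poly"
  assumes "p \<noteq> 0"
    and unit: "\<And>p. is_unit p \<Longrightarrow> P p"
    and factor: "\<And>g q. irreducible g \<Longrightarrow> q \<noteq> 0 \<Longrightarrow> P q \<Longrightarrow> P (g * q)"
  shows "P p"
  using assms(1)
proof (induction "degree p" arbitrary: p rule: less_induct)
  case less
  show ?case
  proof (cases "degree p = 0")
    case True
    with less.prems show ?thesis by (intro unit) (simp add: is_unit_iff_degree)
  next
    case False
    then obtain g where g: "irreducible g" "g dvd p" using ex_irreducible_factor by blast
    then obtain q where q: "p = g * q" by blast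
    with less.prems have nz: "g \<noteq> 0" "q \<noteq> 0" by auto
    from q nz irreducible_degree_pos[OF g(1)] have "degree q < degree p" by (simp add: degree_mult_eq)
    with less.hyps nz factor g(1) q show ?thesis by blast
  qed
qed

lemma split_off_power:
  fixes p g :: "'l::field poly"
  assumes "p \<noteq> 0" "irreducible g"
  obtains e q where "p = g ^ e * q" "\<not> g dvd q"
proof -
  have "\<exists>e q. p = g ^ e * q \<and> \<not> g dvd q"
    using assms(1)
  proof (induction "degree p" arbitrary: p rule: less_induct)
    case less
    show ?case
    proof (cases "g dvd p")
      case False
      thus ?thesis by (intro exI[of _ 0] exI[of _ p]) simp
    next
      case True
      then obtain q where q: "p = g * q" by blast
      with less.prems have nz: "g \<noteq> 0" "q \<noteq> 0" by auto
      from q nz irreducible_degree_pos[OF assms(2)] have "degree q < degree p" by (simp add: degree_mult_eq)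
      from less.hyps[OF this nz(2)] obtain e r where "q = g ^ e * r" "\<not> g dvd r" by blast
      with q show ?thesis by (intro exI[of _ "Suc e"] exI[of _ r]) (simp add: mult_ac)
    qed
  qed
  with that show ?thesis by blast
qed

text \<open>
  The polynomials divisible by \<open>g\<close> form a prime ideal \<open>P\<close>; the lemma is the Nullstellensatz for \<open>P\<close>.
  Write \<open>H = g\<^sup>e q\<close> with \<open>q\<close> prime to \<open>g\<close>.  A point of \<open>H = 0\<close> at which \<open>F q\<close> does not vanish exists by
  \<open>monic_nullstellensatz\<close>, and there every \<open>G\<close> in \<open>P\<close> vanishes because \<open>H\<close> divides \<open>G\<^sup>e q\<close>.
\<close>

lemma generic_point:
  fixes H F :: "'a::alg_closed_field mpoly poly"
  assumes H: "lead_coeff H = 1" and g: "irreducible g" "g dvd fract_poly H"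
    and F: "\<not> g dvd fract_poly F"
  obtains b y where "pt_eval b y F \<noteq> 0" "\<And>G. g dvd fract_poly G \<Longrightarrow> pt_eval b y G = 0"
proof -
  have "H \<noteq> 0" using H by auto
  hence "fract_poly H \<noteq> 0" using fract_poly_inj[of H 0] by (simp add: fract_poly_simps)
  from split_off_power[OF this g(1)] obtain e q where eq: "fract_poly H = g ^ e * q" "\<not> g dvd q" by blast
  obtain c Q where cQ: "c \<noteq> 0" "fract_poly Q = smult (to_fract c) q" using clear_denominators by blast
  have "to_fract c \<noteq> 0" using cQ(1) by simp
  have Q: "\<not> g dvd fract_poly Q" unfolding cQ(2) using eq(2) \<open>to_fract c \<noteq> 0\<close> by (simp add: dvd_smult_iff)
  have "\<not> g dvd fract_poly (F * Q)"
    using irreducible_dvd_mult[OF g(1)] F Q by (auto simp: fract_poly_simps)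
  hence "\<not> H dvd (F * Q) ^ degree H"
  proof (rule contrapos_nn)
    assume "H dvd (F * Q) ^ degree H"
    then obtain W where "(F * Q) ^ degree H = H * W" by blast
    hence "fract_poly (F * Q) ^ degree H = fract_poly H * fract_poly W" by (metis fract_poly_simps(1,4))
    with g(2) have "g dvd fract_poly (F * Q) ^ degree H" by (metis dvd_mult2)
    thus "g dvd fract_poly (F * Q)" by (rule irreducible_dvd_power[OF g(1)])
  qed
  with monic_nullstellensatz[OF H] obtain b y
    where by0: "pt_eval b y H = 0" "pt_eval b y (F * Q) \<noteq> 0" by blast
  show ?thesis
  proof (rule that)
    show "pt_eval b y F \<noteq> 0" using by0(2) by (auto simp: pt_eval_simps)
  next
    fix G assume G: "g dvd fract_poly G"
    have "fract_poly H dvd fract_poly (G ^ e * Q)"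
      unfolding eq(1) fract_poly_simps cQ(2)
      by (intro mult_dvd_mono dvd_power_same G dvd_smult) simp
    from monic_dvd_of_fract_dvd[OF H this] obtain W where W: "G ^ e * Q = H * W" by blast
    have "pt_eval b y G ^ e * pt_eval b y Q = 0"
      using arg_cong[OF W, of "pt_eval b y"] by0(1) by (simp add: pt_eval_simps)
    with by0(2) show "pt_eval b y G = 0" by (auto simp: pt_eval_simps)
  qed
qed

text \<open>
  The hypersurface is the union of the zero sets of the prime ideals defined by the irreducible
  factors \<open>g\<close> of \<open>H\<close>: if each of these ideals contained a polynomial not vanishing at the point, then the
  product of these polynomials, with multiplicities, would be divisible by \<open>H\<close>.
\<close>

lemma factor_through_point:
  fixes H :: "'a::alg_closed_field mpoly poly"
  assumes H: "lead_coeff H = 1" and pt: "pt_eval b y H = 0"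
  obtains g where "irreducible g" "g dvd fract_poly H"
    "\<And>G. g dvd fract_poly G \<Longrightarrow> pt_eval b y G = 0"
proof (rule ccontr)
  assume "\<not> thesis"
  with that have *: "\<exists>G. g dvd fract_poly G \<and> pt_eval b y G \<noteq> 0"
    if "irreducible g" "g dvd fract_poly H" for g using that by blast
  have "H \<noteq> 0" using H by auto
  hence "fract_poly H \<noteq> 0" using fract_poly_inj[of H 0] by (simp add: fract_poly_simps)
  have "\<exists>G. p dvd fract_poly G \<and> pt_eval b y G \<noteq> 0" if "p \<noteq> 0" "p dvd fract_poly H" for p
    using that
  proof (induction p rule: factor_induct)
    case (unit p)
    have "p dvd fract_poly 1 \<and> pt_eval b y 1 \<noteq> 0"
      using unit(1) by (simp add: fract_poly_simps pt_eval_simps)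
    thus ?case by blast
  next
    case (factor g q)
    from factor(4) have "g dvd fract_poly H" "q dvd fract_poly H"
      by (auto dest: dvd_mult_left dvd_mult_right)
    with *[OF factor(1)] factor(3) obtain G G' where "g dvd fract_poly G" "pt_eval b y G \<noteq> 0"
      "q dvd fract_poly G'" "pt_eval b y G' \<noteq> 0" by blast
    hence "g * q dvd fract_poly (G * G')" "pt_eval b y (G * G') \<noteq> 0"
      by (simp_all add: fract_poly_simps pt_eval_simps mult_dvd_mono)
    thus ?case by blast
  qed
  from this[OF \<open>fract_poly H \<noteq> 0\<close>] obtain G where
    G: "fract_poly H dvd fract_poly G" "pt_eval b y G \<noteq> 0" by auto
  from monic_dvd_of_fract_dvd[OF H G(1)] obtain W where "G = H * W" by blast
  with G(2) pt show False by (simp add: pt_eval_simps)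
qed

section \<open>Norms and the specialisation of irreducible factors\<close>

text \<open>
  For a monic divisor \<open>H\<close>, pseudo-division is division with remainder.
\<close>

definition monic_rem :: "'b::idom poly \<Rightarrow> 'b poly \<Rightarrow> 'b poly" where
  "monic_rem F H = snd (pseudo_divmod F H)"

lemma monic_rem:
  fixes F H :: "'b::idom poly"
  assumes "lead_coeff H = 1"
  shows "\<exists>S. F = H * S + monic_rem F H" "monic_rem F H = 0 \<or> degree (monic_rem F H) < degree H"
proof -
  obtain S R where SR: "pseudo_divmod F H = (S, R)" by (cases "pseudo_divmod F H")
  from assms have "H \<noteq> 0" by auto
  from pseudo_divmod[OF this SR] assms SR
  show "\<exists>S. F = H * S + monic_rem F H" "monic_rem F H = 0 \<or> degree (monic_rem F H) < degree H"
    by (auto simp: monic_rem_def)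
qed

lemma monic_rem_eqI:
  fixes F H :: "'b::idom poly"
  assumes "lead_coeff H = 1" "F = H * S + R" "R = 0 \<or> degree R < degree H"
  shows "monic_rem F H = R"
proof -
  obtain S' where S': "F = H * S' + monic_rem F H" using monic_rem(1)[OF assms(1)] by blast
  show ?thesis
    by (rule monic_division_unique(2)[OF assms(1) S'[symmetric, THEN trans, OF assms(2)]])
      (use monic_rem(2)[OF assms(1)] assms(3) in auto)
qed

text \<open>
  Multiplication by \<open>F\<close> on \<open>B[T]/(H)\<close> in the basis of powers of \<open>T\<close>.  Its determinant is the norm of
  \<open>F\<close>.  It detects common factors as the resultant of \<open>H\<close> and \<open>F\<close> does, and since \<open>H\<close> is monic it
  commutes with homomorphisms even if these lower the degree of \<open>F\<close>.
\<close>

definition mult_matrix :: "'b::idom poly \<Rightarrow> 'b poly \<Rightarrow> 'b mat" where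
  "mult_matrix F H = mat (degree H) (degree H) (\<lambda>(i, j). coeff (monic_rem (F * monom 1 j) H) i)"

lemma hom_lead_coeff_monic:
  assumes "comm_ring_hom (tau :: 'b::idom \<Rightarrow> 'c::idom)" "lead_coeff H = 1"
  shows "lead_coeff (map_poly tau H) = 1" "degree (map_poly tau H) = degree H"
proof -
  interpret comm_ring_hom tau by fact
  have c: "coeff (map_poly tau H) (degree H) = 1"
    unfolding coeff_map_poly_hom assms(2) hom_one ..
  show d: "degree (map_poly tau H) = degree H"
  proof (rule antisym[OF degree_map_poly_le le_degree])
    show "coeff (map_poly tau H) (degree H) \<noteq> 0" unfolding c by (rule one_neq_zero)
  qed
  show "lead_coeff (map_poly tau H) = 1" unfolding d by (rule c)
qed

lemma map_monic_rem:
  assumes tau: "comm_ring_hom (tau :: 'b::idom \<Rightarrow> 'c::idom)" and H: "lead_coeff H = 1"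
  shows "monic_rem (map_poly tau F) (map_poly tau H) = map_poly tau (monic_rem F H)"
proof -
  interpret comm_ring_hom tau by fact
  interpret M: map_poly_comm_ring_hom tau ..
  obtain S where S: "F = H * S + monic_rem F H" using monic_rem(1)[OF H] by blast
  show ?thesis
  proof (rule monic_rem_eqI)
    show "lead_coeff (map_poly tau H) = 1" by (rule hom_lead_coeff_monic[OF tau H])
    show "map_poly tau F = map_poly tau H * map_poly tau S + map_poly tau (monic_rem F H)"
      by (subst S) (simp only: M.hom_add M.hom_mult)
    have "degree (map_poly tau (monic_rem F H)) \<le> degree (monic_rem F H)"
      by (rule degree_map_poly_le)
    moreover have "map_poly tau (monic_rem F H) = 0" if "monic_rem F H = 0"
      unfolding that by (rule M.hom_zero)
    ultimately show "map_poly tau (monic_rem F H) = 0 \<or>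
        degree (map_poly tau (monic_rem F H)) < degree (map_poly tau H)"
      unfolding hom_lead_coeff_monic(2)[OF tau H] using monic_rem(2)[OF H, of F] by linarith
  qed
qed

lemma det_mult_matrix_map:
  assumes tau: "comm_ring_hom (tau :: 'b::idom \<Rightarrow> 'c::idom)" and H: "lead_coeff H = 1"
  shows "det (mult_matrix (map_poly tau F) (map_poly tau H)) = tau (det (mult_matrix F H))"
proof -
  interpret comm_ring_hom tau by fact
  interpret M: map_poly_comm_ring_hom tau ..
  have "coeff (monic_rem (map_poly tau F * monom 1 j) (map_poly tau H)) i =
      tau (coeff (monic_rem (F * monom 1 j) H) i)" for i j
  proof -
    have "map_poly tau F * monom 1 j = map_poly tau (F * monom 1 j)"
      unfolding M.hom_mult map_poly_hom_monom hom_one ..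
    thus ?thesis by (simp only: map_monic_rem[OF tau H] coeff_map_poly_hom)
  qed
  hence "mult_matrix (map_poly tau F) (map_poly tau H) = map_mat tau (mult_matrix F H)"
    unfolding mult_matrix_def hom_lead_coeff_monic(2)[OF tau H] by (intro eq_matI) auto
  thus ?thesis by (simp only: hom_det)
qed

lemma monic_rem_sum:
  fixes F H :: "'b::idom poly" and n :: nat
  assumes H: "lead_coeff H = 1"
  shows "monic_rem (F * (\<Sum>j<n. smult (v j) (P j))) H = (\<Sum>j<n. smult (v j) (monic_rem (F * P j) H))"
proof -
  have "\<forall>j. \<exists>S. F * P j = H * S + monic_rem (F * P j) H" using monic_rem(1)[OF H] by blast
  then obtain S where S: "\<And>j. F * P j = H * S j + monic_rem (F * P j) H" by metis
  show ?thesis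
  proof (rule monic_rem_eqI[OF H])
    have "F * (\<Sum>j<n. smult (v j) (P j)) = (\<Sum>j<n. smult (v j) (F * P j))"
      by (simp add: sum_distrib_left)
    also have "\<dots> = (\<Sum>j<n. smult (v j) (H * S j + monic_rem (F * P j) H))"
      using S by simp
    also have "\<dots> = H * (\<Sum>j<n. smult (v j) (S j)) + (\<Sum>j<n. smult (v j) (monic_rem (F * P j) H))"
      by (simp add: smult_add_right sum.distrib sum_distrib_left)
    finally show "F * (\<Sum>j<n. smult (v j) (P j)) =
        H * (\<Sum>j<n. smult (v j) (S j)) + (\<Sum>j<n. smult (v j) (monic_rem (F * P j) H))" .
    show "(\<Sum>j<n. smult (v j) (monic_rem (F * P j) H)) = 0 \<or>
        degree (\<Sum>j<n. smult (v j) (monic_rem (F * P j) H)) < degree H"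
    proof (cases "degree H = 0")
      case True
      hence "monic_rem (F * P j) H = 0" for j using monic_rem(2)[OF H, of "F * P j"] by simp
      thus ?thesis by simp
    next
      case False
      have "degree (smult (v j) (monic_rem (F * P j) H)) \<le> degree H - 1" for j
        using monic_rem(2)[OF H, of "F * P j"] False degree_smult_le[of "v j" "monic_rem (F * P j) H"]
        by auto
      hence "degree (\<Sum>j<n. smult (v j) (monic_rem (F * P j) H)) \<le> degree H - 1"
        by (intro degree_sum_le) auto
      with False show ?thesis by linarith
    qed
  qed
qed

lemma coeff_sum_monom:
  "coeff (\<Sum>j<n. smult (v j) (monom 1 j)) i = (if i < n then v i else 0)"
  for v :: "nat \<Rightarrow> 'b::comm_ring_1"
  by (induction n) (auto simp: less_Suc_eq)

lemma poly_as_sum_below: "degree V < n \<Longrightarrow> V = (\<Sum>j<n. smult (coeff V j) (monom 1 j))"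
  for V :: "'b::comm_ring_1 poly"
  by (rule poly_eqI) (simp add: coeff_sum_monom coeff_eq_0)

lemma mult_matrix_mult_vec:
  fixes F H :: "'b::idom poly"
  assumes H: "lead_coeff H = 1" and n: "n = degree H"
  shows "mult_matrix F H *\<^sub>v vec n v =
    vec n (coeff (monic_rem (F * (\<Sum>j<n. smult (v j) (monom 1 j))) H))"
  unfolding monic_rem_sum[OF H] n
  by (rule eq_vecI)
    (auto simp: mult_matrix_def scalar_prod_def coeff_sum lessThan_atLeast0 mult.commute intro!: sum.cong)

text \<open>
  The nonzero vectors in the kernel of the matrix are the coefficient vectors of these \<open>V\<close>.
\<close>

lemma det_mult_matrix_eq_0_iff:
  fixes F H :: "'l::field poly"
  assumes H: "lead_coeff H = 1"
  shows "det (mult_matrix F H) = 0 \<longleftrightarrow> (\<exists>V. V \<noteq> 0 \<and> degree V < degree H \<and> H dvd F * V)"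
proof -
  let ?n = "degree H"
  have M: "mult_matrix F H \<in> carrier_mat ?n ?n" by (simp add: mult_matrix_def)
  have dvd_iff: "H dvd P \<longleftrightarrow> monic_rem P H = 0" for P
  proof
    assume "H dvd P"
    then obtain S where "P = H * S" by (rule dvdE)
    hence "P = H * S + 0" by simp
    from monic_rem_eqI[OF H this] show "monic_rem P H = 0" by simp
  next
    assume "monic_rem P H = 0"
    with monic_rem(1)[OF H, of P] show "H dvd P" by auto
  qed
  show ?thesis
  proof
    assume "det (mult_matrix F H) = 0"
    then obtain w where w: "w \<in> carrier_vec ?n" "w \<noteq> 0\<^sub>v ?n" "mult_matrix F H *\<^sub>v w = 0\<^sub>v ?n"
      using det_0_iff_vec_prod_zero_field[OF M] by blast
    let ?V = "\<Sum>j<?n. smult (w $ j) (monom 1 j)"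
    have w': "w = vec ?n (\<lambda>j. w $ j)" using w(1) by auto
    have cV: "coeff ?V j = (if j < ?n then w $ j else 0)" for j
      by (rule coeff_sum_monom)
    have npos: "?n \<noteq> 0"
    proof
      assume "?n = 0"
      with w(1,2) show False by auto
    qed
    have "?V \<noteq> 0"
    proof
      assume "?V = 0"
      hence "w $ j = 0" if "j < ?n" for j using cV[of j] that by simp
      with w(1,2) show False by auto
    qed
    moreover have "degree ?V < ?n"
    proof -
      have "degree ?V \<le> ?n - 1" by (rule degree_le) (use cV npos in auto)
      with npos show ?thesis by linarith
    qed
    moreover have "monic_rem (F * ?V) H = 0"
    proof (rule poly_eqI)
      fix i
      have vz: "vec ?n (coeff (monic_rem (F * ?V) H)) = 0\<^sub>v ?n"
        using mult_matrix_mult_vec[OF H refl, of F "\<lambda>j. w $ j"] w(3)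
        unfolding w'[symmetric] by (metis (no_types))
      have "coeff (monic_rem (F * ?V) H) i = 0" if "i < ?n"
        using arg_cong[OF vz, of "\<lambda>u. vec_index u i"]
        unfolding index_vec[OF that] index_zero_vec(1)[OF that] .
      moreover have "coeff (monic_rem (F * ?V) H) i = 0" if "\<not> i < ?n"
        using monic_rem(2)[OF H, of "F * ?V"] that by (auto intro: coeff_eq_0)
      ultimately show "coeff (monic_rem (F * ?V) H) i = coeff 0 i" by auto
    qed
    ultimately show "\<exists>V. V \<noteq> 0 \<and> degree V < degree H \<and> H dvd F * V"
      unfolding dvd_iff by blast
  next
    assume "\<exists>V. V \<noteq> 0 \<and> degree V < degree H \<and> H dvd F * V"
    then obtain V where V: "V \<noteq> 0" "degree V < ?n" "monic_rem (F * V) H = 0"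
      unfolding dvd_iff by blast
    have "mult_matrix F H *\<^sub>v vec ?n (coeff V) = vec ?n (coeff (monic_rem (F * V) H))"
      unfolding mult_matrix_mult_vec[OF H refl] poly_as_sum_below[OF V(2), symmetric] ..
    also have "\<dots> = 0\<^sub>v ?n" unfolding V(3) by auto
    finally have "mult_matrix F H *\<^sub>v vec ?n (coeff V) = 0\<^sub>v ?n" .
    moreover have "vec ?n (coeff V) \<noteq> 0\<^sub>v ?n"
    proof
      assume "vec ?n (coeff V) = 0\<^sub>v ?n"
      from arg_cong[OF this, of "\<lambda>u. vec_index u (degree V)"] have "coeff V (degree V) = 0"
        unfolding index_vec[OF V(2)] index_zero_vec(1)[OF V(2)] .
      with V(1) show False by simp
    qed
    ultimately show "det (mult_matrix F H) = 0"
      using det_0_iff_vec_prod_zero_field[OF M] by (metis vec_carrier)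
  qed
qed

lemma coprime_cancel:
  fixes p a V :: "'l::field poly"
  assumes "p \<noteq> 0" "\<And>g. irreducible g \<Longrightarrow> g dvd p \<Longrightarrow> \<not> g dvd a" "p dvd a * V"
  shows "p dvd V"
  using assms
proof (induction p arbitrary: V rule: factor_induct)
  case (unit p)
  thus ?case by blast
next
  case (factor g q)
  have "g dvd a * V" using factor.prems(2) by (rule dvd_mult_left)
  moreover have "\<not> g dvd a" using factor.prems(1)[OF factor.hyps(1)] by simp
  ultimately have "g dvd V" using irreducible_dvd_mult[OF factor.hyps(1)] by blast
  then obtain W where W: "V = g * W" by blast
  have "g \<noteq> 0" using factor.hyps(1) by auto
  have "g * q dvd g * (a * W)" using factor.prems(2) W by (simp add: mult_ac)
  with \<open>g \<noteq> 0\<close> have "q dvd a * W" by (simp only: dvd_mult_cancel_left) auto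
  moreover have "\<not> h dvd a" if "irreducible h" "h dvd q" for h
    using factor.prems(1)[OF that(1)] that(2) by (simp add: dvd_mult)
  ultimately have "q dvd W" using factor.IH by blast
  with W show ?case by (simp add: mult_dvd_mono)
qed

text \<open>
  A common factor of \<open>H\<close> and \<open>F\<close> makes the norm of \<open>F\<close> vanish.  The norm of the specialised \<open>F\<close> vanishes
  too, which over a field yields a common factor of the specialisations.
\<close>

lemma common_factor_specialises:
  fixes tau :: "'b::idom \<Rightarrow> 'b" and H F :: "'b poly"
  assumes tau: "comm_ring_hom tau" and H: "lead_coeff H = 1"
    and g: "irreducible g" "g dvd fract_poly H" "g dvd fract_poly F"
  obtains g' where "irreducible g'" "g' dvd fract_poly (map_poly tau H)" "g' dvd fract_poly (map_poly tau F)"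
proof (rule ccontr)
  assume no: "\<not> thesis"
  note fr = to_fract_hom.comm_ring_hom_axioms
  have tau0: "tau 0 = 0"
  proof -
    interpret comm_ring_hom tau by fact
    show ?thesis by (rule hom_zero)
  qed
  let ?H = "fract_poly H" and ?H' = "fract_poly (map_poly tau H)"
  have H': "lead_coeff (map_poly tau H) = 1" by (rule hom_lead_coeff_monic[OF tau H])
  have lH: "lead_coeff ?H = 1" and lH': "lead_coeff ?H' = 1"
    by (rule hom_lead_coeff_monic(1)[OF fr H], rule hom_lead_coeff_monic(1)[OF fr H'])
  obtain q where q: "?H = g * q" using g(2) by blast
  have nz: "?H \<noteq> 0" using lH by auto
  with q have "g \<noteq> 0" "q \<noteq> 0" by auto
  have "degree q < degree ?H"
    using q \<open>g \<noteq> 0\<close> \<open>q \<noteq> 0\<close> irreducible_degree_pos[OF g(1)] by (simp add: degree_mult_eq)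
  moreover have "?H dvd fract_poly F * q" unfolding q using g(3) by (simp add: mult_dvd_mono)
  ultimately have "det (mult_matrix (fract_poly F) ?H) = 0"
    using \<open>q \<noteq> 0\<close> det_mult_matrix_eq_0_iff[OF lH] by blast
  hence "det (mult_matrix F H) = 0"
    unfolding det_mult_matrix_map[OF fr H] by simp
  hence "det (mult_matrix (fract_poly (map_poly tau F)) ?H') = 0"
    unfolding det_mult_matrix_map[OF fr H'] det_mult_matrix_map[OF tau H]
    using tau0 by simp
  then obtain V where V: "V \<noteq> 0" "degree V < degree ?H'" "?H' dvd fract_poly (map_poly tau F) * V"
    using det_mult_matrix_eq_0_iff[OF lH'] by blast
  have "?H' dvd V"
    by (rule coprime_cancel[OF _ _ V(3)]) (use lH' no that in auto)
  from dvd_imp_degree_le[OF this V(1)] V(2) show False by linarith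
qed

lemma finite_irreducible_factors:
  fixes p :: "'l::field poly"
  assumes "p \<noteq> 0"
  obtains S where "finite S" "\<And>g. g \<in> S \<Longrightarrow> irreducible g \<and> g dvd p"
    "\<And>g. irreducible g \<Longrightarrow> g dvd p \<Longrightarrow> \<exists>s\<in>S. s dvd g"
proof -
  have "\<exists>S. finite S \<and> (\<forall>g\<in>S. irreducible g \<and> g dvd p) \<and>
      (\<forall>g. irreducible g \<longrightarrow> g dvd p \<longrightarrow> (\<exists>s\<in>S. s dvd g))"
    using assms
  proof (induction p rule: factor_induct)
    case (unit p)
    show ?case
    proof (intro exI[of _ "{}"] conjI allI impI)
      fix g assume "irreducible g" "g dvd p"
      with unit have False using dvd_trans irreducible_not_unit by blast
      thus "\<exists>s\<in>{}. s dvd g" ..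
    qed auto
  next
    case (factor g q)
    then obtain S where S: "finite S" "\<forall>g\<in>S. irreducible g \<and> g dvd q"
      "\<forall>g. irreducible g \<longrightarrow> g dvd q \<longrightarrow> (\<exists>s\<in>S. s dvd g)" by blast
    show ?case
    proof (intro exI[of _ "insert g S"] conjI ballI allI impI)
      fix h assume h: "irreducible h" "h dvd g * q"
      from irreducible_dvd_mult[OF this] show "\<exists>s\<in>insert g S. s dvd h"
      proof
        assume "h dvd g"
        then obtain u where u: "g = h * u" by blast
        with irreducibleD[OF factor.hyps(1) u] irreducible_not_unit[OF h(1)] have "is_unit u" by blast
        with u have "g dvd h" by simp
        thus ?thesis by blast
      next
        assume "h dvd q"
        with S(3) h(1) show ?thesis by blast
      qed
    qed (use S factor in auto)
  qed
  with that show ?thesis by blast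
qed

text \<open>
  A vector space \<open>J\<close> over an infinite field is not covered by finitely many proper subspaces \<open>J \<inter> N s\<close>:
  if \<open>F\<close> avoids all of \<open>S\<close> and \<open>G\<close> avoids \<open>p\<close>, each of the subspaces contains \<open>F + c G\<close> for at most one scalar
  \<open>c\<close>.
\<close>

lemma avoid_finitely_many_subspaces:
  fixes J :: "'v::ab_group_add \<Rightarrow> bool" and N :: "'s \<Rightarrow> 'v \<Rightarrow> bool" and scale :: "'a::field \<Rightarrow> 'v \<Rightarrow> 'v"
  assumes K: "infinite (UNIV :: 'a set)"
    and J0: "J 0" and J: "\<And>c F G. J F \<Longrightarrow> J G \<Longrightarrow> J (F + scale c G)"
    and Nsub: "\<And>s F G. N s F \<Longrightarrow> N s G \<Longrightarrow> N s (F - G)"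
    and Nscale: "\<And>s c F. c \<noteq> 0 \<Longrightarrow> N s (scale c F) \<longleftrightarrow> N s F"
    and scale: "\<And>c c' F. scale c F - scale c' F = scale (c - c') F"
    and fin: "finite S" and ex: "\<And>s. s \<in> S \<Longrightarrow> \<exists>F. J F \<and> \<not> N s F"
  shows "\<exists>F. J F \<and> (\<forall>s\<in>S. \<not> N s F)"
  using fin ex
proof (induction S)
  case empty
  with J0 show ?case by blast
next
  case (insert p S)
  then obtain F G where F: "J F" "\<forall>s\<in>S. \<not> N s F" and G: "J G" "\<not> N p G" by blast
  have Nadd: "N s F" if "N s (F + scale c G)" "N s G" for s c
  proof (cases "c = 0")
    case True
    have "scale 0 G = 0" using scale[of 0 G 0] by simp
    with that(1) True show ?thesis by simp
  next
    case False
    with that(2) have "N s (scale c G)" using Nscale by blast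
    from Nsub[OF that(1) this] show ?thesis by simp
  qed
  have "finite {c. N s (F + scale c G)}" if s: "s \<in> insert p S" for s
  proof (rule ccontr)
    assume inf: "infinite {c. N s (F + scale c G)}"
    then obtain c where c: "N s (F + scale c G)" using not_finite_existsD by blast
    from inf have "infinite ({c. N s (F + scale c G)} - {c})" by simp
    then obtain c' where c': "N s (F + scale c' G)" "c' \<noteq> c"
      by (metis (mono_tags, lifting) Diff_iff finite.emptyI insertI1 mem_Collect_eq ex_in_conv)
    have "N s (scale (c - c') G)" using Nsub[OF c c'(1)] by (simp add: scale)
    with c'(2) have "N s G" using Nscale[of "c - c'"] by simp
    with Nadd[OF c] F(2) G(2) s show False by blast
  qed
  hence "finite (\<Union>s\<in>insert p S. {c. N s (F + scale c G)})" using insert.hyps(1) by blast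
  with K obtain c where "c \<notin> (\<Union>s\<in>insert p S. {c. N s (F + scale c G)})"
    by (metis UNIV_eq_I)
  with J[OF F(1) G(1)] show ?case by blast
qed

lemma fract_poly_monic_nonzero: "lead_coeff H = 1 \<Longrightarrow> fract_poly H \<noteq> 0" for H :: "'b::idom poly"
  using fract_poly_inj[of H 0] by (auto simp: fract_poly_simps)

text \<open>
  The statement says that the prime ideal of \<open>g\<close> is contained in the preimage of the prime ideal of
  some irreducible factor \<open>g'\<close> of the specialised equation.  By \<open>common_factor_specialises\<close> each single
  element of the first ideal lies in one of these finitely many preimages, and as they are
  \<open>K\<close>-subspaces, one of them contains the whole ideal.
\<close>

lemma factor_specialises:
  fixes tau :: "'a::alg_closed_field mpoly \<Rightarrow> 'a mpoly" and H :: "'a mpoly poly"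
  assumes tau: "comm_ring_hom tau" and const: "\<And>c. tau (mconst c) = mconst c"
    and H: "lead_coeff H = 1" and g: "irreducible g" "g dvd fract_poly H"
  obtains g' where "irreducible g'" "g' dvd fract_poly (map_poly tau H)"
    "\<And>F. g dvd fract_poly F \<Longrightarrow> g' dvd fract_poly (map_poly tau F)"
proof -
  let ?H' = "fract_poly (map_poly tau H)"
  have "lead_coeff (map_poly tau H) = 1" by (rule hom_lead_coeff_monic(1)[OF tau H])
  hence "?H' \<noteq> 0" by (rule fract_poly_monic_nonzero)
  then obtain S where
    S: "finite S" "\<And>s. s \<in> S \<Longrightarrow> irreducible s \<and> s dvd ?H'"
      "\<And>g. irreducible g \<Longrightarrow> g dvd ?H' \<Longrightarrow> \<exists>s\<in>S. s dvd g"
    using finite_irreducible_factors by metis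
  let ?J = "\<lambda>F. g dvd fract_poly F" and ?N = "\<lambda>s F. s dvd fract_poly (map_poly tau F)"
  let ?scale = "\<lambda>c F. smult (mconst c :: 'a mpoly) F"
  have sc: "map_poly tau (?scale c F) = ?scale c (map_poly tau F)" for c F
  proof -
    interpret comm_ring_hom tau by fact
    show ?thesis by (rule poly_eqI) (simp only: coeff_map_poly_hom coeff_smult hom_mult const)
  qed
  have tau_diff: "map_poly tau (F - G) = map_poly tau F - map_poly tau G" for F G
  proof -
    interpret comm_ring_hom tau by fact
    show ?thesis by (rule poly_eqI) (simp only: coeff_map_poly_hom coeff_diff hom_minus)
  qed
  have "\<exists>s\<in>S. \<forall>F. ?J F \<longrightarrow> ?N s F"
  proof (rule ccontr)
    assume "\<not> ?thesis"
    hence ex: "\<exists>F. ?J F \<and> \<not> ?N s F" if "s \<in> S" for s using that by blast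
    have "\<exists>F. ?J F \<and> (\<forall>s\<in>S. \<not> ?N s F)"
    proof (rule avoid_finitely_many_subspaces[of ?J ?scale ?N S])
      show "infinite (UNIV :: 'a set)" by (rule infinite_UNIV_alg_closed)
      show "?J 0" unfolding fract_poly_simps by (rule dvd_0_right)
      show "?J (F + ?scale c G)" if "?J F" "?J G" for c F G
        unfolding fract_poly_simps using that by (intro dvd_add dvd_smult)
      show "?N s (F - G)" if "?N s F" "?N s G" for s F G
        unfolding tau_diff fract_poly_simps using that by (intro dvd_diff)
      show "?N s (?scale c F) = ?N s F" if "c \<noteq> 0" for s c F
      proof -
        have "to_fract (mconst c :: 'a mpoly) \<noteq> 0" using that by simp
        thus ?thesis unfolding sc fract_poly_simps(7) by (rule dvd_smult_iff)
      qed
      show "?scale c F - ?scale c' F = ?scale (c - c') F" for c c' F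
        by (simp only: mconst_hom.hom_minus smult_diff_left)
      show "finite S" by (rule S(1))
    qed (rule ex)
    then obtain F where F: "?J F" "\<And>s. s \<in> S \<Longrightarrow> \<not> ?N s F" by blast
    from common_factor_specialises[OF tau H g F(1)] obtain g' where
      g': "irreducible g'" "g' dvd ?H'" "?N g' F" by blast
    from S(3)[OF this(1,2)] obtain s where "s \<in> S" "s dvd g'" by blast
    with g'(3) F(2) show False using dvd_trans by blast
  qed
  with S(2) that show ?thesis by blast
qed

section \<open>Upper bounds for the dimension\<close>

abbreviation ev :: "(nat \<Rightarrow> 'a::comm_ring_1) \<Rightarrow> 'a mpoly \<Rightarrow> 'a" where
  "ev \<equiv> minst (\<lambda>c. c)"

lemma ev_simps:
  "ev u (F * G) = ev u F * ev u G" "ev u (F + G) = ev u F + ev u G" "ev u (F ^ e) = ev u F ^ e"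
  "ev u (mconst c) = c" "ev u (mvar i) = u i" "ev u 0 = 0" "ev u 1 = 1"
  "ev u (prod f A) = (\<Prod>x\<in>A. ev u (f x))" "ev u (sum f A) = (\<Sum>x\<in>A. ev u (f x))"
proof -
  interpret comm_ring_hom "ev u" by (rule comm_ring_hom.minst_comm_ring_hom[OF id_hom])
  show "ev u (F * G) = ev u F * ev u G" by (rule hom_mult)
  show "ev u (F + G) = ev u F + ev u G" by (rule hom_add)
  show "ev u (F ^ e) = ev u F ^ e" by (rule hom_power)
  show "ev u 0 = 0" "ev u 1 = 1" by (rule hom_zero, rule hom_one)
  show "ev u (mconst c) = c" by (rule comm_ring_hom.minst_mconst[OF id_hom])
  show "ev u (mvar i) = u i" by (rule comm_ring_hom.minst_mvar[OF id_hom])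
  show "ev u (prod f A) = (\<Prod>x\<in>A. ev u (f x))" by (rule hom_prod)
  show "ev u (sum f A) = (\<Sum>x\<in>A. ev u (f x))" by (rule hom_sum)
qed

lemma ev_minst: "ev u (minst mconst q F) = ev (\<lambda>i. ev u (q i)) F"
  unfolding comm_ring_hom.hom_minst[OF comm_ring_hom.minst_comm_ring_hom[OF id_hom]]
  by (simp add: ev_simps)

lemma meval_vec: "F \<in> mpolys n \<Longrightarrow> meval (vec n u) F = ev u F"
  unfolding meval_eq_minst by (rule minst_cong) auto

text \<open>
  Otherwise \<open>Z\<close> would be the union of the proper closed subsets \<open>F = 0\<close> and \<open>G = 0\<close>.
\<close>

lemma irreducible_variety_prime:
  assumes Z: "irreducible_variety n Z" and FG: "F \<in> mpolys n" "G \<in> mpolys n"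
    and van: "\<And>x. x \<in> Z \<Longrightarrow> meval x F * meval x G = 0"
  shows "(\<forall>x\<in>Z. meval x F = 0) \<or> (\<forall>x\<in>Z. meval x G = 0)"
proof -
  obtain S where S: "S \<subseteq> mpolys n" "Z = zeros n S"
    using Z by (auto simp: irreducible_variety_def affine_variety_def)
  let ?Z1 = "zeros n (insert F S)" and ?Z2 = "zeros n (insert G S)"
  have "affine_variety n ?Z1" "affine_variety n ?Z2"
    unfolding affine_variety_def using S FG by blast+
  moreover have "Z = ?Z1 \<union> ?Z2" using S van by (auto simp: zeros_def)
  ultimately have "Z = ?Z1 \<or> Z = ?Z2" using Z unfolding irreducible_variety_def by blast
  thus ?thesis by (auto simp: zeros_def)
qed

text \<open>
  Polynomials that vanish on two proper closed subsets, but not on the whole set, have a product that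
  does not vanish on the whole set; so the two subsets cannot cover it.
\<close>

lemma irreducible_varietyI:
  assumes S: "S \<subseteq> mpolys n" and ne: "zeros n S \<noteq> {}"
    and prime: "\<And>F G x y. F \<in> mpolys n \<Longrightarrow> G \<in> mpolys n \<Longrightarrow> x \<in> zeros n S \<Longrightarrow> y \<in> zeros n S \<Longrightarrow>
      meval x F \<noteq> 0 \<Longrightarrow> meval y G \<noteq> 0 \<Longrightarrow> \<exists>z\<in>zeros n S. meval z F * meval z G \<noteq> 0"
  shows "irreducible_variety n (zeros n S)"
  unfolding irreducible_variety_def
proof (intro conjI allI impI)
  show "affine_variety n (zeros n S)" unfolding affine_variety_def using S by blast
  show "zeros n S \<noteq> {}" by fact
next
  fix V1 V2 assume V: "affine_variety n V1 \<and> affine_variety n V2 \<and> zeros n S = V1 \<union> V2"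
  then obtain S1 S2 where S1: "S1 \<subseteq> mpolys n" "V1 = zeros n S1" and S2: "S2 \<subseteq> mpolys n" "V2 = zeros n S2"
    by (auto simp: affine_variety_def)
  show "zeros n S = V1 \<or> zeros n S = V2"
  proof (rule ccontr)
    assume "\<not> ?thesis"
    with V obtain x y where xy: "x \<in> zeros n S" "x \<notin> V1" "y \<in> zeros n S" "y \<notin> V2" by blast
    then obtain F G where FG: "F \<in> S1" "meval x F \<noteq> 0" "G \<in> S2" "meval y G \<noteq> 0"
      unfolding S1 S2 by (auto simp: zeros_def)
    with S1 S2 have "F \<in> mpolys n" "G \<in> mpolys n" by auto
    from prime[OF this xy(1,3) FG(2,4)] obtain z where z: "z \<in> zeros n S" "meval z F * meval z G \<noteq> 0"
      by blast
    with V have "z \<in> V1 \<or> z \<in> V2" by blast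
    with z(2) FG(1,3) show False unfolding S1 S2 by (auto simp: zeros_def)
  qed
qed

lemma meval_mult: "meval x (F * G) = meval x F * meval x G"
  unfolding meval_eq_minst by (rule ev_simps)

lemma irreducible_variety_power:
  assumes Z: "irreducible_variety n Z" and FG: "F \<in> mpolys n" "G \<in> mpolys n"
    and van: "\<And>x. x \<in> Z \<Longrightarrow> meval x F ^ e * meval x G = 0"
    and x: "x \<in> Z" "meval x F \<noteq> 0" and y: "y \<in> Z"
  shows "meval y G = 0"
proof (cases "e = 0")
  case False
  have "F ^ e \<in> mpolys n" using FG(1) by (rule mpolys_power)
  moreover have p: "meval x (F ^ e) = meval x F ^ e" for x unfolding meval_eq_minst by (rule ev_simps)
  ultimately have "(\<forall>x\<in>Z. meval x (F ^ e) = 0) \<or> (\<forall>x\<in>Z. meval x G = 0)"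
    using van by (intro irreducible_variety_prime[OF Z _ FG(2)]) simp_all
  with x y show ?thesis by (auto simp: p)
qed (use van y in simp)

lemma hom_of_poly_value: "comm_ring_hom h \<Longrightarrow> h (poly p x) = poly (map_poly h p) (h x)"
proof -
  assume "comm_ring_hom h"
  then interpret comm_ring_hom h .
  show ?thesis by (rule poly_map_poly[symmetric])
qed

text \<open>
  Along a chain of irreducible varieties, choose \<open>G i\<close> vanishing on \<open>Z i\<close> but not on the next member.
  Then \<open>G 0, \<dots>, G (r - 1)\<close> are algebraically independent as functions on \<open>Z r\<close>.  In a relation, the
  highest power of \<open>G (r - 1)\<close> that divides all terms may be cancelled on \<open>Z r\<close>, which is
  irreducible.  On \<open>Z (r - 1)\<close>, where \<open>G (r - 1)\<close> vanishes, what remains is a nonzero relation between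
  \<open>G 0, \<dots>, G (r - 2)\<close>.  The lengths of chains are thereby bounded by numbers of variables.
\<close>

lemma chain_independent:
  fixes Z :: "nat \<Rightarrow> 'a::field vec set" and Rel :: "'a mpoly"
  assumes "\<And>i. i \<le> r \<Longrightarrow> irreducible_variety n (Z i)"
    and "\<And>i. i < r \<Longrightarrow> Z i \<subseteq> Z (Suc i)"
    and "\<And>i. i < r \<Longrightarrow> G i \<in> mpolys n"
    and "\<And>i x. i < r \<Longrightarrow> x \<in> Z i \<Longrightarrow> meval x (G i) = 0"
    and "\<And>i. i < r \<Longrightarrow> \<exists>x\<in>Z (Suc i). meval x (G i) \<noteq> 0"
    and "Rel \<in> mpolys r" and "\<And>x. x \<in> Z r \<Longrightarrow> ev (\<lambda>i. meval x (G i)) Rel = 0"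
  shows "Rel = 0"
  using assms
proof (induction r arbitrary: Rel)
  case 0
  from mpolys_zero_vars[OF 0(6)] obtain c where c: "Rel = mconst c" ..
  from 0(1)[of 0] obtain x where x: "x \<in> Z 0" unfolding irreducible_variety_def by blast
  from 0(7)[OF x] have "c = 0" unfolding c by (simp only: ev_simps)
  with c show ?case by simp
next
  case (Suc r)
  show ?case
  proof (rule ccontr)
    assume "Rel \<noteq> 0"
    hence "vsplit r Rel \<noteq> 0" by simp
    from order_decomp[OF this, of 0] obtain P' where
      P': "vsplit r Rel = [:0, 1:] ^ order 0 (vsplit r Rel) * P'" "\<not> [:0, 1:] dvd P'" by auto
    define e where "e = order 0 (vsplit r Rel)"
    have P: "vsplit r Rel = monom 1 e * P'" using P'(1) by (simp add: e_def monom_altdef)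
    have c0: "coeff P' 0 \<noteq> 0" using P'(2) poly_eq_0_iff_dvd[of P' 0] by (simp add: poly_0_coeff_0)
    have cP': "coeff P' i \<in> mpolys r" for i
    proof -
      have "coeff P' i = coeff (vsplit r Rel) (i + e)" unfolding P by (simp add: coeff_monom_mult)
      with coeff_vsplit_mpolys[OF Suc.prems(6)] show ?thesis by simp
    qed
    define Rel' where "Rel' = poly P' (mvar r)"
    have Rel: "Rel = mvar r ^ e * Rel'"
      using poly_vsplit[of r Rel] unfolding P Rel'_def by (simp add: poly_monom)
    have Rel': "Rel' \<in> mpolys (Suc r)"
      unfolding Rel'_def poly_altdef
      by (intro mpolys_sum mpolys_mult mpolys_power mpolys_mvar mpolys_mono[OF _ cP']) auto
    have K: "minst mconst G Rel' \<in> mpolys n" using Rel' Suc.prems(3) by (rule mpolys_minst)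
    have evK: "meval x (minst mconst G Rel') = ev (\<lambda>i. meval x (G i)) Rel'" for x
      unfolding meval_eq_minst ev_minst ..
    have van: "meval x (G r) ^ e * meval x (minst mconst G Rel') = 0" if "x \<in> Z (Suc r)" for x
      using Suc.prems(7)[OF that] unfolding evK Rel by (simp add: ev_simps)
    obtain x0 where x0: "x0 \<in> Z (Suc r)" "meval x0 (G r) \<noteq> 0" using Suc.prems(5)[of r, OF lessI] by blast
    have irr: "irreducible_variety n (Z (Suc r))" by (rule Suc.prems(1)) simp
    have Gr: "G r \<in> mpolys n" by (rule Suc.prems(3)) simp
    have "ev (\<lambda>i. meval x (G i)) (coeff P' 0) = 0" if x: "x \<in> Z r" for x
    proof -
      let ?g = "\<lambda>i. meval x (G i)"
      have "x \<in> Z (Suc r)" using x Suc.prems(2)[of r, OF lessI] by blast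
      from irreducible_variety_power[OF irr Gr K van x0 this] have "ev ?g Rel' = 0"
        unfolding evK .
      moreover have "ev ?g Rel' = poly (map_poly (ev ?g) P') (ev ?g (mvar r))"
        unfolding Rel'_def
        by (rule hom_of_poly_value[OF comm_ring_hom.minst_comm_ring_hom[OF id_hom]])
      moreover have "ev ?g (mvar r) = 0" using Suc.prems(4)[OF _ x] by (simp add: ev_simps)
      ultimately show ?thesis by (simp add: poly_0_coeff_0 coeff_map_poly ev_simps)
    qed
    note van0 = this
    have "coeff P' 0 = 0"
    proof (rule Suc.IH)
      show "irreducible_variety n (Z i)" if "i \<le> r" for i by (rule Suc.prems(1)) (use that in simp)
      show "Z i \<subseteq> Z (Suc i)" if "i < r" for i by (rule Suc.prems(2)) (use that in simp)
      show "G i \<in> mpolys n" if "i < r" for i by (rule Suc.prems(3)) (use that in simp)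
      show "meval x (G i) = 0" if "i < r" "x \<in> Z i" for i x
        by (rule Suc.prems(4)[OF _ that(2)]) (use that(1) in simp)
      show "\<exists>x\<in>Z (Suc i). meval x (G i) \<noteq> 0" if "i < r" for i
        by (rule Suc.prems(5)) (use that in simp)
      show "coeff P' 0 \<in> mpolys r" by (rule cP')
    qed (rule van0)
    with c0 show False by simp
  qed
qed

subsection \<open>Algebraic dependence by counting monomials\<close>

lemma more_unknowns_than_equations:
  fixes a :: "'x \<Rightarrow> 'b \<Rightarrow> 'a::field"
  assumes "finite B" "finite A" "card B < card A"
  shows "\<exists>c. (\<exists>x\<in>A. c x \<noteq> 0) \<and> (\<forall>b\<in>B. (\<Sum>x\<in>A. c x * a x b) = 0)"
  using assms
proof (induction B arbitrary: A a)
  case empty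
  then obtain x where "x \<in> A" by fastforce
  thus ?case by (intro exI[of _ "\<lambda>_. 1"]) auto
next
  case (insert b0 B)
  show ?case
  proof (cases "\<forall>x\<in>A. a x b0 = 0")
    case True
    have "card B < card A" using insert by simp
    from insert.IH[OF insert.prems(1) this, of a] obtain c where
      "\<exists>x\<in>A. c x \<noteq> 0" "\<forall>b\<in>B. (\<Sum>x\<in>A. c x * a x b) = 0" by blast
    with True show ?thesis by (intro exI[of _ c]) auto
  next
    case False
    then obtain x0 where x0: "x0 \<in> A" "a x0 b0 \<noteq> 0" by blast
    let ?A = "A - {x0}"
    let ?a = "\<lambda>x b. a x b - a x b0 / a x0 b0 * a x0 b"
    have "finite ?A" "card B < card ?A" using insert x0 by auto
    from insert.IH[OF this, of ?a] obtain c where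
      c: "\<exists>x\<in>?A. c x \<noteq> 0" "\<forall>b\<in>B. (\<Sum>x\<in>?A. c x * ?a x b) = 0" by blast
    \<comment> \<open>The value that solves equation \<open>b0\<close> for the eliminated unknown \<open>x0\<close>.\<close>
    define t where "t = - (\<Sum>x\<in>?A. c x * a x b0) / a x0 b0"
    have sum: "(\<Sum>x\<in>A. (c(x0 := t)) x * a x b) = t * a x0 b + (\<Sum>x\<in>?A. c x * a x b)" for b
    proof -
      have "(\<Sum>x\<in>A. (c(x0 := t)) x * a x b) = (c(x0 := t)) x0 * a x0 b + (\<Sum>x\<in>?A. (c(x0 := t)) x * a x b)"
        using insert.prems(1) x0(1) by (rule sum.remove)
      also have "(\<Sum>x\<in>?A. (c(x0 := t)) x * a x b) = (\<Sum>x\<in>?A. c x * a x b)"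
        by (rule sum.cong) auto
      finally show ?thesis by simp
    qed
    have "(\<Sum>x\<in>A. (c(x0 := t)) x * a x b) = 0" if "b \<in> insert b0 B" for b
    proof (cases "b = b0")
      case True
      show ?thesis unfolding sum True using x0 by (simp add: t_def)
    next
      case False
      with that c(2) have "0 = (\<Sum>x\<in>?A. c x * ?a x b)" by simp
      also have "\<dots> = (\<Sum>x\<in>?A. c x * a x b) - (\<Sum>x\<in>?A. c x * a x b0) / a x0 b0 * a x0 b"
        by (simp add: right_diff_distrib sum_subtractf divide_inverse sum_distrib_right sum_distrib_left mult_ac)
      also have "\<dots> = (\<Sum>x\<in>?A. c x * a x b) + t * a x0 b" by (simp add: t_def)
      finally show ?thesis unfolding sum by (simp add: add.commute)
    qed
    moreover have "\<exists>x\<in>A. (c(x0 := t)) x \<noteq> 0" using c(1) by auto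
    ultimately show ?thesis by blast
  qed
qed

definition exps_bounded :: "nat \<Rightarrow> 'a::zero mpoly \<Rightarrow> bool" where
  "exps_bounded D F \<longleftrightarrow> (\<forall>k\<in>Poly_Mapping.keys F. \<forall>j. Poly_Mapping.lookup k j \<le> D)"

lemma exps_bounded_mult:
  assumes "exps_bounded D F" "exps_bounded D' G"
  shows "exps_bounded (D + D') (F * G)"
  unfolding exps_bounded_def
proof (intro ballI allI)
  fix k j assume "k \<in> Poly_Mapping.keys (F * G)"
  then obtain a b where "k = a + b" "a \<in> Poly_Mapping.keys F" "b \<in> Poly_Mapping.keys G"
    using keys_mult[of F G] by blast
  with assms show "Poly_Mapping.lookup k j \<le> D + D'"
    by (auto simp: exps_bounded_def lookup_add intro!: add_mono)
qed

lemma exps_bounded_1: "exps_bounded 0 (1 :: 'a::comm_ring_1 mpoly)"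
  by (auto simp: exps_bounded_def)

lemma exps_bounded_power: "exps_bounded D F \<Longrightarrow> exps_bounded (e * D) (F ^ e)"
  for F :: "'a::comm_ring_1 mpoly"
  by (induction e) (auto simp: exps_bounded_1 intro: exps_bounded_mult)

lemma exps_bounded_prod:
  "(\<And>i. i < r \<Longrightarrow> exps_bounded (D i) (F i)) \<Longrightarrow> exps_bounded (\<Sum>i<r. D i) (\<Prod>i<r. F i)"
  for F :: "nat \<Rightarrow> 'a::comm_ring_1 mpoly"
  by (induction r) (auto simp: exps_bounded_1 intro: exps_bounded_mult)

lemma exps_bounded_mono: "D \<le> D' \<Longrightarrow> exps_bounded D F \<Longrightarrow> exps_bounded D' F"
  unfolding exps_bounded_def using le_trans by blast

lemma ex_exps_bounded: "\<exists>D. \<forall>i<r. exps_bounded D (G i)" for G :: "nat \<Rightarrow> 'a::zero mpoly"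
proof -
  have "\<exists>D. exps_bounded D F" for F :: "'a mpoly"
  proof -
    let ?T = "\<Union>k\<in>Poly_Mapping.keys F. Poly_Mapping.lookup k ` Poly_Mapping.keys k"
    have fin: "finite ?T" by auto
    have "Poly_Mapping.lookup k j \<le> Max (insert 0 ?T)" if "k \<in> Poly_Mapping.keys F" for k j
    proof (cases "j \<in> Poly_Mapping.keys k")
      case True
      with that fin show ?thesis by (intro Max_ge) auto
    qed (simp add: in_keys_iff)
    thus ?thesis unfolding exps_bounded_def by blast
  qed
  then obtain D where D: "exps_bounded (D F) F" for F :: "'a mpoly" by metis
  have "D (G i) \<le> (\<Sum>i<r. D (G i))" if "i < r" for i
    using that by (intro member_le_sum) auto
  with exps_bounded_mono D show ?thesis by blast
qed

lemma card_bounded_exponents: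
  "finite {k :: nat \<Rightarrow>\<^sub>0 nat. Poly_Mapping.keys k \<subseteq> {..<m} \<and> (\<forall>j. Poly_Mapping.lookup k j \<le> N)}"
  "card {k :: nat \<Rightarrow>\<^sub>0 nat. Poly_Mapping.keys k \<subseteq> {..<m} \<and> (\<forall>j. Poly_Mapping.lookup k j \<le> N)} \<le> (N + 1) ^ m"
proof -
  let ?B = "{k :: nat \<Rightarrow>\<^sub>0 nat. Poly_Mapping.keys k \<subseteq> {..<m} \<and> (\<forall>j. Poly_Mapping.lookup k j \<le> N)}"
  let ?f = "\<lambda>k. restrict (Poly_Mapping.lookup k) {..<m}"
  have inj: "inj_on ?f ?B"
  proof (rule inj_onI)
    fix k k' assume k: "k \<in> ?B" "k' \<in> ?B" "?f k = ?f k'"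
    show "k = k'"
    proof (rule poly_mapping_eqI)
      fix j
      show "Poly_Mapping.lookup k j = Poly_Mapping.lookup k' j"
      proof (cases "j < m")
        case True
        with fun_cong[OF k(3), of j] show ?thesis by simp
      next
        case False
        with k(1,2) have "j \<notin> Poly_Mapping.keys k" "j \<notin> Poly_Mapping.keys k'" by auto
        thus ?thesis by (simp add: in_keys_iff)
      qed
    qed
  qed
  have sub: "?f ` ?B \<subseteq> {..<m} \<rightarrow>\<^sub>E {..N}" by (auto simp: PiE_def)
  have fin: "finite ({..<m} \<rightarrow>\<^sub>E {..N})" by (intro finite_PiE) auto
  show "finite ?B" using finite_imageD[OF finite_subset[OF sub fin] inj] .
  have "card ?B = card (?f ` ?B)" by (rule card_image[OF inj, symmetric])
  also have "\<dots> \<le> card ({..<m} \<rightarrow>\<^sub>E {..N})" by (rule card_mono[OF fin sub])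
  also have "\<dots> = (N + 1) ^ m" by (simp add: card_PiE)
  finally show "card ?B \<le> (N + 1) ^ m" .
qed

lemma minst_mconst_sum: "minst mconst G (sum F E) = (\<Sum>e\<in>E. minst mconst G (F e))"
  by (induction E rule: infinite_finite_induct) (simp_all add: mconst_hom.minst_add minst_def[of _ _ 0])

text \<open>
  The \<open>(N + 1)\<^sup>r\<close> monomials in the \<open>G i\<close> with exponents at most \<open>N\<close> lie in a space spanned by
  \<open>(r N D + 1)\<^sup>m\<close> monomials, where \<open>D\<close> bounds the exponents in all \<open>G i\<close>.  As \<open>m < r\<close>, they are linearly dependent
  for large \<open>N\<close>.
\<close>

lemma algebraically_dependent:
  fixes G :: "nat \<Rightarrow> 'a::field mpoly"
  assumes m: "m < r" and G: "\<And>i. i < r \<Longrightarrow> G i \<in> mpolys m"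
  obtains Rel where "Rel \<in> mpolys r" "Rel \<noteq> 0" "minst mconst G Rel = 0"
proof -
  obtain D where D: "\<And>i. i < r \<Longrightarrow> exps_bounded D (G i)" using ex_exps_bounded[of r G] by blast
  \<comment> \<open>With this \<open>N\<close>, \<open>(r N D + 1)\<^sup>m \<le> (N (r D + 1))\<^sup>m = N\<^bsup>m+1\<^esup> \<le> N\<^sup>r < (N + 1)\<^sup>r\<close>.\<close>
  define N where "N = (r * D + 1) ^ m"
  define E where "E = ({..<r} \<rightarrow>\<^sub>E {..N})"
  define B where "B = {k :: nat \<Rightarrow>\<^sub>0 nat. Poly_Mapping.keys k \<subseteq> {..<m} \<and> (\<forall>j. Poly_Mapping.lookup k j \<le> r * (N * D))}"
  define M where "M = (\<lambda>e. \<Prod>i<r. G i ^ e i)"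
  define k where "k = (\<lambda>e. \<Sum>i<r. Poly_Mapping.single i (e i :: nat))"
  have N1: "1 \<le> N" by (simp add: N_def)
  have E: "finite E" "card E = (N + 1) ^ r" by (auto simp: E_def card_PiE intro: finite_PiE)
  have B: "finite B" "card B \<le> (r * (N * D) + 1) ^ m" unfolding B_def by (rule card_bounded_exponents)+
  have "card B \<le> (r * (N * D) + 1) ^ m" by (rule B)
  also have "\<dots> \<le> (N * (r * D + 1)) ^ m"
    using N1 by (intro power_mono) (simp_all add: algebra_simps)
  also have "\<dots> = N ^ Suc m" unfolding power_mult_distrib N_def[symmetric] by simp
  also have "\<dots> \<le> N ^ r" using N1 m by (intro power_increasing) auto
  also have "\<dots> < (N + 1) ^ r" using m by (intro power_strict_mono) auto
  finally have "card B < card E" using E by simp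
  from more_unknowns_than_equations[OF B(1) E(1) this, of "\<lambda>e. Poly_Mapping.lookup (M e)"]
  obtain c where c: "\<exists>e\<in>E. c e \<noteq> 0" "\<And>b. b \<in> B \<Longrightarrow> (\<Sum>e\<in>E. c e * Poly_Mapping.lookup (M e) b) = 0"
    by blast
  have lk: "Poly_Mapping.lookup (k e) i = (if i < r then e i else 0)" for e i
    by (auto simp: k_def lookup_sum lookup_single when_def)
  have kinj: "e = e'" if "e \<in> E" "e' \<in> E" "k e = k e'" for e e'
  proof (rule PiE_ext)
    show "e \<in> {..<r} \<rightarrow>\<^sub>E {..N}" "e' \<in> {..<r} \<rightarrow>\<^sub>E {..N}" using that by (auto simp: E_def)
    fix i assume "i \<in> {..<r}"
    with that(3) lk[of e i] lk[of e' i] show "e i = e' i" by simp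
  qed
  have keys_k: "Poly_Mapping.keys (k e) \<subseteq> {..<r}" for e
    using lk by (auto simp: in_keys_iff split: if_splits)
  define Rel where "Rel = (\<Sum>e\<in>E. Poly_Mapping.single (k e) (c e))"
  show ?thesis
  proof (rule that)
    show "Rel \<in> mpolys r"
      unfolding Rel_def by (rule mpolys_sum) (use keys_k in \<open>auto simp: mpolys_def\<close>)
    from c(1) obtain e0 where e0: "e0 \<in> E" "c e0 \<noteq> 0" by blast
    have "Poly_Mapping.lookup Rel (k e0) = (\<Sum>e\<in>E. if e = e0 then c e else 0)"
      unfolding Rel_def lookup_sum
      by (rule sum.cong) (use kinj e0 in \<open>auto simp: lookup_single when_def\<close>)
    also have "\<dots> = c e0" using e0(1) E(1) by simp
    finally show "Rel \<noteq> 0" using e0(2) by auto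
    have mono: "minst mconst G (Poly_Mapping.single (k e) (c e)) = mconst (c e) * M e" for e
      unfolding minst_single[of mconst, OF mconst_hom.hom_zero]
        mon_inst_superset[OF finite_lessThan keys_k] M_def by (simp add: lk)
    have "Poly_Mapping.lookup (\<Sum>e\<in>E. mconst (c e) * M e) b = 0" for b
    proof (cases "b \<in> B")
      case True
      have "Poly_Mapping.lookup (mconst (c e) * M e) b = c e * Poly_Mapping.lookup (M e) b" for e
        unfolding mconst_def mult_map_scale_conv_mult[symmetric]
        by (simp add: Poly_Mapping.map.rep_eq when_def)
      with c(2)[OF True] show ?thesis by (simp add: lookup_sum)
    next
      case False
      have "b \<notin> Poly_Mapping.keys (M e)" if e: "e \<in> E" for e
      proof
        assume b: "b \<in> Poly_Mapping.keys (M e)"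
        have "exps_bounded (\<Sum>i<r. e i * D) (M e)"
          unfolding M_def by (intro exps_bounded_prod exps_bounded_power D)
        moreover have "(\<Sum>i<r. e i * D) \<le> (\<Sum>i<r. N * D)"
          using e by (intro sum_mono mult_right_mono) (auto simp: E_def PiE_iff)
        ultimately have "exps_bounded (r * (N * D)) (M e)" by (auto intro: exps_bounded_mono)
        moreover have "M e \<in> mpolys m" unfolding M_def by (intro mpolys_prod mpolys_power G) auto
        ultimately have "b \<in> B" using b by (auto simp: B_def exps_bounded_def mpolys_def)
        with False show False ..
      qed
      moreover have "Poly_Mapping.keys (mconst (c e) * M e) \<subseteq> Poly_Mapping.keys (M e)" for e
        unfolding mconst_def mult_map_scale_conv_mult[symmetric]
        by (auto simp: in_keys_iff Poly_Mapping.map.rep_eq when_def)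
      ultimately show ?thesis by (auto simp: lookup_sum in_keys_iff subset_iff intro!: sum.neutral)
    qed
    hence "(\<Sum>e\<in>E. mconst (c e) * M e) = 0" by (intro poly_mapping_eqI) simp
    thus "minst mconst G Rel = 0"
      unfolding Rel_def
      by (simp add: mono minst_mconst_sum)
  qed
qed

subsection \<open>Dimension of parametrised sets\<close>

lemma zariski_closure_superset: "S \<subseteq> carrier_vec n \<Longrightarrow> S \<subseteq> zariski_closure n S"
  by (auto simp: zariski_closure_def zeros_def vanishing_ideal_def)

lemma zariski_closure_variety: "affine_variety n Z \<Longrightarrow> zariski_closure n Z \<subseteq> Z"
  by (auto simp: zariski_closure_def zeros_def vanishing_ideal_def affine_variety_def)

lemma separating_polynomial:
  assumes "affine_variety n Z" "x \<in> carrier_vec n" "x \<notin> Z"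
  obtains F where "F \<in> mpolys n" "\<And>z. z \<in> Z \<Longrightarrow> meval z F = 0" "meval x F \<noteq> 0"
  using assms by (force simp: affine_variety_def zeros_def)

text \<open>
  Along each of the finitely many parametrisations by affine \<open>m\<close>-space, more than \<open>m\<close> polynomials satisfy
  an algebraic relation.  The product of these relations holds on \<open>S\<close>, hence on its closure, and
  contradicts \<open>chain_independent\<close>.
\<close>

lemma chain_length_le:
  fixes Params :: "(nat \<Rightarrow> 'a::field mpoly) set"
  assumes fin: "finite Params" and q: "\<And>q i. q \<in> Params \<Longrightarrow> i < n \<Longrightarrow> q i \<in> mpolys m"
    and S: "S \<subseteq> (\<Union>q\<in>Params. range (\<lambda>u. vec n (\<lambda>i. ev u (q i))))"
    and irr: "\<And>i. i \<le> r \<Longrightarrow> irreducible_variety n (Z i)"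
    and strict: "\<And>i. i < r \<Longrightarrow> Z i \<subset> Z (Suc i)"
    and sub: "Z r \<subseteq> zariski_closure n S"
  shows "r \<le> m"
proof (rule ccontr)
  assume "\<not> r \<le> m"
  hence mr: "m < r" by simp
  have "\<exists>F. F \<in> mpolys n \<and> (\<forall>x\<in>Z i. meval x F = 0) \<and> (\<exists>x\<in>Z (Suc i). meval x F \<noteq> 0)"
    if "i < r" for i
  proof -
    obtain x where x: "x \<in> Z (Suc i)" "x \<notin> Z i" using strict[OF \<open>i < r\<close>] by blast
    have "affine_variety n (Z i)" "affine_variety n (Z (Suc i))"
      using irr[of i] irr[of "Suc i"] \<open>i < r\<close> by (simp_all add: irreducible_variety_def)
    moreover from this(2) x(1) have "x \<in> carrier_vec n" by (auto simp: affine_variety_def zeros_def)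
    ultimately show ?thesis using separating_polynomial[of n "Z i" x] x by metis
  qed
  then obtain G where G: "\<And>i. i < r \<Longrightarrow> G i \<in> mpolys n"
    "\<And>i x. i < r \<Longrightarrow> x \<in> Z i \<Longrightarrow> meval x (G i) = 0"
    "\<And>i. i < r \<Longrightarrow> \<exists>x\<in>Z (Suc i). meval x (G i) \<noteq> 0"
    by metis
  have "\<exists>Rel. Rel \<in> mpolys r \<and> Rel \<noteq> 0 \<and> minst mconst (\<lambda>i. minst mconst q (G i)) Rel = 0"
    if "q \<in> Params" for q
  proof -
    have "minst mconst q (G i) \<in> mpolys m" if "i < r" for i
      using G(1)[OF that] q[OF \<open>q \<in> Params\<close>] by (rule mpolys_minst)
    from algebraically_dependent[of m r "\<lambda>i. minst mconst q (G i)", OF mr this]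
    show ?thesis by blast
  qed
  then obtain Rel where Rel: "\<And>q. q \<in> Params \<Longrightarrow> Rel q \<in> mpolys r" "\<And>q. q \<in> Params \<Longrightarrow> Rel q \<noteq> 0"
    "\<And>q. q \<in> Params \<Longrightarrow> minst mconst (\<lambda>i. minst mconst q (G i)) (Rel q) = 0" by metis
  \<comment> \<open>A relation valid on all pieces at once.\<close>
  define R where "R = (\<Prod>q\<in>Params. Rel q)"
  have R: "R \<in> mpolys r" "R \<noteq> 0"
    unfolding R_def using Rel(1,2) fin by (auto simp: prod_zero_iff)
  have ev_R: "meval x (minst mconst G R) = ev (\<lambda>i. meval x (G i)) R" for x
    unfolding meval_eq_minst ev_minst ..
  have "meval x (minst mconst G R) = 0" if x: "x \<in> S" for x
  proof -
    from x S obtain q u where qu: "q \<in> Params" "x = vec n (\<lambda>i. ev u (q i))" by blast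
    have "ev (\<lambda>i. meval x (G i)) (Rel q) = ev (\<lambda>i. ev u (minst mconst q (G i))) (Rel q)"
      by (rule minst_cong[OF Rel(1)[OF qu(1)]]) (simp add: qu(2) meval_vec G(1) ev_minst)
    also have "\<dots> = ev u (minst mconst (\<lambda>i. minst mconst q (G i)) (Rel q))"
      by (rule ev_minst[symmetric])
    also have "\<dots> = 0" unfolding Rel(3)[OF qu(1)] by (rule ev_simps)
    finally show ?thesis unfolding ev_R unfolding R_def ev_simps using fin qu(1) by (auto intro: prod_zero)
  qed
  moreover have "minst mconst G R \<in> mpolys n" using R(1) G(1) by (rule mpolys_minst)
  ultimately have "minst mconst G R \<in> vanishing_ideal n S" by (simp add: vanishing_ideal_def)
  hence van: "ev (\<lambda>i. meval x (G i)) R = 0" if "x \<in> Z r" for x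
    using sub that unfolding ev_R[symmetric] by (auto simp: zariski_closure_def zeros_def)
  have "R = 0"
  proof (rule chain_independent[of r n Z G])
    show "Z i \<subseteq> Z (Suc i)" if "i < r" for i using strict[OF that] by blast
  qed (fact irr G R(1) van)+
  with R(2) show False ..
qed

lemma variety_dim_le:
  fixes Params :: "(nat \<Rightarrow> 'a::field mpoly) set"
  assumes "finite Params" "\<And>q i. q \<in> Params \<Longrightarrow> i < n \<Longrightarrow> q i \<in> mpolys m"
    and "S \<subseteq> (\<Union>q\<in>Params. range (\<lambda>u. vec n (\<lambda>i. ev u (q i))))"
  shows "variety_dim n S \<le> ereal (real m)"
  unfolding variety_dim_def
proof (rule Sup_least)
  fix e assume "e \<in> {ereal (real r) | r. \<exists>Z :: nat \<Rightarrow> 'a vec set.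
     (\<forall>i \<le> r. irreducible_variety n (Z i) \<and> Z i \<subseteq> zariski_closure n S) \<and>
     (\<forall>i < r. Z i \<subset> Z (Suc i))}"
  then obtain r and Z :: "nat \<Rightarrow> 'a vec set" where e: "e = ereal (real r)"
    and Z: "\<forall>i \<le> r. irreducible_variety n (Z i) \<and> Z i \<subseteq> zariski_closure n S"
      "\<forall>i < r. Z i \<subset> Z (Suc i)" by blast
  have "r \<le> m"
  proof (rule chain_length_le[where Z = Z])
    show "finite Params" "S \<subseteq> (\<Union>q\<in>Params. range (\<lambda>u. vec n (\<lambda>i. ev u (q i))))" by fact+
    show "q i \<in> mpolys m" if "q \<in> Params" "i < n" for q i using that by (rule assms(2))
  qed (use Z in blast)+
  thus "e \<le> ereal (real m)" unfolding e by simp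
qed

lemma chain_length_affine_space:
  fixes Z :: "nat \<Rightarrow> 'a::field vec set"
  assumes "\<And>i. i \<le> r \<Longrightarrow> irreducible_variety n (Z i)" "\<And>i. i < r \<Longrightarrow> Z i \<subset> Z (Suc i)"
  shows "r \<le> n"
proof (rule chain_length_le[of "{mvar}" n n "carrier_vec n" r Z])
  show "carrier_vec n \<subseteq> (\<Union>q\<in>{mvar :: nat \<Rightarrow> 'a mpoly}. range (\<lambda>u. vec n (\<lambda>i. ev u (q i))))"
  proof
    fix x :: "'a vec" assume "x \<in> carrier_vec n"
    hence "x = vec n (\<lambda>i. ev (\<lambda>i. x $ i) (mvar i))" by (auto simp: ev_simps)
    thus "x \<in> (\<Union>q\<in>{mvar :: nat \<Rightarrow> 'a mpoly}. range (\<lambda>u. vec n (\<lambda>i. ev u (q i))))" by blast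
  qed
  have "Z r \<subseteq> carrier_vec n"
    using assms(1)[of r] by (auto simp: irreducible_variety_def affine_variety_def zeros_def)
  also have "\<dots> \<subseteq> zariski_closure n (carrier_vec n)" by (rule zariski_closure_superset) simp
  finally show "Z r \<subseteq> zariski_closure n (carrier_vec n)" .
qed (use assms in auto)

lemma irreducible_affine_space:
  assumes "infinite (UNIV :: 'a::field set)"
  shows "irreducible_variety n (carrier_vec n :: 'a vec set)"
proof -
  have eq: "carrier_vec n = zeros n ({} :: 'a mpoly set)" by (simp add: zeros_def)
  show ?thesis unfolding eq
  proof (rule irreducible_varietyI)
    show "zeros n ({} :: 'a mpoly set) \<noteq> {}" unfolding eq[symmetric] using zero_carrier_vec by blast
    fix F G :: "'a mpoly" and x y
    assume FG: "F \<in> mpolys n" "G \<in> mpolys n" and "meval x F \<noteq> 0" "meval y G \<noteq> 0"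
    hence "F \<noteq> 0" "G \<noteq> 0" by (auto simp: meval_eq_minst ev_simps)
    hence "F * G \<noteq> 0" by simp
    from exists_nonzero_value[OF assms this] obtain u where u: "ev u (F * G) \<noteq> 0" by blast
    have "meval (vec n u) F * meval (vec n u) G \<noteq> 0" using u FG by (simp add: meval_vec ev_simps)
    thus "\<exists>z\<in>zeros n {}. meval z F * meval z G \<noteq> 0" unfolding eq[symmetric] by (metis vec_carrier)
  qed simp
qed

text \<open>
  The whole space, which is irreducible, can be put on top of a chain inside the hypersurface.
\<close>

lemma irreducible_hypersurface_chain_le:
  fixes Z :: "nat \<Rightarrow> 'a::field vec set"
  assumes K: "infinite (UNIV :: 'a set)" and H: "H \<in> mpolys n" "H \<noteq> 0"
    and Z: "\<And>i. i \<le> r \<Longrightarrow> irreducible_variety n (Z i)" "\<And>i. i < r \<Longrightarrow> Z i \<subset> Z (Suc i)"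
    and sub: "Z r \<subseteq> zeros n {H}"
  shows "r < n"
proof -
  let ?Z = "\<lambda>i. if i \<le> r then Z i else carrier_vec n"
  obtain u where "ev u H \<noteq> 0" using exists_nonzero_value[OF K H(2)] by blast
  hence "vec n u \<notin> zeros n {H}" using H(1) by (simp add: zeros_def meval_vec)
  hence top: "Z r \<subset> carrier_vec n" using sub by (auto simp: zeros_def)
  have "Suc r \<le> n"
  proof (rule chain_length_affine_space[of _ n ?Z])
    show "irreducible_variety n (?Z i)" for i
      using Z(1) irreducible_affine_space[OF K] by simp
    show "?Z i \<subset> ?Z (Suc i)" if "i < Suc r" for i
      using that Z(2) top by (cases "i = r") auto
  qed
  thus ?thesis by simp
qed

section \<open>Hypersurfaces are equidimensional\<close>

text \<open>
  The restriction of a polynomial to the subspace \<open>X\<^sub>0 = \<dots> = X\<^bsub>j-1\<^esub> = 0\<close>, as a polynomial in \<open>X\<^sub>k\<close>.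
\<close>

definition slice :: "nat \<Rightarrow> nat \<Rightarrow> 'a::comm_ring_1 mpoly \<Rightarrow> 'a mpoly poly" where
  "slice k j = minst (\<lambda>c. [:mconst c:])
     (\<lambda>i. if i < j then 0 else if i = k then [:0, 1:] else [:mvar i:])"

definition kill_var :: "nat \<Rightarrow> 'a::comm_ring_1 mpoly \<Rightarrow> 'a mpoly" where
  "kill_var j = minst mconst (\<lambda>i. if i = j then 0 else mvar i)"

lemma slice_0: "slice k 0 = vsplit k"
  by (simp add: slice_def vsplit_def)

lemma slice_hom: "comm_ring_hom (slice k j)"
  unfolding slice_def by (rule comm_ring_hom.minst_comm_ring_hom[OF const_mconst_hom])

lemma slice_mvar: "slice k j (mvar i) = (if i < j then 0 else if i = k then [:0, 1:] else [:mvar i:])"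
  unfolding slice_def by (rule comm_ring_hom.minst_mvar[OF const_mconst_hom])

lemma slice_simps: "slice k j (F * G) = slice k j F * slice k j G" "slice k j 1 = 1"
proof -
  interpret comm_ring_hom "slice k j" by (rule slice_hom)
  show "slice k j (F * G) = slice k j F * slice k j G" by (rule hom_mult)
  show "slice k j 1 = 1" by (rule hom_one)
qed

lemma kill_var_hom: "comm_ring_hom (kill_var j)"
  unfolding kill_var_def by (rule mconst_hom.minst_comm_ring_hom)

lemma kill_var_simps:
  "kill_var j (mconst c) = mconst c" "kill_var j (mvar i) = (if i = j then 0 else mvar i)"
  unfolding kill_var_def by (rule mconst_hom.minst_mconst, rule mconst_hom.minst_mvar)

lemma map_poly_hom:
  assumes "comm_ring_hom h"
  shows "comm_ring_hom (map_poly h)" "map_poly h [:c:] = [:h c:]" "map_poly h [:0, 1:] = [:0, 1:]"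
    "map_poly h 0 = 0" "map_poly h 1 = 1" "h 0 = 0"
proof -
  interpret comm_ring_hom h by fact
  interpret M: map_poly_comm_ring_hom h ..
  show "comm_ring_hom (map_poly h)" by (rule M.comm_ring_hom_axioms)
  show c: "map_poly h [:c:] = [:h c:]" for c
    unfolding map_poly_pCons_hom M.hom_zero ..
  show "map_poly h [:0, 1:] = [:0, 1:]"
    unfolding map_poly_pCons_hom[of 0] c hom_zero hom_one ..
  show "map_poly h 0 = 0" "map_poly h 1 = 1" by (rule M.hom_zero, rule M.hom_one)
  show "h 0 = 0" by (rule hom_zero)
qed

lemma map_kill_var_slice:
  assumes "j < k"
  shows "map_poly (kill_var j) (slice k j F) = slice k (Suc j) F"
proof -
  note mp = map_poly_hom[OF kill_var_hom[of j]]
  show ?thesis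
    unfolding slice_def comm_ring_hom.hom_minst[OF mp(1)]
    by (rule arg_cong2[where f = "\<lambda>h p. minst h p F"])
      (use assms in \<open>auto simp: fun_eq_iff mp kill_var_simps less_Suc_eq\<close>)
qed

lemma pt_eval_consts: "pt_eval b y [:mconst c:] = c" "pt_eval b y [:0, 1:] = y" "pt_eval b y [:mvar i:] = b i"
  unfolding pt_eval_def map_poly_hom[OF minst_id_hom] by (simp_all add: ev_simps)

lemma pt_eval_X: "pt_eval b y (pCons 0 1) = y"
  using pt_eval_consts(2) by (simp only: one_pCons)

lemma pt_eval_slice:
  "pt_eval b y (slice k j F) = ev (\<lambda>i. if i < j then 0 else if i = k then y else b i) F"
  unfolding slice_def comm_ring_hom.hom_minst[OF pt_eval_hom]
  by (rule arg_cong2[where f = "\<lambda>h p. minst h p F"]) (auto simp: fun_eq_iff pt_eval_consts pt_eval_X pt_eval_simps)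

lemma monic_slice:
  fixes H :: "'a::idom mpoly"
  assumes H: "lead_coeff (vsplit k H) = 1" and "j \<le> k"
  shows "lead_coeff (slice k j H) = 1"
  using \<open>j \<le> k\<close>
proof (induction j)
  case 0
  show ?case unfolding slice_0 by (rule H)
next
  case (Suc j)
  hence "lead_coeff (slice k j H) = 1" by simp
  hence "lead_coeff (map_poly (kill_var j) (slice k j H)) = 1"
    by (rule hom_lead_coeff_monic(1)[OF kill_var_hom])
  with Suc show ?case by (simp add: map_kill_var_slice)
qed

text \<open>
  For an irreducible factor \<open>g\<close> of the restricted equation, the zero set of the prime ideal of all
  polynomials whose restriction is divisible by \<open>g\<close>: a component of the hypersurface cut by the
  subspace \<open>X\<^sub>0 = \<dots> = X\<^bsub>j-1\<^esub> = 0\<close>.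
\<close>

definition factor_variety :: "nat \<Rightarrow> nat \<Rightarrow> 'a::field mpoly fract poly \<Rightarrow> 'a vec set" where
  "factor_variety k j g = zeros (k + 1) {F \<in> mpolys (k + 1). g dvd fract_poly (slice k j F)}"

text \<open>
  The vanishing ideal of \<open>factor_variety k j g\<close> is not larger than the prime ideal that defines it.
\<close>

lemma factor_variety_generic:
  fixes H :: "'a::alg_closed_field mpoly"
  assumes H: "lead_coeff (vsplit k H) = 1" and j: "j \<le> k"
    and g: "irreducible g" "g dvd fract_poly (slice k j H)"
    and F: "F \<in> mpolys (k + 1)" "\<not> g dvd fract_poly (slice k j F)"
  shows "\<exists>z\<in>factor_variety k j g. meval z F \<noteq> 0"
proof -
  obtain b y where by0: "pt_eval b y (slice k j F) \<noteq> 0"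
    "\<And>G. g dvd fract_poly G \<Longrightarrow> pt_eval b y G = 0"
    using generic_point[OF monic_slice[OF H j] g F(2)] by metis
  let ?u = "\<lambda>i. if i < j then 0 else if i = k then y else b i"
  have "ev ?u G = 0" if "g dvd fract_poly (slice k j G)" for G
    using by0(2)[OF that] unfolding pt_eval_slice .
  hence "vec (k + 1) ?u \<in> factor_variety k j g"
    unfolding factor_variety_def zeros_def by (simp add: meval_vec)
  moreover have "meval (vec (k + 1) ?u) F \<noteq> 0"
    using by0(1) F(1) by (simp only: meval_vec pt_eval_slice) simp
  ultimately show ?thesis by blast
qed

lemma factor_variety_irreducible:
  fixes H :: "'a::alg_closed_field mpoly"
  assumes H: "lead_coeff (vsplit k H) = 1" and j: "j \<le> k"
    and g: "irreducible g" "g dvd fract_poly (slice k j H)"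
  shows "irreducible_variety (k + 1) (factor_variety k j g)"
  unfolding factor_variety_def
proof (rule irreducible_varietyI, goal_cases)
  case 1
  show ?case by blast
next
  case 2
  have "\<not> g dvd fract_poly (slice k j 1)"
    using irreducible_not_unit[OF g(1)] by (simp add: slice_simps fract_poly_simps)
  from factor_variety_generic[OF H j g mpolys_1 this] show ?case unfolding factor_variety_def by blast
next
  case (3 F G x y)
  hence "\<not> g dvd fract_poly (slice k j F)" "\<not> g dvd fract_poly (slice k j G)"
    by (auto simp: zeros_def)
  hence "\<not> g dvd fract_poly (slice k j (F * G))"
    using irreducible_dvd_mult[OF g(1)] by (auto simp: slice_simps fract_poly_simps)
  from factor_variety_generic[OF H j g mpolys_mult[OF 3(1,2)] this]
  show ?case unfolding factor_variety_def meval_mult .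
qed

lemma factor_chain:
  fixes H :: "'a::alg_closed_field mpoly"
  assumes H: "lead_coeff (vsplit k H) = 1"
    and g0: "irreducible g0" "g0 dvd fract_poly (slice k 0 H)"
  obtains g where "g 0 = g0"
    "\<And>j. j \<le> k \<Longrightarrow> irreducible (g j) \<and> g j dvd fract_poly (slice k j H)"
    "\<And>j F. j < k \<Longrightarrow> g j dvd fract_poly (slice k j F) \<Longrightarrow> g (Suc j) dvd fract_poly (slice k (Suc j) F)"
proof -
  let ?P = "\<lambda>j g. (j = 0 \<longrightarrow> g = g0) \<and> (j \<le> k \<longrightarrow> irreducible g \<and> g dvd fract_poly (slice k j H))"
  let ?Q = "\<lambda>j g g'. j < k \<longrightarrow>
    (\<forall>F. g dvd fract_poly (slice k j F) \<longrightarrow> g' dvd fract_poly (slice k (Suc j) F))"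
  have "\<exists>g. \<forall>j. ?P j (g j) \<and> ?Q j (g j) (g (Suc j))"
  proof (rule dependent_nat_choice)
    show "\<exists>g. ?P 0 g" using g0 by blast
  next
    fix g j assume g: "?P j g"
    show "\<exists>g'. ?P (Suc j) g' \<and> ?Q j g g'"
    proof (cases "j < k")
      case True
      with g have "irreducible g" "g dvd fract_poly (slice k j H)" by auto
      from factor_specialises[OF kill_var_hom kill_var_simps(1) monic_slice[OF H less_imp_le[OF True]] this]
      obtain g' where g': "irreducible g'" "g' dvd fract_poly (map_poly (kill_var j) (slice k j H))"
        "\<And>F. g dvd fract_poly F \<Longrightarrow> g' dvd fract_poly (map_poly (kill_var j) F)" by metis
      have "?Q j g g'" using g'(3) map_kill_var_slice[OF True] by metis
      with g'(1,2) show ?thesis unfolding map_kill_var_slice[OF True] by (intro exI[of _ g']) simp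
    qed auto
  qed
  then obtain g where g: "\<And>j. ?P j (g j)" "\<And>j. ?Q j (g j) (g (Suc j))" by blast
  show ?thesis by (rule that[of g]) (use g in blast)+
qed

text \<open>
  A component through \<open>x\<close> is cut successively with the hyperplanes \<open>X\<^sub>0 = 0, \<dots>, X\<^bsub>k-1\<^esub> = 0\<close>, following at each
  step one component of the intersection.  The ideal of a component at step \<open>j\<close> belongs to a factor \<open>g j\<close> of
  positive degree in \<open>X\<^sub>k\<close>, so that it does not contain \<open>X\<^sub>j\<close> and the next variety is strictly smaller.
  The equation being monic in \<open>X\<^sub>k\<close>, each component is finite over the space of the other coordinates,
  and no intersection is empty.
\<close>

lemma hypersurface_chain_through_point:
  fixes H :: "'a::alg_closed_field mpoly"
  assumes Hn: "H \<in> mpolys (k + 1)" and H: "lead_coeff (vsplit k H) = 1"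
    and x: "x \<in> zeros (k + 1) {H}"
  obtains W where "\<And>j. j \<le> k \<Longrightarrow> irreducible_variety (k + 1) (W j)"
    "\<And>j. j < k \<Longrightarrow> W (Suc j) \<subset> W j" "x \<in> W 0" "W 0 \<subseteq> zeros (k + 1) {H}"
proof -
  have ptx: "pt_eval (\<lambda>i. x $ i) (x $ k) (slice k 0 F) = meval x F" for F
    unfolding pt_eval_slice meval_eq_minst by (rule arg_cong[where f = "\<lambda>u. ev u F"]) auto
  have "pt_eval (\<lambda>i. x $ i) (x $ k) (slice k 0 H) = 0"
    unfolding ptx using x by (simp add: zeros_def)
  from factor_through_point[OF monic_slice[OF H le0] this] obtain g0 where
    g0: "irreducible g0" "g0 dvd fract_poly (slice k 0 H)"
      "\<And>G. g0 dvd fract_poly G \<Longrightarrow> pt_eval (\<lambda>i. x $ i) (x $ k) G = 0" by metis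
  from factor_chain[OF H g0(1,2)] obtain g where g: "g 0 = g0"
    "\<And>j. j \<le> k \<Longrightarrow> irreducible (g j) \<and> g j dvd fract_poly (slice k j H)"
    "\<And>j F. j < k \<Longrightarrow> g j dvd fract_poly (slice k j F) \<Longrightarrow> g (Suc j) dvd fract_poly (slice k (Suc j) F)"
    by metis
  let ?W = "\<lambda>j. factor_variety k j (g j)"
  show ?thesis
  proof (rule that[of ?W])
    show "irreducible_variety (k + 1) (?W j)" if "j \<le> k" for j
      using factor_variety_irreducible[OF H that] g(2)[OF that] by blast
    show "?W (Suc j) \<subset> ?W j" if j: "j < k" for j
    proof -
      have "?W (Suc j) \<subseteq> ?W j"
        using g(3)[OF j] by (auto simp: factor_variety_def zeros_def)
      moreover have "\<exists>z\<in>?W j. meval z (mvar j) \<noteq> 0"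
      proof (rule factor_variety_generic[OF H])
        show "j \<le> k" "mvar j \<in> mpolys (k + 1)" using j by auto
        show gj: "irreducible (g j)" "g j dvd fract_poly (slice k j H)"
          using g(2)[of j] j by auto
        have "(mvar j :: 'a mpoly) \<noteq> 0"
        proof
          assume "mvar j = (0 :: 'a mpoly)"
          from arg_cong[OF this, of "ev (\<lambda>_. 1)"] show False by (simp add: ev_simps)
        qed
        hence "is_unit (fract_poly (slice k j (mvar j :: 'a mpoly)))"
          using j by (simp add: slice_mvar fract_poly_simps is_unit_pCons_iff)
        thus "\<not> g j dvd fract_poly (slice k j (mvar j))"
          using irreducible_not_unit[OF gj(1)] dvd_trans by blast
      qed
      moreover have "meval z (mvar j) = 0" if "z \<in> ?W (Suc j)" for z
      proof -
        have "mvar j \<in> mpolys (k + 1)" using j by auto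
        moreover have "g (Suc j) dvd fract_poly (slice k (Suc j) (mvar j))"
          by (simp add: slice_mvar fract_poly_simps)
        ultimately show ?thesis using that by (auto simp: factor_variety_def zeros_def)
      qed
      ultimately show ?thesis by blast
    qed
    have "meval x F = 0" if "g 0 dvd fract_poly (slice k 0 F)" for F
      using g0(3)[of "slice k 0 F"] that unfolding ptx g(1) .
    thus "x \<in> ?W 0" using x by (auto simp: factor_variety_def zeros_def)
    show "?W 0 \<subseteq> zeros (k + 1) {H}"
      using g0(2) Hn g(1) by (auto simp: factor_variety_def zeros_def)
  qed
qed

text \<open>
  The variety \<open>W 0\<close> of the preceding lemma is a component, since a larger irreducible subset of the
  hypersurface would, together with the whole space, prolong the chain \<open>W k \<subset> \<dots> \<subset> W 0\<close> beyond the
  length that affine \<open>(k + 1)\<close>-space allows.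
\<close>

lemma local_dim_monic_hypersurface:
  fixes H :: "'a::alg_closed_field mpoly"
  assumes Hn: "H \<in> mpolys (k + 1)" and H: "lead_coeff (vsplit k H) = 1"
    and x: "x \<in> zeros (k + 1) {H}"
  shows "local_dim (k + 1) (zeros (k + 1) {H}) x = ereal (real k)"
proof -
  let ?n = "k + 1" and ?V = "zeros (k + 1) {H}"
  note K = infinite_UNIV_alg_closed[where 'a = 'a]
  have "vsplit k H \<noteq> 0" using H by (metis coeff_0 zero_neq_one)
  hence H0: "H \<noteq> 0" by simp
  obtain W where W: "\<And>j. j \<le> k \<Longrightarrow> irreducible_variety ?n (W j)"
    "\<And>j. j < k \<Longrightarrow> W (Suc j) \<subset> W j" "x \<in> W 0" "W 0 \<subseteq> ?V"
    using hypersurface_chain_through_point[OF Hn H x] by metis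
  let ?Z = "\<lambda>i. W (k - i)"
  have Zirr: "irreducible_variety ?n (?Z i)" for i by (rule W(1)) simp
  have Zss: "?Z i \<subset> ?Z (Suc i)" if "i < k" for i
    using W(2)[of "k - Suc i"] that by (simp add: Suc_diff_Suc)
  have comp: "irreducible_component ?n ?V (W 0)"
    unfolding irreducible_component_def
  proof (intro conjI allI impI)
    show "irreducible_variety ?n (W 0)" by (rule W(1)) simp
    show "W 0 \<subseteq> ?V" by (rule W(4))
    fix Z' assume Z': "irreducible_variety ?n Z' \<and> W 0 \<subseteq> Z' \<and> Z' \<subseteq> ?V"
    show "Z' = W 0"
    proof (rule ccontr)
      assume "Z' \<noteq> W 0"
      with Z' have ss: "W 0 \<subset> Z'" by blast
      \<comment> \<open>The chain \<open>W k \<subset> \<dots> \<subset> W 0 \<subset> Z'\<close>.\<close>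
      let ?Y = "\<lambda>i. if i \<le> k then ?Z i else Z'"
      have "Suc k < ?n"
      proof (rule irreducible_hypersurface_chain_le[OF K Hn H0, of _ ?Y])
        show "irreducible_variety ?n (?Y i)" for i using Zirr Z' by simp
        show "?Y i \<subset> ?Y (Suc i)" if "i < Suc k" for i
          using that Zss[of i] ss by (cases "i = k") auto
        show "?Y (Suc k) \<subseteq> ?V" using Z' by simp
      qed
      thus False by simp
    qed
  qed
  show ?thesis
  proof (rule antisym)
    show "local_dim ?n ?V x \<le> ereal (real k)"
      unfolding local_dim_def
    proof (rule Sup_least)
      fix e assume "e \<in> {variety_dim ?n Z | Z. irreducible_component ?n ?V Z \<and> x \<in> Z}"
      then obtain Z where Z: "e = variety_dim ?n Z" "irreducible_component ?n ?V Z" by blast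
      hence "affine_variety ?n Z" "Z \<subseteq> ?V"
        by (auto simp: irreducible_component_def irreducible_variety_def)
      hence cl: "zariski_closure ?n Z \<subseteq> ?V" using zariski_closure_variety by blast
      show "e \<le> ereal (real k)" unfolding Z(1) variety_dim_def
      proof (rule Sup_least)
        fix e assume "e \<in> {ereal (real r) | r. \<exists>Y :: nat \<Rightarrow> 'a vec set.
          (\<forall>i \<le> r. irreducible_variety ?n (Y i) \<and> Y i \<subseteq> zariski_closure ?n Z) \<and>
          (\<forall>i < r. Y i \<subset> Y (Suc i))}"
        then obtain r and Y :: "nat \<Rightarrow> 'a vec set" where e: "e = ereal (real r)"
          and Y: "\<forall>i \<le> r. irreducible_variety ?n (Y i) \<and> Y i \<subseteq> zariski_closure ?n Z"
            "\<forall>i < r. Y i \<subset> Y (Suc i)" by blast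
        have "r < ?n"
          by (rule irreducible_hypersurface_chain_le[OF K Hn H0, of r Y]) (use Y cl in blast)+
        thus "e \<le> ereal (real k)" unfolding e by simp
      qed
    qed
    have "ereal (real k) \<le> variety_dim ?n (W 0)"
      unfolding variety_dim_def
    proof (rule Sup_upper, rule CollectI, intro exI[of _ k] exI[of _ ?Z] conjI allI impI refl)
      fix i :: nat assume "i \<le> k"
      show "irreducible_variety ?n (?Z i)" by (rule Zirr)
      have dec: "W j \<subseteq> W 0" if "j \<le> k" for j
        using that
      proof (induction j)
        case (Suc j)
        with W(2)[of j] show ?case by auto
      qed simp
      have "W 0 \<subseteq> carrier_vec ?n" using W(4) by (auto simp: zeros_def)
      with dec[of "k - i"] show "?Z i \<subseteq> zariski_closure ?n (W 0)"
        using zariski_closure_superset by (metis diff_le_self subset_trans)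
    qed (rule Zss)
    also have "\<dots> \<le> local_dim ?n ?V x"
      unfolding local_dim_def by (rule Sup_upper) (use comp W(3) in blast)
    finally show "ereal (real k) \<le> local_dim ?n ?V x" .
  qed
qed

section \<open>Tangent spaces of hypersurfaces\<close>

text \<open>
  The kernel dimension depends on the kernel only, which is also the kernel of the matrix with the
  single row \<open>w\<close>; the echelon form of this matrix has one pivot.
\<close>

lemma kernel_dim_hyperplane:
  fixes J :: "'a::field mat" and w :: "'a vec"
  assumes J: "J \<in> carrier_mat nr n" and w: "w \<in> carrier_vec n" and j: "j < n" "w $ j \<noteq> 0"
    and ker: "mat_kernel J = {v \<in> carrier_vec n. w \<bullet> v = 0}"
  shows "kernel_dim J = n - 1"
proof -
  define A where "A = mat_of_rows n [w]"
  have A: "A \<in> carrier_mat 1 n" by (simp add: A_def mat_of_rows_def)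
  have rowA: "row A 0 = w" using w by (simp add: A_def)
  have Av: "A *\<^sub>v v = 0\<^sub>v 1 \<longleftrightarrow> w \<bullet> v = 0" for v
  proof
    assume "A *\<^sub>v v = 0\<^sub>v 1"
    from arg_cong[OF this, of "\<lambda>u. vec_index u 0"] show "w \<bullet> v = 0" using A rowA by simp
  next
    assume "w \<bullet> v = 0"
    thus "A *\<^sub>v v = 0\<^sub>v 1" using A rowA by (intro eq_vecI) auto
  qed
  have "mat_kernel A = mat_kernel J" unfolding ker mat_kernel[OF A] Av ..
  hence "kernel_dim J = kernel_dim A" using A J unfolding kernel_dim_def by simp
  also have "\<dots> = n - length (pivot_positions (gauss_jordan_single A))"
    using A by (simp add: kernel_dim_code)
  also have "length (pivot_positions (gauss_jordan_single A)) = 1"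
  proof -
    define C where "C = gauss_jordan_single A"
    note gj = gauss_jordan_single[OF A C_def[symmetric]]
    have "row C 0 \<noteq> 0\<^sub>v n"
    proof
      assume r: "row C 0 = 0\<^sub>v n"
      have "C *\<^sub>v unit_vec n j = 0\<^sub>v 1" using gj(2) r by (intro eq_vecI) auto
      hence "A *\<^sub>v unit_vec n j = 0\<^sub>v 1" using gj(1)[of "unit_vec n j"] by simp
      hence "w \<bullet> unit_vec n j = 0" using Av by simp
      thus False using j w by simp
    qed
    hence "{i. i < 1 \<and> row C i \<noteq> 0\<^sub>v n} = {0}" by auto
    with find_base_vectors(5)[OF gj(3,2)] show ?thesis by (simp add: C_def)
  qed
  finally show ?thesis .
qed

abbreviation at_curve :: "(nat \<Rightarrow> 'a::field poly) \<Rightarrow> 'a mpoly \<Rightarrow> 'a poly" where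
  "at_curve \<equiv> minst (\<lambda>c. [:c:])"

lemma at_curve_hom: "comm_ring_hom (at_curve \<gamma>)"
  by (rule comm_ring_hom.minst_comm_ring_hom[OF pCons_0_hom[OF id_hom]])

lemma at_curve_simps:
  "at_curve \<gamma> (F * G) = at_curve \<gamma> F * at_curve \<gamma> G" "at_curve \<gamma> (F ^ e) = at_curve \<gamma> F ^ e"
  "at_curve \<gamma> (sum f A) = (\<Sum>x\<in>A. at_curve \<gamma> (f x))"
proof -
  interpret comm_ring_hom "at_curve \<gamma>" by (rule at_curve_hom)
  show "at_curve \<gamma> (F * G) = at_curve \<gamma> F * at_curve \<gamma> G" by (rule hom_mult)
  show "at_curve \<gamma> (F ^ e) = at_curve \<gamma> F ^ e" by (rule hom_power)
  show "at_curve \<gamma> (sum f A) = (\<Sum>x\<in>A. at_curve \<gamma> (f x))" by (rule hom_sum)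
qed

lemma at_curve_first_order:
  assumes F: "F \<in> mpolys n" and \<gamma>: "\<And>i. i < n \<Longrightarrow> coeff (\<gamma> i) 0 = x i \<and> coeff (\<gamma> i) (Suc 0) = v i"
  shows "coeff (at_curve \<gamma> F) 0 = ev x F"
    "coeff (at_curve \<gamma> F) (Suc 0) = (\<Sum>i<n. ev x (mpderiv i F) * v i)"
proof -
  have c: "ev (\<lambda>i. coeff (\<gamma> i) 0) G = ev x G" if "G \<in> mpolys n" for G
    by (rule minst_cong[OF that]) (use \<gamma> in blast)
  show "coeff (at_curve \<gamma> F) 0 = ev x F" unfolding coeff_0_minst[OF id_hom] by (rule c[OF F])
  show "coeff (at_curve \<gamma> F) (Suc 0) = (\<Sum>i<n. ev x (mpderiv i F) * v i)"
    unfolding coeff_1_minst[OF id_hom F]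
    by (rule sum.cong) (use \<gamma> c mpolys_mpderiv[OF F] in auto)
qed

text \<open>
  Taylor's formula to second order, obtained by substituting \<open>p j + s\<close> for \<open>X\<^sub>j\<close> with a new variable
  \<open>s\<close>, and then \<open>e\<close> for \<open>s\<close>.
\<close>

lemma minst_perturb:
  fixes h :: "'a::comm_ring_1 \<Rightarrow> 'b::comm_ring_1"
  assumes h: "comm_ring_hom h" and F: "F \<in> mpolys n" and j: "j < n"
  shows "\<exists>c. minst h (p(j := p j + e)) F = minst h p F + e * minst h p (mpderiv j F) + e ^ 2 * c"
proof -
  let ?q = "\<lambda>i. if i = j then [:p j, 1:] else [:p i:]"
  let ?P = "minst (\<lambda>c. [:h c:]) ?q F"
  have "comm_ring_hom (\<lambda>P. poly P e)" by unfold_locales auto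
  from comm_ring_hom.hom_minst[OF this, of "\<lambda>c. [:h c:]" ?q F]
  have "poly ?P e = minst h (\<lambda>i. poly (?q i) e) F" by simp
  also have "(\<lambda>i. poly (?q i) e) = p(j := p j + e)" by (auto simp: fun_eq_iff)
  finally have 1: "minst h (p(j := p j + e)) F = poly ?P e" ..
  have q0: "(\<lambda>i. coeff (?q i) 0) = p" by (auto simp: fun_eq_iff)
  have c0: "coeff ?P 0 = minst h p F" unfolding coeff_0_minst[OF h] q0 ..
  have "coeff ?P (Suc 0) = (\<Sum>i<n. minst h p (mpderiv i F) * coeff (?q i) (Suc 0))"
    unfolding coeff_1_minst[OF h F] q0 ..
  also have "\<dots> = (\<Sum>i<n. if i = j then minst h p (mpderiv i F) else 0)"
    by (rule sum.cong) auto
  also have "\<dots> = minst h p (mpderiv j F)" using j by simp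
  finally have c1: "coeff ?P (Suc 0) = minst h p (mpderiv j F)" .
  obtain a P1 where P1: "?P = pCons a P1" by (cases ?P)
  obtain b P2 where P2: "P1 = pCons b P2" by (cases P1)
  have "poly ?P e = a + e * b + e ^ 2 * poly P2 e"
    unfolding P1 P2 by (simp add: algebra_simps power2_eq_square)
  moreover have "a = minst h p F" "b = minst h p (mpderiv j F)"
    using c0 c1 unfolding P1 P2 by simp_all
  ultimately show ?thesis unfolding 1 by blast
qed

text \<open>
  Hensel's lemma: at a point where some partial derivative is nonzero, each tangent direction \<open>v\<close> is the
  velocity of a polynomial curve on which \<open>H\<close> vanishes to any prescribed order.
\<close>

lemma smooth_curve:
  fixes x v :: "nat \<Rightarrow> 'a::field"
  assumes H: "H \<in> mpolys n" and j: "j < n" "ev x (mpderiv j H) \<noteq> 0"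
    and x: "ev x H = 0" and v: "(\<Sum>i<n. ev x (mpderiv i H) * v i) = 0"
  shows "\<exists>\<gamma>. (\<forall>i<n. coeff (\<gamma> i) 0 = x i \<and> coeff (\<gamma> i) (Suc 0) = v i) \<and>
    monom 1 (N + 2) dvd at_curve \<gamma> H"
proof (induction N)
  case 0
  let ?g = "\<lambda>i. [:x i, v i:]"
  have g: "coeff (?g i) 0 = x i \<and> coeff (?g i) (Suc 0) = v i" for i by simp
  from at_curve_first_order[OF H this] x v
  have "coeff (at_curve ?g H) 0 = 0" "coeff (at_curve ?g H) (Suc 0) = 0" by simp_all
  hence "coeff (at_curve ?g H) i = 0" if "i < 2" for i
    using that by (auto simp: less_2_cases_iff)
  hence "monom 1 2 dvd at_curve ?g H" by (simp add: monom_1_dvd_iff')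
  with g show ?case unfolding add_0_left by (intro exI[of _ ?g]) blast
next
  case (Suc N)
  then obtain \<gamma> where \<gamma>: "\<And>i. i < n \<Longrightarrow> coeff (\<gamma> i) 0 = x i \<and> coeff (\<gamma> i) (Suc 0) = v i"
    "monom 1 (N + 2) dvd at_curve \<gamma> H" by blast
  then obtain q where q: "at_curve \<gamma> H = monom 1 (N + 2) * q" by (elim dvdE)
  let ?D = "at_curve \<gamma> (mpderiv j H)"
  have D0: "coeff ?D 0 = ev x (mpderiv j H)"
    by (rule at_curve_first_order(1)[OF mpolys_mpderiv[OF H] \<gamma>(1)])
  \<comment> \<open>The correction of \<open>\<gamma> j\<close> that cancels the lowest coefficient of \<open>H\<close> on the curve.\<close>
  define c where "c = - coeff q 0 / ev x (mpderiv j H)"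
  let ?e = "monom c (N + 2)"
  let ?g = "\<gamma>(j := \<gamma> j + ?e)"
  obtain r where r: "at_curve ?g H = at_curve \<gamma> H + ?e * ?D + ?e ^ 2 * r"
    using minst_perturb[OF pCons_0_hom[OF id_hom] H j(1), of \<gamma> ?e] by blast
  have e: "?e = monom 1 (N + 2) * [:c:]" by (simp add: smult_monom)
  let ?b = "q + [:c:] * ?D + monom 1 (N + 2) * [:c:] ^ 2 * r"
  have eq: "at_curve ?g H = monom 1 (N + 2) * ?b"
  proof -
    have alg: "m * q + m * u * D + (m * u) ^ 2 * r = m * (q + u * D + m * u ^ 2 * r)"
      for m q u D r :: "'a poly"
      by (simp add: power2_eq_square algebra_simps)
    show ?thesis by (subst r, subst q, unfold e) (rule alg)
  qed
  have "coeff ?b 0 = coeff q 0 + c * coeff ?D 0"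
    by (simp add: coeff_monom_mult mult.assoc)
  also have "\<dots> = 0" unfolding D0 c_def using j(2) by simp
  finally have "monom 1 1 dvd ?b" by (simp add: monom_1_dvd_iff')
  hence "monom 1 (N + 2) * monom 1 1 dvd at_curve ?g H" unfolding eq by (rule mult_dvd_mono[OF dvd_refl])
  hence "monom 1 (Suc N + 2) dvd at_curve ?g H" by (simp add: mult_monom)
  moreover have "\<forall>i<n. coeff (?g i) 0 = x i \<and> coeff (?g i) (Suc 0) = v i"
    using \<gamma>(1) by auto
  ultimately show ?case by blast
qed

text \<open>
  If \<open>t\<close> divided \<open>p\<close> at most once, it would divide \<open>p\<^sup>d\<close> at most \<open>d\<close> times.
\<close>

lemma monom_dvd_power:
  fixes p :: "'a::field poly"
  assumes "monom 1 (2 * d + 2) dvd p ^ d"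
  shows "coeff p (Suc 0) = 0"
proof (cases "p = 0")
  case False
  from order_decomp[OF this, of 0] obtain u where u: "p = [:0, 1:] ^ order 0 p * u" "\<not> [:0, 1:] dvd u"
    by auto
  define m where "m = order 0 p"
  have p: "p = monom 1 m * u" using u(1) by (simp add: m_def monom_altdef)
  have u0: "coeff u 0 \<noteq> 0" using u(2) poly_eq_0_iff_dvd[of u 0] by (simp add: poly_0_coeff_0)
  have "p ^ d = monom 1 (m * d) * u ^ d"
    unfolding p by (simp add: power_mult_distrib monom_power)
  hence "coeff (p ^ d) (m * d) = coeff u 0 ^ d" by (simp add: coeff_monom_mult coeff_0_power)
  with u0 have "coeff (p ^ d) (m * d) \<noteq> 0" by simp
  with assms have "2 * d + 2 \<le> m * d" unfolding monom_1_dvd_iff' by (metis not_less)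
  have "2 \<le> m"
  proof (rule ccontr)
    assume "\<not> 2 \<le> m"
    hence "m * d \<le> 1 * d" by (intro mult_le_mono1) simp
    with \<open>2 * d + 2 \<le> m * d\<close> show False by simp
  qed
  thus ?thesis unfolding p by (simp add: coeff_monom_mult)
qed simp

text \<open>
  As \<open>H\<close> may have multiple factors, only a power \<open>F\<^sup>d\<close> is known to be a multiple of it.  On a curve with
  velocity \<open>v\<close> on which \<open>H\<close> vanishes to order \<open>2 d + 2\<close>, this forces \<open>F\<close> to vanish to second order, and the
  coefficient of \<open>t\<close> is the derivative of \<open>F\<close> along \<open>v\<close>.
\<close>

lemma tangent_direction_kills:
  fixes H F :: "'a::alg_closed_field mpoly"
  assumes Hn: "H \<in> mpolys (k + 1)" and H: "lead_coeff (vsplit k H) = 1"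
    and F: "F \<in> mpolys (k + 1)" and van: "\<And>z. z \<in> zeros (k + 1) {H} \<Longrightarrow> meval z F = 0"
    and x: "ev x H = 0" and j: "j < k + 1" "ev x (mpderiv j H) \<noteq> 0"
    and v: "(\<Sum>i<k + 1. ev x (mpderiv i H) * v i) = 0"
  shows "(\<Sum>i<k + 1. ev x (mpderiv i F) * v i) = 0"
proof -
  let ?d = "degree (vsplit k H)"
  have pe: "pt_eval b y (vsplit k G) = ev (b(k := y)) G" for b y and G :: "'a mpoly"
    unfolding pt_eval_def by (rule minst_vsplit[OF id_hom])
  have "vsplit k H dvd vsplit k F ^ ?d"
  proof (rule monic_nullstellensatz[OF H])
    fix b y assume "pt_eval b y (vsplit k H) = 0"
    hence "vec (k + 1) (b(k := y)) \<in> zeros (k + 1) {H}"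
      using Hn by (simp add: pe zeros_def meval_vec)
    from van[OF this] show "pt_eval b y (vsplit k F) = 0" using F by (simp add: pe meval_vec)
  qed
  then obtain Q where "vsplit k F ^ ?d = vsplit k H * Q" by (elim dvdE)
  from arg_cong[OF this, of "\<lambda>P. poly P (mvar k)"] have FQ: "F ^ ?d = H * poly Q (mvar k)"
    by (simp add: poly_vsplit)
  obtain \<gamma> where \<gamma>: "\<And>i. i < k + 1 \<Longrightarrow> coeff (\<gamma> i) 0 = x i \<and> coeff (\<gamma> i) (Suc 0) = v i"
    "monom 1 (2 * ?d + 2) dvd at_curve \<gamma> H"
    using smooth_curve[OF Hn j x v, of "2 * ?d"] by blast
  have "at_curve \<gamma> F ^ ?d = at_curve \<gamma> H * at_curve \<gamma> (poly Q (mvar k))"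
    using arg_cong[OF FQ, of "at_curve \<gamma>"] unfolding at_curve_simps .
  with \<gamma>(2) have "monom 1 (2 * ?d + 2) dvd at_curve \<gamma> F ^ ?d" by simp
  hence "coeff (at_curve \<gamma> F) (Suc 0) = 0" by (rule monom_dvd_power)
  moreover have "coeff (at_curve \<gamma> F) (Suc 0) = (\<Sum>i<k + 1. ev x (mpderiv i F) * v i)"
    by (rule at_curve_first_order(2)[OF F]) (rule \<gamma>(1))
  ultimately show ?thesis by simp
qed

text \<open>
  The tangent space is the hyperplane orthogonal to the gradient of \<open>H\<close>: on it all generators of the
  vanishing ideal have derivative zero by \<open>tangent_direction_kills\<close>, and conversely \<open>H\<close> is a combination
  of the generators.  So its dimension \<open>k\<close> is the local dimension.
\<close>

lemma nonsingular_of_gradient: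
  fixes H :: "'a::alg_closed_field mpoly"
  assumes Hn: "H \<in> mpolys (k + 1)" and H: "lead_coeff (vsplit k H) = 1"
    and j: "j < k + 1" "meval x (mpderiv j H) \<noteq> 0"
  shows "\<not> singular_point (k + 1) (zeros (k + 1) {H}) x"
proof
  let ?n = "k + 1" and ?V = "zeros (k + 1) {H}"
  assume "singular_point ?n ?V x"
  then obtain Fs where xV: "x \<in> ?V" and gen: "generates_ideal ?n Fs (vanishing_ideal ?n ?V)"
    and ne: "ereal (real (kernel_dim (jacobian_matrix ?n Fs x))) \<noteq> local_dim ?n ?V x"
    by (auto simp: singular_point_def)
  let ?x = "\<lambda>i. x $ i" and ?m = "length Fs" and ?J = "jacobian_matrix ?n Fs x"
  have Fs: "Fs ! l \<in> mpolys ?n" if "l < ?m" for l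
    using gen that by (auto simp: generates_ideal_def)
  have I: "vanishing_ideal ?n ?V = {\<Sum>i<?m. G i * Fs ! i | G. \<forall>i<?m. G i \<in> mpolys ?n}"
    using gen by (simp add: generates_ideal_def)
  have FsI: "Fs ! l \<in> vanishing_ideal ?n ?V" if "l < ?m" for l
    unfolding I
  proof (rule CollectI, intro exI conjI allI impI)
    have "(\<Sum>i<?m. (if i = l then 1 else 0) * Fs ! i) = (\<Sum>i<?m. if i = l then Fs ! i else 0)"
      by (rule sum.cong) auto
    also have "\<dots> = Fs ! l" using that by simp
    finally show "Fs ! l = (\<Sum>i<?m. (if i = l then 1 else 0) * Fs ! i)" ..
  qed auto
  have xH: "ev ?x H = 0" using xV by (simp add: zeros_def meval_eq_minst)
  have xc: "x \<in> carrier_vec ?n" using xV by (simp add: zeros_def)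
  have jH: "ev ?x (mpderiv j H) \<noteq> 0" using j(2) by (simp add: meval_eq_minst)
  have HI: "H \<in> vanishing_ideal ?n ?V" using Hn by (auto simp: vanishing_ideal_def zeros_def)
  let ?w = "vec ?n (\<lambda>i. ev ?x (mpderiv i H))"
  have J: "?J \<in> carrier_mat ?m ?n" by (simp add: jacobian_matrix_def)
  have Jv: "?J *\<^sub>v v = 0\<^sub>v ?m \<longleftrightarrow> (\<forall>l<?m. (\<Sum>i<?n. ev ?x (mpderiv i (Fs ! l)) * v $ i) = 0)"
    if "v \<in> carrier_vec ?n" for v
  proof -
    have "(?J *\<^sub>v v) $ l = (\<Sum>i<?n. ev ?x (mpderiv i (Fs ! l)) * v $ i)" if "l < ?m" for l
      using that \<open>v \<in> carrier_vec ?n\<close>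
      by (simp add: jacobian_matrix_def scalar_prod_def lessThan_atLeast0 meval_eq_minst del: sum.op_ivl_Suc)
    moreover have "?J *\<^sub>v v = 0\<^sub>v ?m \<longleftrightarrow> (\<forall>l<?m. (?J *\<^sub>v v) $ l = 0)"
      using J by (auto simp: vec_eq_iff)
    ultimately show ?thesis by auto
  qed
  have wv: "?w \<bullet> v = (\<Sum>i<?n. ev ?x (mpderiv i H) * v $ i)" if "v \<in> carrier_vec ?n" for v
    using that by (simp add: scalar_prod_def lessThan_atLeast0 del: sum.op_ivl_Suc)
  have iff: "?J *\<^sub>v v = 0\<^sub>v ?m \<longleftrightarrow> ?w \<bullet> v = 0" if v: "v \<in> carrier_vec ?n" for v
  proof
    assume "?w \<bullet> v = 0"
    hence dH: "(\<Sum>i<?n. ev ?x (mpderiv i H) * v $ i) = 0" unfolding wv[OF v] .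
    show "?J *\<^sub>v v = 0\<^sub>v ?m"
      unfolding Jv[OF v]
    proof (intro allI impI)
      fix l assume "l < ?m"
      hence van: "meval z (Fs ! l) = 0" if "z \<in> ?V" for z
        using FsI that by (auto simp: vanishing_ideal_def)
      show "(\<Sum>i<?n. ev ?x (mpderiv i (Fs ! l)) * v $ i) = 0"
        by (rule tangent_direction_kills[OF Hn H Fs[OF \<open>l < ?m\<close>] van xH j(1) jH dH])
    qed
  next
    assume "?J *\<^sub>v v = 0\<^sub>v ?m"
    hence dF: "\<And>l. l < ?m \<Longrightarrow> (\<Sum>i<?n. ev ?x (mpderiv i (Fs ! l)) * v $ i) = 0"
      unfolding Jv[OF v] by blast
    from HI obtain G where G: "H = (\<Sum>i<?m. G i * Fs ! i)" unfolding I by blast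
    let ?g = "\<lambda>i. [:?x i, v $ i:]"
    have g: "coeff (?g i) 0 = ?x i \<and> coeff (?g i) (Suc 0) = v $ i" for i by simp
    have "coeff (at_curve ?g (Fs ! l)) 0 = 0" "coeff (at_curve ?g (Fs ! l)) (Suc 0) = 0" if l: "l < ?m" for l
    proof -
      show "coeff (at_curve ?g (Fs ! l)) (Suc 0) = 0"
        unfolding at_curve_first_order(2)[OF Fs[OF l] g] by (rule dF[OF l])
      have "meval x (Fs ! l) = 0" using FsI[OF l] xV by (auto simp: vanishing_ideal_def)
      thus "coeff (at_curve ?g (Fs ! l)) 0 = 0"
        unfolding at_curve_first_order(1)[OF Fs[OF l] g] by (simp add: meval_eq_minst)
    qed
    hence "coeff (at_curve ?g (G l) * at_curve ?g (Fs ! l)) (Suc 0) = 0" if "l < ?m" for l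
      using that by (simp add: coeff_1_mult)
    hence "coeff (at_curve ?g H) (Suc 0) = 0"
      unfolding G at_curve_simps coeff_sum by simp
    thus "?w \<bullet> v = 0" unfolding wv[OF v] at_curve_first_order(2)[OF Hn g] .
  qed
  have "mat_kernel ?J = {v \<in> carrier_vec ?n. ?w \<bullet> v = 0}"
    unfolding mat_kernel[OF J] using iff by blast
  from kernel_dim_hyperplane[OF J _ j(1) _ this] jH j(1) have "kernel_dim ?J = k" by simp
  with ne local_dim_monic_hypersurface[OF Hn H xV] show False by simp
qed

section \<open>Gradient and singular points of the hypersurface\<close>

lemma poly_lift_poly: "poly (poly (map_poly (\<lambda>a. [:a:]) S) q) t = poly S (poly q t)"
  for S q :: "'b::comm_ring_1 poly"
  by (induction S) (simp_all add: map_poly_pCons)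

lemma poly_lift_X: "poly (map_poly (\<lambda>a. [:a:]) S) [:0, 1:] = S"
  for S :: "'b::comm_ring_1 poly"
  by (induction S) (simp_all add: map_poly_pCons)

lemma to_ac_hom: "comm_ring_hom to_ac"
  by unfold_locales simp_all

definition H_poly_ac :: "nat \<Rightarrow> 'a::field poly \<Rightarrow> 'a alg_closure mpoly" where
  "H_poly_ac k f = Poly_Mapping.map to_ac (H_poly k f)"

lemma minst_H_poly_ac:
  fixes h :: "'a::field alg_closure \<Rightarrow> 'c::idom"
  shows "comm_ring_hom h \<Longrightarrow> minst h p (H_poly_ac k f) = minst (\<lambda>c. h (to_ac c)) p (H_poly k f)"
  unfolding H_poly_ac_def by (rule minst_map[OF to_ac_hom])

lemma H_poly_ac_mpolys: "H_poly_ac k f \<in> mpolys (k + 1)"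
  unfolding H_poly_ac_def by (rule mpolys_map[OF to_ac_hom H_poly_mpolys])

lemma map_poly_comp_hom:
  assumes "comm_ring_hom g" "comm_ring_hom h"
  shows "map_poly (\<lambda>c. h (g c)) f = map_poly h (map_poly g f)" "comm_ring_hom (\<lambda>c. h (g c))"
proof -
  interpret g: comm_ring_hom g by fact
  interpret h: comm_ring_hom h by fact
  show "map_poly (\<lambda>c. h (g c)) f = map_poly h (map_poly g f)"
    by (rule poly_eqI) (simp only: coeff_map_poly g.hom_zero h.hom_zero)
  show "comm_ring_hom (\<lambda>c. h (g c))"
    by unfold_locales (simp_all only: g.hom_add h.hom_add g.hom_mult h.hom_mult
      g.hom_zero h.hom_zero g.hom_one h.hom_one)
qed

lemma map_poly_root_prod:
  fixes h :: "'b::idom \<Rightarrow> 'c::idom"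
  assumes "comm_ring_hom h"
  shows "map_poly h ((\<Prod>i\<in>A. root_poly (p i)) * S + R) =
    (\<Prod>i\<in>A. root_poly (h (p i))) * map_poly h S + map_poly h R"
proof -
  interpret comm_ring_hom h by fact
  interpret M: map_poly_comm_ring_hom h ..
  have "map_poly h (root_poly c) = root_poly (h c)" for c
    by (rule poly_eqI) (simp add: coeff_map_poly coeff_pCons hom_uminus split: nat.splits)
  thus ?thesis unfolding M.hom_add M.hom_mult M.hom_prod by simp
qed

text \<open>
  By \<open>minst_H_poly_last\<close>, \<open>H\<^sub>f\<close> in its last variable is the quotient of \<open>f\<close> by \<open>\<Prod>\<^bsub>i<k\<^esub>(T - X\<^sub>i)\<close>.
\<close>

lemma vsplit_H_poly_ac_monic:
  fixes f :: "'a::field poly"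
  assumes f: "degree f = k + d" "lead_coeff f = 1"
  shows "lead_coeff (vsplit k (H_poly_ac k f)) = 1"
proof -
  let ?q = "\<lambda>i. if i = k then [:0, 1:] else [:mvar i :: 'a alg_closure mpoly:]"
  let ?g = "\<lambda>c. mconst (to_ac c) :: 'a alg_closure mpoly"
  note hg = map_poly_comp_hom(2)[OF to_ac_hom mconst_hom.comm_ring_hom_axioms]
  note lift = pCons_0_hom[OF id_hom[where 'a = "'a alg_closure mpoly"]]
  let ?F = "map_poly ?g f"
  have F: "lead_coeff ?F = 1" "degree ?F = k + d"
    using hom_lead_coeff_monic[OF hg f(2)] f(1) by simp_all
  obtain S R where SR: "?F = (\<Prod>i<k. root_poly (mvar i)) * S + R"
    "R = 0 \<or> degree R < degree (\<Prod>i<k. root_poly (mvar i :: 'a alg_closure mpoly))"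
    using monic_division[OF lead_coeff_prod_root_poly] by metis
  hence R: "R = 0 \<or> degree R < k" by (simp only: degree_prod_root_poly[OF finite_lessThan] card_lessThan)
  let ?S = "map_poly (\<lambda>a. [:a:]) S" and ?R = "map_poly (\<lambda>a. [:a:]) R"
  have "map_poly (\<lambda>c. [:?g c:]) f = map_poly (\<lambda>a. [:a:]) ?F"
    by (rule map_poly_comp_hom(1)[OF hg lift])
  also have "\<dots> = (\<Prod>i<k. root_poly [:mvar i:]) * ?S + ?R"
    unfolding SR(1) by (rule map_poly_root_prod[OF lift])
  also have "(\<Prod>i<k. root_poly [:mvar i:]) = (\<Prod>i<k. root_poly (?q i))"
    by (rule prod.cong) auto
  finally have div: "map_poly (\<lambda>c. [:?g c:]) f = (\<Prod>i<k. root_poly (?q i)) * ?S + ?R" .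
  have R': "?R = 0 \<or> degree ?R < k"
    using R degree_map_poly_le[of "\<lambda>a. [:a:]" R] by auto
  have "vsplit k (H_poly_ac k f) = minst (\<lambda>c. [:?g c:]) ?q (H_poly k f)"
    unfolding vsplit_def by (rule minst_H_poly_ac[OF const_mconst_hom])
  also have "\<dots> = poly ?S (?q k)"
    by (rule minst_H_poly_last[OF map_poly_comp_hom(2)[OF hg lift] div R'])
  also have "\<dots> = S" by (simp only: poly_lift_X if_True refl)
  finally show ?thesis using quotient_monic(2)[OF SR(1) R F(2,1)] by simp
qed

text \<open>
  The coefficient of \<open>t\<close> in \<open>H_poly_shift\<close> for \<open>e = t\<close>.
\<close>

lemma gradient_H_poly_ac:
  fixes f :: "'a::field poly"
  assumes div: "map_poly to_ac f = (\<Prod>i<k + 1. root_poly (u i)) * S + R" and deg: "degree R \<le> k"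
    and i: "i < k + 1"
  shows "ev u (mpderiv i (H_poly_ac k f)) = poly S (u i)"
proof -
  note lift = pCons_0_hom[OF id_hom[where 'a = "'a alg_closure"]]
  let ?p = "\<lambda>i. [:u i:]" and ?e = "[:0, 1 :: 'a alg_closure:]"
  let ?S = "map_poly (\<lambda>a. [:a:]) S" and ?R = "map_poly (\<lambda>a. [:a:]) R"
  let ?H = "H_poly_ac k f"
  have mn: "at_curve g ?H = minst (\<lambda>c. [:to_ac c:]) g (H_poly k f)" for g
    by (rule minst_H_poly_ac[OF lift])
  have "map_poly (\<lambda>c. [:to_ac c:]) f = map_poly (\<lambda>a. [:a:]) (map_poly to_ac f)"
    by (rule map_poly_comp_hom(1)[OF to_ac_hom lift])
  also have "\<dots> = (\<Prod>i<k + 1. root_poly (?p i)) * ?S + ?R"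
    unfolding div by (rule map_poly_root_prod[OF lift])
  finally have div': "map_poly (\<lambda>c. [:to_ac c:]) f = (\<Prod>i<k + 1. root_poly (?p i)) * ?S + ?R" .
  have deg': "degree ?R \<le> k" using deg degree_map_poly_le[of "\<lambda>a. [:a:]" R] by linarith
  have shift: "at_curve (?p(i := ?p i + ?e)) ?H = at_curve ?p ?H + ?e * poly ?S (?p i + ?e)"
    unfolding mn
    by (rule H_poly_shift[OF map_poly_comp_hom(2)[OF to_ac_hom lift] div' deg']) (use i in simp)
  have "coeff (at_curve ?p ?H) (Suc 0) = (\<Sum>j<k + 1. ev u (mpderiv j ?H) * 0)"
    by (rule at_curve_first_order(2)[OF H_poly_ac_mpolys]) simp
  hence 0: "coeff (at_curve ?p ?H) (Suc 0) = 0" by simp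
  have "coeff (at_curve (?p(i := ?p i + ?e)) ?H) (Suc 0) =
      (\<Sum>j<k + 1. ev u (mpderiv j ?H) * (if j = i then 1 else 0))"
    by (rule at_curve_first_order(2)[OF H_poly_ac_mpolys]) simp
  also have "\<dots> = (\<Sum>j<k + 1. if j = i then ev u (mpderiv j ?H) else 0)"
    by (rule sum.cong) auto
  also have "\<dots> = ev u (mpderiv i ?H)" using i by simp
  finally have "ev u (mpderiv i ?H) = coeff (?e * poly ?S (?p i + ?e)) (Suc 0)"
    unfolding shift coeff_add 0 by simp
  also have "\<dots> = poly (poly ?S (?p i + ?e)) 0" by (simp add: poly_0_coeff_0)
  also have "\<dots> = poly S (u i)" unfolding poly_lift_poly by simp
  finally show ?thesis .
qed

text \<open>
  All partial derivatives vanish at \<open>x\<close>, so each coordinate of \<open>x\<close> is a root of the quotient \<open>S\<close> of \<open>f\<close> by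
  \<open>\<Prod>(T - x\<^sub>i)\<close>.  This quotient is monic of degree \<open>d - 1\<close>.
\<close>

lemma singular_point_few_coordinates:
  fixes f :: "'a::field poly" and x :: "'a alg_closure vec"
  assumes f: "degree f = k + d" "lead_coeff f = 1" and d: "0 < d"
    and x: "x \<in> singular_locus (k + 1) (V_hyp k f)"
  shows "x \<in> carrier_vec (k + 1)" "card ((\<lambda>i. x $ i) ` {..<k + 1}) \<le> d - 1"
proof -
  let ?H = "H_poly_ac k f" and ?u = "\<lambda>i. x $ i"
  have sing: "singular_point (k + 1) (zeros (k + 1) {?H}) x"
    using x by (simp add: singular_locus_def V_hyp_def H_poly_ac_def)
  thus "x \<in> carrier_vec (k + 1)" by (simp add: singular_point_def zeros_def)
  have grad: "ev ?u (mpderiv i ?H) = 0" if "i < k + 1" for i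
    using nonsingular_of_gradient[OF H_poly_ac_mpolys vsplit_H_poly_ac_monic[OF f] that] sing
    unfolding meval_eq_minst by blast
  have F: "degree (map_poly to_ac f) = k + 1 + (d - 1)" "lead_coeff (map_poly to_ac f) = 1"
    using hom_lead_coeff_monic[OF to_ac_hom f(2)] f(1) d by simp_all
  obtain S R where SR: "map_poly to_ac f = (\<Prod>i<k + 1. root_poly (?u i)) * S + R" "degree R \<le> k"
    using ex_division_nodes[of "map_poly to_ac f" ?u k] by metis
  have "degree S = d - 1" "lead_coeff S = 1"
    by (rule quotient_monic[OF SR(1) _ F], use SR(2) in simp)+
  hence S: "degree S = d - 1" "S \<noteq> 0" by auto
  have "?u ` {..<k + 1} \<subseteq> {y. poly S y = 0}"
    using grad gradient_H_poly_ac[OF SR] by auto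
  hence "card (?u ` {..<k + 1}) \<le> card {y. poly S y = 0}"
    by (rule card_mono[OF poly_roots_finite[OF S(2)]])
  also have "\<dots> \<le> d - 1" using card_poly_roots_bound[OF S(2)] S(1) by simp
  finally show "card (?u ` {..<k + 1}) \<le> d - 1" .
qed

text \<open>
  A vector with at most \<open>m\<close> distinct coordinates is given by their values \<open>u\<close> and by the map \<open>\<pi>\<close> that
  tells which of them stands at which place.
\<close>

lemma few_coordinates_parametrised:
  fixes x :: "'b::field vec"
  assumes x: "x \<in> carrier_vec n" and card: "card ((\<lambda>i. x $ i) ` {..<n}) \<le> m"
  shows "\<exists>\<pi>\<in>{..<n} \<rightarrow>\<^sub>E {..<m}. \<exists>u. x = vec n (\<lambda>i. ev u (mvar (\<pi> i)))"
proof -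
  let ?A = "(\<lambda>i. x $ i) ` {..<n}"
  have "finite ?A" by simp
  from ex_bij_betw_nat_finite[OF this] obtain h where h: "bij_betw h {0..<card ?A} ?A" by blast
  have "\<exists>l. l < m \<and> h l = x $ i" if i: "i < n" for i
  proof -
    have "x $ i \<in> h ` {0..<card ?A}" using h i by (simp add: bij_betw_def)
    then obtain l where "l < card ?A" "h l = x $ i" by fastforce
    with card show ?thesis by (intro exI[of _ l]) simp
  qed
  then obtain p where p: "\<And>i. i < n \<Longrightarrow> p i < m \<and> h (p i) = x $ i" by metis
  have "x = vec n (\<lambda>i. ev h (mvar (restrict p {..<n} i)))"
    using x p by (intro eq_vecI) (auto simp: ev_simps)
  moreover have "restrict p {..<n} \<in> {..<n} \<rightarrow>\<^sub>E {..<m}" using p by auto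
  ultimately show ?thesis by blast
qed

lemma monic_monom_plus_lower:
  fixes a :: "nat \<Rightarrow> 'a::field"
  assumes "f = monom 1 (k + d) + (\<Sum>i<d. monom (a i) (k + i))"
  shows "degree f = k + d" "lead_coeff f = 1"
proof -
  have c: "coeff (\<Sum>i<d. monom (a i) (k + i)) j = 0" if "k + d \<le> j" for j
    unfolding coeff_sum using that by (intro sum.neutral) auto
  have 1: "coeff f (k + d) = 1" unfolding assms by (simp add: c)
  moreover have "degree f \<le> k + d"
    by (rule degree_le) (auto simp: assms c)
  ultimately show "degree f = k + d" by (metis le_antisym le_degree zero_neq_one)
  with 1 show "lead_coeff f = 1" by simp
qed

theorem corollary3p3:
  fixes f :: "'a::{field, finite} poly" and a :: "nat \<Rightarrow> 'a" and d k :: nat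
  assumes "0 < d" and "0 < k" and "d < k"
    and "f = Polynomial.monom 1 (k + d) + (\<Sum>i<d. Polynomial.monom (a i) (k + i))"
  shows "variety_dim (k + 1) (singular_locus (k + 1) (V_hyp k f)) \<le> ereal (real d - 1)"
proof -
  let ?n = "k + 1" and ?m = "d - 1"
  note f = monic_monom_plus_lower[OF assms(4)]
  let ?Params = "(\<lambda>\<pi> i. mvar (\<pi> i) :: 'a alg_closure mpoly) ` ({..<?n} \<rightarrow>\<^sub>E {..<?m})"
  have "variety_dim ?n (singular_locus ?n (V_hyp k f)) \<le> ereal (real ?m)"
  proof (rule variety_dim_le)
    show "finite ?Params" by (intro finite_imageI finite_PiE) auto
    show "q i \<in> mpolys ?m" if "q \<in> ?Params" "i < ?n" for q i
      using that by (auto intro!: mpolys_mvar)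
    show "singular_locus ?n (V_hyp k f) \<subseteq> (\<Union>q\<in>?Params. range (\<lambda>u. vec ?n (\<lambda>i. ev u (q i))))"
    proof
      fix x assume "x \<in> singular_locus ?n (V_hyp k f)"
      from few_coordinates_parametrised[OF singular_point_few_coordinates[OF f assms(1) this]]
      show "x \<in> (\<Union>q\<in>?Params. range (\<lambda>u. vec ?n (\<lambda>i. ev u (q i))))" by blast
    qed
  qed
  also have "real ?m = real d - 1" using assms(1) by simp
  finally show ?thesis .
qed

end
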